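(* Let the data and the discretization satisfy all assumptions listed in the context. Let $n\in\{1,\dots,N\}$ and let $(\mathbf u_0,\dots,\mathbf u_{n-1})$, $\mathbf u_\nu=(u_{\nu,i})_{i\in I}\in(\mathbb R^+_0)^I$, be a nonnegative solution of the finite volume scheme up to time step $n-1$, i.e. $u_{0,i}=\theta_{{\rm init},i}$ for all $i\in I$ and $\mathcal H_{\nu,i}(\mathbf u_{\nu-1},\mathbf u_\nu)=0$ for all $i\in I$, $\nu\in\{1,\dots,n-1\}$. Let $$m(\mathbf u_{n-1}):=\min\{\theta_{\rm ext},\,\|\mathbf u_{n-1}\|_{\min}\},\qquad M_n(\mathbf u_{n-1}):=\max\Big\{\theta_{\rm ext},\,\|\mathbf u_{n-1}\|_{\max}+\frac{k_n}{C_\varepsilon}B_{f,n}\Big\}.$$ Then each $\mathbf u_n\in(\mathbb R^+_0)^I$ with $\mathcal H_{n,i}(\mathbf u_{n-1},\mathbf u_n)=0$ for all $i\in I$ lies in $[m(\mathbf u_{n-1}),M_n(\mathbf u_{n-1})]^I$. Furthermore, if $k_n$ satisfies $$k_n\Big((L_{V,\Gamma_\Omega}+L_{V,\partial\Omega\setminus\Gamma_\Omega}+L_{V,\Sigma})\,l_g^1(M_n(\mathbf u_{n-1}))+(L_{V,\Gamma_\Omega}+L_{V,\Sigma})\,l_g^2(M_n(\mathbf u_{n-1}))+L_{V,\partial\Omega\setminus\Gamma_\Omega}\,l_g^3(M_n(\mathbf u_{n-1}))\Big)<C_\varepsilon,$$ then there is a unique $\mathbf u_n\in(\mathbb R^+_0)^I$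 with $\mathcal H_{n,i}(\mathbf u_{n-1},\mathbf u_n)=0$ for all $i\in I$.
   Context: Notation: $\mathbb R^+=(0,\infty)$, $\mathbb R^+_0=[0,\infty)$; $\lambda_d$ is $d$-dimensional (surface) measure; $\|\cdot\|_2$ is the Euclidean norm; for a finite vector $\mathbf u=(u_i)$, $\|\mathbf u\|_{\min}:=\min_i u_i$, $\|\mathbf u\|_{\max}:=\max_i u_i$. A partition of a polyhedral set consists of finitely many (relatively) open, pairwise disjoint pieces which cover it up to boundaries of the pieces. Domain: $T>0$, $\overline\Omega=\overline\Omega_{\mathrm s}\cup\overline\Omega_{\mathrm g}$, $\Omega_{\mathrm s}\cap\Omega_{\mathrm g}=\emptyset$, where $\Omega,\Omega_{\mathrm s},\Omega_{\mathrm g}$ are nonvoid, polyhedral, bounded, open subsets of $\mathbb R^3$; $\partial\Omega_{\mathrm s}$ is the disjoint union of $\partial\Omega$ and $\partial\Omega_{\mathrm g}$. Put $\Sigma:=\partial\Omega_{\mathrm g}=\overline\Omega_{\mathrm s}\cap\overline\Omega_{\mathrm g}$ (a Lipschitz interface), so $\partial\Omega=\partial\Omega_{\mathrm s}\setminus\Sigma$. Put $O:=\mathrm{int}(\mathrm{conv}(\overline\Omega))\setminus\overline\Omega$, $\Gamma:=\partial O$, $\Gamma_\Omega:=\overline\Omega\cap\overline O$, $\Gamma_{\rm ph}:=\partial\,\mathrm{conv}(\overline\Omega)\cap\partial O$; $\Gamma_\Omega,\Gamma_{\rm ph}$ partition $\Gamma$. Data: for $m\in\{\mathrm s,\mathrm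 g\}$, $\varepsilon_m:\mathbb R^+_0\to\mathbb R^+_0$ is continuous and there is $C_\varepsilon\in\mathbb R^+$ with $\varepsilon_m(\theta_2)\ge(\theta_2-\theta_1)C_\varepsilon+\varepsilon_m(\theta_1)$ for $\theta_2\ge\theta_1\ge0$; $\kappa_m\in\mathbb R^+_0$; $f_m\in L^\infty(]0,T[\times\Omega_m)$, $f_m\ge0$ a.e.; $\sigma\in\mathbb R^+$; $\theta_{\rm ext}\in\mathbb R^+$; $\theta_{\rm init}\in L^\infty(\Omega,\mathbb R^+)$. The emissivity $\epsilon:\mathbb R^+_0\to\,]0,1]$ is locally Lipschitz: for each $r\ge0$, $L_{\epsilon,r}:=\sup\{|\epsilon(\theta_1)-\epsilon(\theta_2)|/|\theta_1-\theta_2|:\theta_1,\theta_2\in[0,r],\theta_1\ne\theta_2\}<\infty$ ($L_{\epsilon,0}:=0$). Put $\epsilon_{\min,r}:=\min_{[0,r]}\epsilon>0$. The negative variation is $\mathrm{var}^-\epsilon(0):=0$ and, for $\lambda>0$, $\mathrm{var}^-\epsilon(\lambda):=\sup\sum_{l=1}^n\big(-\min\{0,\epsilon(s_l)-\epsilon(s_{l-1})\}\big)$ over all $0=s_0<\dots<s_n=\lambda$. Discretization: $0=t_0<\dots<t_N=T$, $N\in\mathbb N$, $k_\nu:=t_\nu-t_{\nu-1}$. $(\omega_i)_{i\in I}$ is a finite partition of $\Omega$ into nonvoid, polyhedral, connected, open subsets; $\omega_{m,i}:=\omega_i\cap\Omega_m$, $I_m:=\{j\in I:\omega_{m,j}\ne\emptyset\}$.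 For each $i\in I$, $\partial_{\rm reg}\omega_{\mathrm s,i}\cap\Sigma=\partial_{\rm reg}\omega_{\mathrm g,i}\cap\Sigma$, where $\partial_{\rm reg}$ is the part of the boundary where a unique outer unit normal exists ($\partial_{\rm reg}\emptyset=\emptyset$). Points $x_i\in\overline\omega_i$ are given such that: $x_i\in\overline\omega_{m,i}$ for $i\in I_m$; if $\lambda_2(\overline\omega_i\cap\Gamma_\Omega)\ne0$, then $x_i\in\overline\omega_i\cap\Gamma_\Omega$; if $\lambda_2(\overline\omega_i\cap(\partial\Omega\setminus\Gamma_\Omega))\ne0$, then $x_i\in\overline\omega_i\cap\overline{\partial\Omega\setminus\Gamma_\Omega}$. Put $\mathrm{nb}_m(i):=\{j\in I_m\setminus\{i\}:\lambda_2(\partial\omega_{m,i}\cap\partial\omega_{m,j})\ne0\}$, $\mathrm{nb}(i):=\{j\in I\setminus\{i\}:\lambda_2(\partial\omega_i\cap\partial\omega_j)\ne0\}$; for $i\in I$, $j\in\mathrm{nb}(i)$: $x_i\ne x_j$ and $(x_j-x_i)/\|x_i-x_j\|_2$ equals the outer unit normal of $\omega_i$ on $\partial\omega_i\cap\partial\omega_j$. Boundary elements: $(\zeta_\alpha)_{\alpha\in I_\Omega}$ and $(\zeta_\alpha)_{\alpha\in I_\Sigma}$ are finite partitions of $\Gamma_\Omega$ and $\Sigma$, respectively, into nonvoid, polyhedral, connected, relatively open sets, each lying in a plane; $I_\Omega\cap I_\Sigma=\emptyset$, $\mathrm{ph}\notin I_\Omega\cup I_\Sigma$; $\zeta_{\rm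 ph}:=\Gamma_{\rm ph}$, $I_\Gamma:=I_\Omega\cup\{\mathrm{ph}\}$. For each $\alpha\in I_\Omega$ (resp. $I_\Sigma$) there is a unique $i(\alpha)\in I$ with $\zeta_\alpha\subseteq\partial\omega_{i(\alpha)}\cap\Gamma_\Omega$ (resp. $\zeta_\alpha\subseteq\partial\omega_{\mathrm s,i(\alpha)}\cap\Sigma$); moreover $x_{i(\alpha)}\in\overline\zeta_\alpha$. Put $J_{\Omega,i}:=\{\alpha\in I_\Omega:\lambda_2(\zeta_\alpha\cap\partial\omega_i)\ne0\}$, $J_{\Sigma,i}:=\{\alpha\in I_\Sigma:\lambda_2(\zeta_\alpha\cap\partial\omega_{\mathrm s,i})\ne0\}$. View factors: for $(S,D)=(\Sigma,\Omega_{\mathrm g})$ or $(\Gamma,O)$ let $\vec n$ be the a.e. defined unit normal on $S=\partial D$ pointing into $D$, $\omega(x,y):=\dfrac{(\vec n(y)\cdot(x-y))\,(\vec n(x)\cdot(y-x))}{\pi\,((y-x)\cdot(y-x))^2}$, and $\Lambda(x,y):=1$ if $x,y\in S$ are mutually visible, i.e. the open segment $]x,y[$ is contained in $D$, and $\Lambda(x,y):=0$ otherwise. For $(\alpha,\beta)\in(I_\Sigma\times I_\Sigma)\cup(I_\Gamma\times I_\Gamma)$ put $\Lambda_{\alpha,\beta}:=\int_{\zeta_\alpha\times\zeta_\beta}\Lambda\,\omega$. These numbers are nonnegative and symmetric, with $\sum_{\beta\in I_\Sigma}\Lambda_{\alpha,\beta}=\lambda_2(\zeta_\alpha)$ for $\alpha\in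 I_\Sigma$ and $\sum_{\beta\in I_\Gamma}\Lambda_{\alpha,\beta}=\lambda_2(\zeta_\alpha)$ for $\alpha\in I_\Gamma$. Discrete radiation operators: for $\mathbf u\in(\mathbb R^+_0)^{I_\Omega}$ (resp. $(\mathbb R^+_0)^{I_\Sigma}$) let $E_{\Gamma,\alpha}(\mathbf u)$ (resp. $E_{\Sigma,\alpha}(\mathbf u)$) $:=\sigma\epsilon(u_\alpha)u_\alpha^4\lambda_2(\zeta_\alpha)$; for $\alpha\in I_\Omega$, $E_{{\rm ph},\alpha}(\mathbf u):=\sigma(1-\epsilon(u_\alpha))\theta_{\rm ext}^4\Lambda_{\alpha,{\rm ph}}$; $G_{\Gamma,\alpha,\beta}(\mathbf u)$ (for $\alpha,\beta\in I_\Omega$), resp. $G_{\Sigma,\alpha,\beta}(\mathbf u)$ (for $\alpha,\beta\in I_\Sigma$), is $\delta_{\alpha\beta}\lambda_2(\zeta_\alpha)-(1-\epsilon(u_\alpha))\Lambda_{\alpha,\beta}$. The matrices $\mathbf G_\Gamma(\mathbf u),\mathbf G_\Sigma(\mathbf u)$ are strictly diagonally dominant, hence invertible. Put $\mathbf R_\Gamma(\mathbf u):=\mathbf G_\Gamma(\mathbf u)^{-1}(\mathbf E_\Gamma(\mathbf u)+\mathbf E_{\rm ph}(\mathbf u))$, $\mathbf R_\Sigma(\mathbf u):=\mathbf G_\Sigma(\mathbf u)^{-1}\mathbf E_\Sigma(\mathbf u)$, $V_{\Gamma,\alpha}(\mathbf u):=\epsilon(u_\alpha)\sum_{\beta\in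 I_\Omega}R_{\Gamma,\beta}(\mathbf u)\Lambda_{\alpha,\beta}+\sigma\epsilon(u_\alpha)\theta_{\rm ext}^4\Lambda_{\alpha,{\rm ph}}$ ($\alpha\in I_\Omega$), $V_{\Sigma,\alpha}(\mathbf u):=\epsilon(u_\alpha)\sum_{\beta\in I_\Sigma}R_{\Sigma,\beta}(\mathbf u)\Lambda_{\alpha,\beta}$ ($\alpha\in I_\Sigma$). For $\mathbf u\in(\mathbb R^+_0)^I$: $\mathbf u|_{I_\Omega}:=(u_{i(\alpha)})_{\alpha\in I_\Omega}$, $\mathbf u|_{I_\Sigma}:=(u_{i(\alpha)})_{\alpha\in I_\Sigma}$. Source and initial approximations: $f_{m,\nu,i}$ and $\theta_{{\rm init},i}$ are given real numbers with $0\le\operatorname{ess\,inf}(f_m|_{]t_{\nu-1},t_\nu[\times\omega_{m,i}})\le f_{m,\nu,i}\le\|f_m\|_{L^\infty(]t_{\nu-1},t_\nu[\times\omega_{m,i})}$ for $m\in\{\mathrm s,\mathrm g\}$, $\nu\in\{1,\dots,N\}$, $i\in I_m$ (terms with $\omega_{m,i}=\emptyset$ contribute $0$), and $0\le\operatorname{ess\,inf}(\theta_{\rm init}|_{\omega_i})\le\theta_{{\rm init},i}\le\|\theta_{\rm init}\|_{L^\infty(\omega_i)}$ for $i\in I$. Scheme operator: for $\nu\in\{1,\dots,N\}$, $i\in I$, $\mathcal H_{\nu,i}:(\mathbb R^+_0)^I\times(\mathbb R^+_0)^I\to\mathbb R$, $$\begin{aligned}\mathcal H_{\nu,i}(\tilde{\mathbf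 u},\mathbf u)=\;&k_\nu^{-1}\sum_{m\in\{\mathrm s,\mathrm g\}}(\varepsilon_m(u_i)-\varepsilon_m(\tilde u_i))\lambda_3(\omega_{m,i})-\sum_{m\in\{\mathrm s,\mathrm g\}}\kappa_m\sum_{j\in\mathrm{nb}_m(i)}\frac{u_j-u_i}{\|x_i-x_j\|_2}\lambda_2(\partial\omega_{m,i}\cap\partial\omega_{m,j})\\&+\sigma\epsilon(u_i)u_i^4\lambda_2(\partial\omega_{\mathrm s,i}\cap\Gamma_\Omega)-\sum_{\alpha\in J_{\Omega,i}}V_{\Gamma,\alpha}(\mathbf u|_{I_\Omega})\\&+\sigma\epsilon(u_i)(u_i^4-\theta_{\rm ext}^4)\lambda_2(\partial\omega_{\mathrm s,i}\cap(\partial\Omega\setminus\Gamma_\Omega))\\&+\sigma\epsilon(u_i)u_i^4\lambda_2(\omega_i\cap\Sigma)-\sum_{\alpha\in J_{\Sigma,i}}V_{\Sigma,\alpha}(\mathbf u|_{I_\Sigma})-\sum_{m\in\{\mathrm s,\mathrm g\}}f_{m,\nu,i}\lambda_3(\omega_{m,i}).\end{aligned}$$ Constants: $B_{f,\nu}:=\max_{i\in I}\sum_{m\in\{\mathrm s,\mathrm g\}}f_{m,\nu,i}\lambda_3(\omega_{m,i})/\lambda_3(\omega_i)$; $L_{V,\Gamma_\Omega}:=\sigma\max_{i\in I}\lambda_2(\partial\omega_{\mathrm s,i}\cap\Gamma_\Omega)/\lambda_3(\omega_i)$; $L_{V,\partial\Omega\setminus\Gamma_\Omega}:=\sigma\max_{i\in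 I}\lambda_2(\partial\omega_{\mathrm s,i}\cap(\partial\Omega\setminus\Gamma_\Omega))/\lambda_3(\omega_i)$; $L_{V,\Sigma}:=\sigma\max_{i\in I}\lambda_2(\omega_i\cap\Sigma)/\lambda_3(\omega_i)$; for $r\ge0$: $l_g^1(r):=4\,\mathrm{var}^-\epsilon(r)\,r^3+L_{\epsilon,r}r^4$, $l_g^2(r):=4\epsilon_{\min,r}^{-1}r^3+\max\{r^4,\theta_{\rm ext}^4\}L_{\epsilon,r}(2\epsilon_{\min,r}^{-1}+1)$, $l_g^3(r):=L_{\epsilon,r}\theta_{\rm ext}^4$. *)

theory Defs
  imports "HOL-Analysis.Analysis" "HOL-Probability.Essential_Supremum"
begin

section \<open>Geometric notions\<close>

type_synonym space = "real^3"

definition hausdorff2 :: "space set \<Rightarrow> ennreal" where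
  "hausdorff2 A = (SUP d\<in>{0<..}.
     INF C\<in>{C :: nat \<Rightarrow> space set. A \<subseteq> (\<Union>n. C n) \<and> (\<forall>n. bounded (C n) \<and> diameter (C n) \<le> d)}.
       (\<Sum>n. ennreal (pi / 4 * (diameter (C n))\<^sup>2)))"

text \<open>Two-dimensional surface measure in three-space: the Hausdorff measure on the Borel sets.
  The factor pi/4 is the area of a disc of diameter 1, so that on planes one obtains the usual
  area.\<close>

definition surface_measure :: "space measure" where
  "surface_measure = measure_of UNIV (sets borel) hausdorff2"

abbreviation lambda2 :: "space set \<Rightarrow> real" where
  "lambda2 A \<equiv> measure surface_measure A"

abbreviation lambda3 :: "space set \<Rightarrow> real" where
  "lambda3 A \<equiv> measure lborel A"

text \<open>A (relatively) open polyhedral subset of an affine subspace H is the interior, relative to H,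
  of a finite union of convex polytopes. Such sets are bounded and regular open: slits
  (cracks) are excluded.\<close>

definition open_polyhedral_in :: "space set \<Rightarrow> space set \<Rightarrow> bool" where
  "open_polyhedral_in H S \<longleftrightarrow>
     (\<exists>F. finite F \<and> (\<forall>K\<in>F. polytope K \<and> K \<subseteq> H) \<and> S = top_of_set H interior_of (\<Union>F))"

abbreviation open_polyhedral :: "space set \<Rightarrow> bool" where
  "open_polyhedral \<equiv> open_polyhedral_in UNIV"

definition plane :: "space set \<Rightarrow> bool" where
  "plane H \<longleftrightarrow> affine H \<and> aff_dim H = 2"

definition partition_of :: "space set \<Rightarrow> 'b set \<Rightarrow> ('b \<Rightarrow> space set) \<Rightarrow> bool" where
  "partition_of S A p \<longleftrightarrow> finite A \<and> disjoint_family_on p A \<and> (\<forall>a\<in>A. p a \<subseteq> S)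
     \<and> S \<subseteq> (\<Union>a\<in>A. closure (p a))"

text \<open>Near each boundary point, D is the strict epigraph, in some direction e, of a Lipschitz
  function of the orthogonal projection along e.\<close>

definition lipschitz_boundary :: "space set \<Rightarrow> bool" where
  "lipschitz_boundary D \<longleftrightarrow>
     (\<forall>x\<in>frontier D. \<exists>e r L \<phi>. norm e = 1 \<and> r > 0 \<and> L-lipschitz_on UNIV (\<phi> :: space \<Rightarrow> real) \<and>
        (\<forall>y\<in>ball x r. y \<in> D \<longleftrightarrow> \<phi> (y - (y \<bullet> e) *\<^sub>R e) < y \<bullet> e))"

text \<open>D is tangent at x to the half-space with outer unit normal v: outside every double cone
  around the tangent plane, the two sides of the plane locally lie in D and in its complement,
  respectively.\<close>

definition outer_unit_normal :: "space set \<Rightarrow> space \<Rightarrow> space \<Rightarrow> bool" where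
  "outer_unit_normal D x v \<longleftrightarrow> x \<in> frontier D \<and> norm v = 1 \<and>
     (\<forall>c>0. \<exists>r>0. \<forall>y\<in>ball x r.
        ((y - x) \<bullet> v < - c * norm (y - x) \<longrightarrow> y \<in> D) \<and>
        ((y - x) \<bullet> v > c * norm (y - x) \<longrightarrow> y \<notin> D))"

definition regular_boundary :: "space set \<Rightarrow> space set" where
  "regular_boundary D = {x \<in> frontier D. \<exists>!v. outer_unit_normal D x v}"

definition inner_unit_normal :: "space set \<Rightarrow> space \<Rightarrow> space" where
  "inner_unit_normal D x =
     (if x \<in> regular_boundary D then - (THE v. outer_unit_normal D x v) else 0)"

definition view_kernel :: "space set \<Rightarrow> space \<Rightarrow> space \<Rightarrow> real" where
  "view_kernel D x y =
     ((inner_unit_normal D y \<bullet> (x - y)) * (inner_unit_normal D x \<bullet> (y - x)))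
       / (pi * ((y - x) \<bullet> (y - x))\<^sup>2)"

definition visibility :: "space set \<Rightarrow> space \<Rightarrow> space \<Rightarrow> real" where
  "visibility D x y = (if open_segment x y \<subseteq> D then 1 else 0)"

definition view_factor :: "space set \<Rightarrow> space set \<Rightarrow> space set \<Rightarrow> real" where
  "view_factor D Z Z' =
     (LINT (x, y) | (restrict_space surface_measure Z \<Otimes>\<^sub>M restrict_space surface_measure Z').
        visibility D x y * view_kernel D x y)"


section \<open>Function spaces and finite matrices\<close>

definition Linf_on :: "'b::euclidean_space set \<Rightarrow> ('b \<Rightarrow> real) \<Rightarrow> bool" where
  "Linf_on S g \<longleftrightarrow> g \<in> borel_measurable (lebesgue_on S) \<and> (\<exists>C. AE x in lebesgue_on S. \<bar>g x\<bar> \<le> C)"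

definition Linf_norm :: "'b::euclidean_space set \<Rightarrow> ('b \<Rightarrow> real) \<Rightarrow> ereal" where
  "Linf_norm S g = esssup (lebesgue_on S) (\<lambda>x. ereal \<bar>g x\<bar>)"

definition ess_inf :: "'b::euclidean_space set \<Rightarrow> ('b \<Rightarrow> real) \<Rightarrow> ereal" where
  "ess_inf S g = - esssup (lebesgue_on S) (\<lambda>x. ereal (- g x))"

definition matrix_inverse_on :: "'b set \<Rightarrow> ('b \<Rightarrow> 'b \<Rightarrow> real) \<Rightarrow> 'b \<Rightarrow> 'b \<Rightarrow> real" where
  "matrix_inverse_on A G = (THE H. H \<in> A \<rightarrow>\<^sub>E (A \<rightarrow>\<^sub>E UNIV) \<and>
     (\<forall>\<alpha>\<in>A. \<forall>\<beta>\<in>A. (\<Sum>\<gamma>\<in>A. G \<alpha> \<gamma> * H \<gamma> \<beta>) = (if \<alpha> = \<beta> then 1 else 0) \<and>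
                 (\<Sum>\<gamma>\<in>A. H \<alpha> \<gamma> * G \<gamma> \<beta>) = (if \<alpha> = \<beta> then 1 else 0)))"

definition matrix_vector_on :: "'b set \<Rightarrow> ('b \<Rightarrow> 'b \<Rightarrow> real) \<Rightarrow> ('b \<Rightarrow> real) \<Rightarrow> 'b \<Rightarrow> real" where
  "matrix_vector_on A G w \<alpha> = (\<Sum>\<beta>\<in>A. G \<alpha> \<beta> * w \<beta>)"


section \<open>Moduli of the emissivity\<close>

definition lipschitz_quotients :: "(real \<Rightarrow> real) \<Rightarrow> real \<Rightarrow> real set" where
  "lipschitz_quotients h r =
     {\<bar>h a - h b\<bar> / \<bar>a - b\<bar> | a b. a \<in> {0..r} \<and> b \<in> {0..r} \<and> a \<noteq> b}"

definition lip_const :: "(real \<Rightarrow> real) \<Rightarrow> real \<Rightarrow> real" where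
  "lip_const h r = (if r = 0 then 0 else Sup (lipschitz_quotients h r))"

definition min_upto :: "(real \<Rightarrow> real) \<Rightarrow> real \<Rightarrow> real" where
  "min_upto h r = Inf (h ` {0..r})"

definition neg_variation :: "(real \<Rightarrow> real) \<Rightarrow> real \<Rightarrow> real" where
  "neg_variation h l = (if l = 0 then 0 else
     Sup {(\<Sum>k=1..n. - min 0 (h (s k) - h (s (k - 1)))) | (n::nat) (s :: nat \<Rightarrow> real).
            s 0 = 0 \<and> s n = l \<and> (\<forall>k\<in>{1..n}. s (k - 1) < s k)})"


section \<open>Data of the problem and of the discretization\<close>

datatype phase = Solid | Gas

record ('i, 'a) fv_problem =
  final_time :: real
  domain :: "space set"
  subdomain :: "phase \<Rightarrow> space set"
  energy :: "phase \<Rightarrow> real \<Rightarrow> real"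
  C_energy :: real
  kappa :: "phase \<Rightarrow> real"
  heat_source :: "phase \<Rightarrow> real \<times> space \<Rightarrow> real"
  boltzmann :: real
  theta_ext :: real
  theta_init :: "space \<Rightarrow> real"
  emissivity :: "real \<Rightarrow> real"
  num_steps :: nat
  time_node :: "nat \<Rightarrow> real"
  cells :: "'i set"
  cell :: "'i \<Rightarrow> space set"
  node :: "'i \<Rightarrow> space"
  elems_domain :: "'a set"
  elems_interface :: "'a set"
  elem_ph :: 'a
  elem :: "'a \<Rightarrow> space set"
  cell_of :: "'a \<Rightarrow> 'i"
  source_approx :: "phase \<Rightarrow> nat \<Rightarrow> 'i \<Rightarrow> real"
  init_approx :: "'i \<Rightarrow> real"

definition interface :: "('i, 'a) fv_problem \<Rightarrow> space set" where
  "interface P = frontier (subdomain P Gas)"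

definition open_cavity :: "('i, 'a) fv_problem \<Rightarrow> space set" where
  "open_cavity P = interior (convex hull (closure (domain P))) - closure (domain P)"

definition Gamma_domain :: "('i, 'a) fv_problem \<Rightarrow> space set" where
  "Gamma_domain P = closure (domain P) \<inter> closure (open_cavity P)"

definition Gamma_ph :: "('i, 'a) fv_problem \<Rightarrow> space set" where
  "Gamma_ph P = frontier (convex hull (closure (domain P))) \<inter> frontier (open_cavity P)"

definition subcell :: "('i, 'a) fv_problem \<Rightarrow> phase \<Rightarrow> 'i \<Rightarrow> space set" where
  "subcell P m i = cell P i \<inter> subdomain P m"

definition phase_cells :: "('i, 'a) fv_problem \<Rightarrow> phase \<Rightarrow> 'i set" where
  "phase_cells P m = {j \<in> cells P. subcell P m j \<noteq> {}}"

definition nb :: "('i, 'a) fv_problem \<Rightarrow> 'i \<Rightarrow> 'i set" where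
  "nb P i = {j \<in> cells P - {i}. lambda2 (frontier (cell P i) \<inter> frontier (cell P j)) \<noteq> 0}"

definition nb_phase :: "('i, 'a) fv_problem \<Rightarrow> phase \<Rightarrow> 'i \<Rightarrow> 'i set" where
  "nb_phase P m i = {j \<in> phase_cells P m - {i}.
     lambda2 (frontier (subcell P m i) \<inter> frontier (subcell P m j)) \<noteq> 0}"

definition J_domain :: "('i, 'a) fv_problem \<Rightarrow> 'i \<Rightarrow> 'a set" where
  "J_domain P i = {\<alpha> \<in> elems_domain P. lambda2 (elem P \<alpha> \<inter> frontier (cell P i)) \<noteq> 0}"

definition J_interface :: "('i, 'a) fv_problem \<Rightarrow> 'i \<Rightarrow> 'a set" where
  "J_interface P i =
     {\<alpha> \<in> elems_interface P. lambda2 (elem P \<alpha> \<inter> frontier (subcell P Solid i)) \<noteq> 0}"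

definition step :: "('i, 'a) fv_problem \<Rightarrow> nat \<Rightarrow> real" where
  "step P \<nu> = time_node P \<nu> - time_node P (\<nu> - 1)"

definition view_Gamma :: "('i, 'a) fv_problem \<Rightarrow> 'a \<Rightarrow> 'a \<Rightarrow> real" where
  "view_Gamma P \<alpha> \<beta> = view_factor (open_cavity P) (elem P \<alpha>) (elem P \<beta>)"

definition view_interface :: "('i, 'a) fv_problem \<Rightarrow> 'a \<Rightarrow> 'a \<Rightarrow> real" where
  "view_interface P \<alpha> \<beta> = view_factor (subdomain P Gas) (elem P \<alpha>) (elem P \<beta>)"


section \<open>Standing assumptions\<close>

text \<open>The equivalences \<open>cell_of_domain\<close> and \<open>cell_of_interface\<close> say that \<open>cell_of P \<alpha>\<close> is the unique
  cell whose boundary contains the element. The properties of the view factors (nonnegativity,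
  reciprocity, and the closure relation that the view factors of an element of a closed surface
  add up to its area) are known facts about the integrals \<open>view_factor\<close>; they are part of the
  setting.\<close>

locale fv_setting =
  fixes P :: "('i, 'a) fv_problem"
  assumes final_time_pos: "final_time P > 0"
    and domain_polyhedral: "domain P \<noteq> {}" "open_polyhedral (domain P)"
    and subdomain_polyhedral: "\<And>m. subdomain P m \<noteq> {}" "\<And>m. open_polyhedral (subdomain P m)"
    and subdomain_cover:
      "closure (domain P) = closure (subdomain P Solid) \<union> closure (subdomain P Gas)"
    and subdomain_disjoint: "subdomain P Solid \<inter> subdomain P Gas = {}"
    and frontier_solid:
      "frontier (subdomain P Solid) = frontier (domain P) \<union> frontier (subdomain P Gas)"
      "frontier (domain P) \<inter> frontier (subdomain P Gas) = {}"
    and interface_lipschitz: "lipschitz_boundary (subdomain P Gas)"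
    and energy_nonneg: "\<And>m \<theta>. \<theta> \<ge> 0 \<Longrightarrow> energy P m \<theta> \<ge> 0"
    and energy_continuous: "\<And>m. continuous_on {0..} (energy P m)"
    and C_energy_pos: "C_energy P > 0"
    and energy_growth: "\<And>m \<theta>1 \<theta>2. 0 \<le> \<theta>1 \<Longrightarrow> \<theta>1 \<le> \<theta>2 \<Longrightarrow>
      energy P m \<theta>2 \<ge> (\<theta>2 - \<theta>1) * C_energy P + energy P m \<theta>1"
    and kappa_nonneg: "\<And>m. kappa P m \<ge> 0"
    and heat_source_Linf: "\<And>m. Linf_on ({0<..<final_time P} \<times> subdomain P m) (heat_source P m)"
    and heat_source_nonneg:
      "\<And>m. AE z in lebesgue_on ({0<..<final_time P} \<times> subdomain P m). heat_source P m z \<ge> 0"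
    and boltzmann_pos: "boltzmann P > 0"
    and theta_ext_pos: "theta_ext P > 0"
    and theta_init_Linf: "Linf_on (domain P) (theta_init P)"
    and theta_init_pos: "AE x in lebesgue_on (domain P). theta_init P x > 0"
    and emissivity_range: "\<And>\<theta>. \<theta> \<ge> 0 \<Longrightarrow> 0 < emissivity P \<theta> \<and> emissivity P \<theta> \<le> 1"
    and emissivity_lipschitz: "\<And>r. r \<ge> 0 \<Longrightarrow> bdd_above (lipschitz_quotients (emissivity P) r)"
    and time_nodes: "time_node P 0 = 0" "time_node P (num_steps P) = final_time P"
      "\<And>\<nu>. \<nu> < num_steps P \<Longrightarrow> time_node P \<nu> < time_node P (Suc \<nu>)"
    and cells_partition: "partition_of (domain P) (cells P) (cell P)"
    and cell_polyhedral: "\<And>i. i \<in> cells P \<Longrightarrow>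
      cell P i \<noteq> {} \<and> open_polyhedral (cell P i) \<and> connected (cell P i)"
    and cell_interface: "\<And>i. i \<in> cells P \<Longrightarrow>
      regular_boundary (subcell P Solid i) \<inter> interface P =
      regular_boundary (subcell P Gas i) \<inter> interface P"
    and node_in_cell: "\<And>i. i \<in> cells P \<Longrightarrow> node P i \<in> closure (cell P i)"
    and node_in_subcell: "\<And>m i. i \<in> phase_cells P m \<Longrightarrow> node P i \<in> closure (subcell P m i)"
    and node_Gamma: "\<And>i. i \<in> cells P \<Longrightarrow>
      lambda2 (closure (cell P i) \<inter> Gamma_domain P) \<noteq> 0 \<Longrightarrow>
      node P i \<in> closure (cell P i) \<inter> Gamma_domain P"
    and node_frontier: "\<And>i. i \<in> cells P \<Longrightarrow>
      lambda2 (closure (cell P i) \<inter> (frontier (domain P) - Gamma_domain P)) \<noteq> 0 \<Longrightarrow>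
      node P i \<in> closure (cell P i) \<inter> closure (frontier (domain P) - Gamma_domain P)"
    and nodes_distinct: "\<And>i j. i \<in> cells P \<Longrightarrow> j \<in> nb P i \<Longrightarrow> node P i \<noteq> node P j"
    and nodes_orthogonal: "\<And>i j. i \<in> cells P \<Longrightarrow> j \<in> nb P i \<Longrightarrow>
      AE y in surface_measure. y \<in> frontier (cell P i) \<inter> frontier (cell P j) \<longrightarrow>
        outer_unit_normal (cell P i) y ((node P j - node P i) /\<^sub>R norm (node P i - node P j))"
    and elems_domain_partition: "partition_of (Gamma_domain P) (elems_domain P) (elem P)"
    and elems_interface_partition: "partition_of (interface P) (elems_interface P) (elem P)"
    and elem_polygon: "\<And>\<alpha>. \<alpha> \<in> elems_domain P \<union> elems_interface P \<Longrightarrow>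
      elem P \<alpha> \<noteq> {} \<and> connected (elem P \<alpha>) \<and> (\<exists>H. plane H \<and> open_polyhedral_in H (elem P \<alpha>))"
    and elems_disjoint: "elems_domain P \<inter> elems_interface P = {}"
    and elem_ph_new: "elem_ph P \<notin> elems_domain P \<union> elems_interface P"
    and elem_ph: "elem P (elem_ph P) = Gamma_ph P"
    and cell_of_in: "\<And>\<alpha>. \<alpha> \<in> elems_domain P \<union> elems_interface P \<Longrightarrow> cell_of P \<alpha> \<in> cells P"
    and cell_of_domain: "\<And>\<alpha> i. \<alpha> \<in> elems_domain P \<Longrightarrow> i \<in> cells P \<Longrightarrow>
      elem P \<alpha> \<subseteq> frontier (cell P i) \<inter> Gamma_domain P \<longleftrightarrow> i = cell_of P \<alpha>"
    and cell_of_interface: "\<And>\<alpha> i. \<alpha> \<in> elems_interface P \<Longrightarrow> i \<in> cells P \<Longrightarrow>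
      elem P \<alpha> \<subseteq> frontier (subcell P Solid i) \<inter> interface P \<longleftrightarrow> i = cell_of P \<alpha>"
    and node_in_elem: "\<And>\<alpha>. \<alpha> \<in> elems_domain P \<union> elems_interface P \<Longrightarrow>
      node P (cell_of P \<alpha>) \<in> closure (elem P \<alpha>)"
    and view_interface_nonneg: "\<And>\<alpha> \<beta>. \<alpha> \<in> elems_interface P \<Longrightarrow> \<beta> \<in> elems_interface P \<Longrightarrow>
      view_interface P \<alpha> \<beta> \<ge> 0"
    and view_interface_sym: "\<And>\<alpha> \<beta>. \<alpha> \<in> elems_interface P \<Longrightarrow> \<beta> \<in> elems_interface P \<Longrightarrow>
      view_interface P \<alpha> \<beta> = view_interface P \<beta> \<alpha>"
    and view_interface_sum: "\<And>\<alpha>. \<alpha> \<in> elems_interface P \<Longrightarrow>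
      (\<Sum>\<beta>\<in>elems_interface P. view_interface P \<alpha> \<beta>) = lambda2 (elem P \<alpha>)"
    and view_Gamma_nonneg: "\<And>\<alpha> \<beta>. \<alpha> \<in> insert (elem_ph P) (elems_domain P) \<Longrightarrow>
      \<beta> \<in> insert (elem_ph P) (elems_domain P) \<Longrightarrow> view_Gamma P \<alpha> \<beta> \<ge> 0"
    and view_Gamma_sym: "\<And>\<alpha> \<beta>. \<alpha> \<in> insert (elem_ph P) (elems_domain P) \<Longrightarrow>
      \<beta> \<in> insert (elem_ph P) (elems_domain P) \<Longrightarrow> view_Gamma P \<alpha> \<beta> = view_Gamma P \<beta> \<alpha>"
    and view_Gamma_sum: "\<And>\<alpha>. \<alpha> \<in> insert (elem_ph P) (elems_domain P) \<Longrightarrow>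
      (\<Sum>\<beta>\<in>insert (elem_ph P) (elems_domain P). view_Gamma P \<alpha> \<beta>) = lambda2 (elem P \<alpha>)"
    and source_approx_bounds: "\<And>m \<nu> i. \<nu> \<in> {1..num_steps P} \<Longrightarrow> i \<in> phase_cells P m \<Longrightarrow>
      0 \<le> ess_inf ({time_node P (\<nu> - 1)<..<time_node P \<nu>} \<times> subcell P m i) (heat_source P m) \<and>
      ess_inf ({time_node P (\<nu> - 1)<..<time_node P \<nu>} \<times> subcell P m i) (heat_source P m)
        \<le> ereal (source_approx P m \<nu> i) \<and>
      ereal (source_approx P m \<nu> i)
        \<le> Linf_norm ({time_node P (\<nu> - 1)<..<time_node P \<nu>} \<times> subcell P m i) (heat_source P m)"
    and init_approx_bounds: "\<And>i. i \<in> cells P \<Longrightarrow>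
      0 \<le> ess_inf (cell P i) (theta_init P) \<and>
      ess_inf (cell P i) (theta_init P) \<le> ereal (init_approx P i) \<and>
      ereal (init_approx P i) \<le> Linf_norm (cell P i) (theta_init P)"


section \<open>Discrete radiation operators and the scheme\<close>

definition E_rad :: "('i, 'a) fv_problem \<Rightarrow> ('a \<Rightarrow> real) \<Rightarrow> 'a \<Rightarrow> real" where
  "E_rad P u \<alpha> = boltzmann P * emissivity P (u \<alpha>) * u \<alpha> ^ 4 * lambda2 (elem P \<alpha>)"

definition E_ph :: "('i, 'a) fv_problem \<Rightarrow> ('a \<Rightarrow> real) \<Rightarrow> 'a \<Rightarrow> real" where
  "E_ph P u \<alpha> =
     boltzmann P * (1 - emissivity P (u \<alpha>)) * theta_ext P ^ 4 * view_Gamma P \<alpha> (elem_ph P)"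

definition G_Gamma :: "('i, 'a) fv_problem \<Rightarrow> ('a \<Rightarrow> real) \<Rightarrow> 'a \<Rightarrow> 'a \<Rightarrow> real" where
  "G_Gamma P u \<alpha> \<beta> = (if \<alpha> = \<beta> then lambda2 (elem P \<alpha>) else 0)
     - (1 - emissivity P (u \<alpha>)) * view_Gamma P \<alpha> \<beta>"

definition G_interface :: "('i, 'a) fv_problem \<Rightarrow> ('a \<Rightarrow> real) \<Rightarrow> 'a \<Rightarrow> 'a \<Rightarrow> real" where
  "G_interface P u \<alpha> \<beta> = (if \<alpha> = \<beta> then lambda2 (elem P \<alpha>) else 0)
     - (1 - emissivity P (u \<alpha>)) * view_interface P \<alpha> \<beta>"

definition R_Gamma :: "('i, 'a) fv_problem \<Rightarrow> ('a \<Rightarrow> real) \<Rightarrow> 'a \<Rightarrow> real" where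
  "R_Gamma P u = matrix_vector_on (elems_domain P)
     (matrix_inverse_on (elems_domain P) (G_Gamma P u)) (\<lambda>\<beta>. E_rad P u \<beta> + E_ph P u \<beta>)"

definition R_interface :: "('i, 'a) fv_problem \<Rightarrow> ('a \<Rightarrow> real) \<Rightarrow> 'a \<Rightarrow> real" where
  "R_interface P u = matrix_vector_on (elems_interface P)
     (matrix_inverse_on (elems_interface P) (G_interface P u)) (E_rad P u)"

definition V_Gamma :: "('i, 'a) fv_problem \<Rightarrow> ('a \<Rightarrow> real) \<Rightarrow> 'a \<Rightarrow> real" where
  "V_Gamma P u \<alpha> =
     emissivity P (u \<alpha>) * (\<Sum>\<beta>\<in>elems_domain P. R_Gamma P u \<beta> * view_Gamma P \<alpha> \<beta>)
     + boltzmann P * emissivity P (u \<alpha>) * theta_ext P ^ 4 * view_Gamma P \<alpha> (elem_ph P)"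

definition V_interface :: "('i, 'a) fv_problem \<Rightarrow> ('a \<Rightarrow> real) \<Rightarrow> 'a \<Rightarrow> real" where
  "V_interface P u \<alpha> =
     emissivity P (u \<alpha>) * (\<Sum>\<beta>\<in>elems_interface P. R_interface P u \<beta> * view_interface P \<alpha> \<beta>)"

definition nonneg_vectors :: "('i, 'a) fv_problem \<Rightarrow> ('i \<Rightarrow> real) set" where
  "nonneg_vectors P = cells P \<rightarrow>\<^sub>E {0..}"

text \<open>The restrictions of u to the boundary elements are both given by \<open>u \<circ> cell_of P\<close>; the radiation
  operators only use its values on \<open>elems_domain P\<close> and \<open>elems_interface P\<close>, respectively.\<close>

definition scheme ::
    "('i, 'a) fv_problem \<Rightarrow> nat \<Rightarrow> 'i \<Rightarrow> ('i \<Rightarrow> real) \<Rightarrow> ('i \<Rightarrow> real) \<Rightarrow> real" where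
  "scheme P \<nu> i v u =
     inverse (step P \<nu>) *
       (\<Sum>m\<in>{Solid, Gas}. (energy P m (u i) - energy P m (v i)) * lambda3 (subcell P m i))
     - (\<Sum>m\<in>{Solid, Gas}. kappa P m *
         (\<Sum>j\<in>nb_phase P m i. (u j - u i) / norm (node P i - node P j)
            * lambda2 (frontier (subcell P m i) \<inter> frontier (subcell P m j))))
     + boltzmann P * emissivity P (u i) * u i ^ 4
         * lambda2 (frontier (subcell P Solid i) \<inter> Gamma_domain P)
     - (\<Sum>\<alpha>\<in>J_domain P i. V_Gamma P (u \<circ> cell_of P) \<alpha>)
     + boltzmann P * emissivity P (u i) * (u i ^ 4 - theta_ext P ^ 4)
         * lambda2 (frontier (subcell P Solid i) \<inter> (frontier (domain P) - Gamma_domain P))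
     + boltzmann P * emissivity P (u i) * u i ^ 4 * lambda2 (cell P i \<inter> interface P)
     - (\<Sum>\<alpha>\<in>J_interface P i. V_interface P (u \<circ> cell_of P) \<alpha>)
     - (\<Sum>m\<in>{Solid, Gas}. source_approx P m \<nu> i * lambda3 (subcell P m i))"

definition nonneg_solution_upto ::
    "('i, 'a) fv_problem \<Rightarrow> nat \<Rightarrow> (nat \<Rightarrow> 'i \<Rightarrow> real) \<Rightarrow> bool" where
  "nonneg_solution_upto P k u \<longleftrightarrow>
     (\<forall>\<nu>\<in>{0..k}. u \<nu> \<in> nonneg_vectors P) \<and>
     (\<forall>i\<in>cells P. u 0 i = init_approx P i) \<and>
     (\<forall>\<nu>\<in>{1..k}. \<forall>i\<in>cells P. scheme P \<nu> i (u (\<nu> - 1)) (u \<nu>) = 0)"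


section \<open>Constants\<close>

definition B_source :: "('i, 'a) fv_problem \<Rightarrow> nat \<Rightarrow> real" where
  "B_source P \<nu> = Max ((\<lambda>i. (\<Sum>m\<in>{Solid, Gas}. source_approx P m \<nu> i * lambda3 (subcell P m i))
                          / lambda3 (cell P i)) ` cells P)"

definition L_Gamma :: "('i, 'a) fv_problem \<Rightarrow> real" where
  "L_Gamma P = boltzmann P *
     Max ((\<lambda>i. lambda2 (frontier (subcell P Solid i) \<inter> Gamma_domain P) / lambda3 (cell P i)) ` cells P)"

definition L_frontier :: "('i, 'a) fv_problem \<Rightarrow> real" where
  "L_frontier P = boltzmann P *
     Max ((\<lambda>i. lambda2 (frontier (subcell P Solid i) \<inter> (frontier (domain P) - Gamma_domain P))
                / lambda3 (cell P i)) ` cells P)"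

definition L_interface :: "('i, 'a) fv_problem \<Rightarrow> real" where
  "L_interface P = boltzmann P *
     Max ((\<lambda>i. lambda2 (cell P i \<inter> interface P) / lambda3 (cell P i)) ` cells P)"

definition l_g1 :: "('i, 'a) fv_problem \<Rightarrow> real \<Rightarrow> real" where
  "l_g1 P r = 4 * neg_variation (emissivity P) r * r ^ 3 + lip_const (emissivity P) r * r ^ 4"

definition l_g2 :: "('i, 'a) fv_problem \<Rightarrow> real \<Rightarrow> real" where
  "l_g2 P r = 4 * inverse (min_upto (emissivity P) r) * r ^ 3
     + max (r ^ 4) (theta_ext P ^ 4) * lip_const (emissivity P) r
         * (2 * inverse (min_upto (emissivity P) r) + 1)"

definition l_g3 :: "('i, 'a) fv_problem \<Rightarrow> real \<Rightarrow> real" where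
  "l_g3 P r = lip_const (emissivity P) r * theta_ext P ^ 4"

definition lower_bound :: "('i, 'a) fv_problem \<Rightarrow> ('i \<Rightarrow> real) \<Rightarrow> real" where
  "lower_bound P v = min (theta_ext P) (Min (v ` cells P))"

definition upper_bound :: "('i, 'a) fv_problem \<Rightarrow> nat \<Rightarrow> ('i \<Rightarrow> real) \<Rightarrow> real" where
  "upper_bound P n v =
     max (theta_ext P) (Max (v ` cells P) + step P n / C_energy P * B_source P n)"

end

theory Submission
  imports Defs
begin

text \<open>A discrete maximum principle gives the bounds: in a cell where the solution is maximal and exceeds
  the external temperature, conduction and net radiation only remove heat, because the radiosities
  lie between the extreme values of the emitted black-body intensities; dually for the minimum.
  For two candidates with values in these bounds, the difference of the schemes in a cell dominates
  the growth of the energy minus the Lipschitz constant of the radiation times the maximal distance.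
  If the time step is small, solving each cell equation for its own unknown (which is possible by the
  maximum principle and the intermediate value theorem) is a contraction, so that there is exactly
  one solution.

  The geometric input is that the elements of the boundary of a cell have the same total area as
  this boundary. It is checked off a null set: outside the pairwise intersections of the finitely many
  bounding planes, each polyhedral set is locally empty, everything, or an open half-space of one
  common plane.\<close>

section \<open>The two-dimensional Hausdorff measure\<close>

text \<open>The maximum principle balances emission, weighted with areas of pieces of the cell
  boundary, against irradiation, summed over boundary elements. It needs these areas to agree, and
  the agreement is not a hypothesis: partitions cover only up to closures, and an element counts for
  a cell when it meets its boundary in nonzero area. So polygons must have positive finite area and
  relative boundaries of area zero. As the area is \<open>measure_of\<close> applied to
  \<open>hausdorff2\<close>, which would be the zero measure if \<open>hausdorff2\<close> were not
  countably additive on Borel sets, Caratheodory's construction has to come first.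

  Solving cell by cell suits the energies: they are continuous and grow at least linearly but need
  not be Lipschitz, so a step of the form u - c * H(u) need not contract. Scalar roots require only
  a lower bound for differences of H. In that bound conduction has the same coefficient in the
  diagonal part and in the part bounded by the distance; the two cancel in the contraction
  condition, so only radiation restricts the time step.\<close>

definition h2_covers :: "real \<Rightarrow> space set \<Rightarrow> (nat \<Rightarrow> space set) set" where
  "h2_covers d A = {C. A \<subseteq> (\<Union>n. C n) \<and> (\<forall>n. bounded (C n) \<and> diameter (C n) \<le> d)}"

definition h2_size :: "(nat \<Rightarrow> space set) \<Rightarrow> ennreal" where
  "h2_size C = (\<Sum>n. ennreal (pi / 4 * (diameter (C n))\<^sup>2))"

text \<open>The outer premeasure at scale d. It grows as d shrinks, so the supremum over d in
  \<open>hausdorff2\<close> is a limit, and any two scales can be replaced by a common finer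
  one.\<close>

definition h2_pre :: "real \<Rightarrow> space set \<Rightarrow> ennreal" where
  "h2_pre d A = (INF C\<in>h2_covers d A. h2_size C)"

lemma hausdorff2_eq: "hausdorff2 A = (SUP d\<in>{0<..}. h2_pre d A)"
  by (simp add: hausdorff2_def h2_pre_def h2_covers_def h2_size_def)

lemma h2_pre_le: "C \<in> h2_covers d A \<Longrightarrow> h2_pre d A \<le> h2_size C"
  by (simp add: h2_pre_def INF_lower)

lemma h2_pre_le_hausdorff2: "d > 0 \<Longrightarrow> h2_pre d A \<le> hausdorff2 A"
  unfolding hausdorff2_eq by (auto intro: SUP_upper)

lemma h2_pre_mono: "A \<subseteq> B \<Longrightarrow> h2_pre d A \<le> h2_pre d B"
  unfolding h2_pre_def h2_covers_def by (rule INF_superset_mono) auto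

lemma h2_pre_antimono: "d \<le> d' \<Longrightarrow> h2_pre d' A \<le> h2_pre d A"
  unfolding h2_pre_def h2_covers_def by (rule INF_superset_mono) (auto intro: order_trans)

lemma hausdorff2_mono: "A \<subseteq> B \<Longrightarrow> hausdorff2 A \<le> hausdorff2 B"
  unfolding hausdorff2_eq by (intro SUP_mono) (auto intro: h2_pre_mono)

lemma hausdorff2_empty [simp]: "hausdorff2 {} = 0"
proof -
  have "h2_pre d {} = 0" if "d > 0" for d
    using h2_pre_le[of "\<lambda>_. {}" d "{}"] that by (simp add: h2_covers_def h2_size_def)
  then show ?thesis by (simp add: hausdorff2_eq)
qed

text \<open>Near-optimal covers of the sets \<open>A n\<close>, with errors e/2^(n+1) that add up to
  e, are merged into one cover of the union. The scale d stays the same, so the result passes to the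
  supremum over d.\<close>

lemma h2_pre_countably_subadditive: "h2_pre d (\<Union>n. A n) \<le> (\<Sum>n. h2_pre d (A n))"
proof (cases "(\<Sum>n. h2_pre d (A n)) = \<infinity>")
  case False
  show ?thesis
  proof (rule ennreal_le_epsilon)
    fix e :: real
    assume e: "0 < e"
    have fin: "h2_pre d (A n) \<noteq> \<infinity>" for n
      using False ennreal_suminf_lessD[of "\<lambda>n. h2_pre d (A n)" \<infinity> n] by (auto simp: less_top)
    have "\<exists>C\<in>h2_covers d (A n). h2_size C < h2_pre d (A n) + ennreal (e * (1/2)^Suc n)" for n
      by (rule INF_approx_ennreal) (use e fin[of n] in \<open>auto simp: h2_pre_def\<close>)
    then obtain C where C: "\<And>n. C n \<in> h2_covers d (A n)"
      and sz: "\<And>n. h2_size (C n) < h2_pre d (A n) + ennreal (e * (1/2)^Suc n)" by metis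
    \<comment> \<open>\<open>prod_decode\<close> enumerates the double family as one sequence, and
      the size of \<open>K\<close> becomes an iterated sum.\<close>
    define K where "K = (\<lambda>k. case prod_decode k of (m, n) \<Rightarrow> C m n)"
    have K: "K \<in> h2_covers d (\<Union>n. A n)"
      unfolding h2_covers_def
    proof (intro CollectI conjI allI subsetI)
      fix x assume "x \<in> (\<Union>n. A n)"
      then obtain m where "x \<in> A m" by blast
      then obtain n where "x \<in> C m n" using C[of m] by (auto simp: h2_covers_def)
      then have "x \<in> K (prod_encode (m, n))" by (simp add: K_def)
      then show "x \<in> (\<Union>n. K n)" by blast
    qed (use C in \<open>auto simp: K_def h2_covers_def split: prod.split\<close>)
    have "h2_size K = (\<Sum>m. h2_size (C m))"
      unfolding h2_size_def K_def
      by (subst suminf_ennreal_2dimen[symmetric,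
            of "\<lambda>m. \<Sum>n. ennreal (pi / 4 * (diameter (C m n))\<^sup>2)"
               "\<lambda>p. ennreal (pi / 4 * (diameter (C (fst p) (snd p)))\<^sup>2)"])
         (auto simp: case_prod_beta)
    also have "\<dots> \<le> (\<Sum>n. h2_pre d (A n) + ennreal (e * (1/2)^Suc n))"
      using sz by (intro suminf_le) (auto simp: less_imp_le)
    also have "\<dots> = (\<Sum>n. h2_pre d (A n)) + (\<Sum>n. ennreal (e * (1/2)^Suc n))"
      by (intro suminf_add[symmetric]) auto
    also have "(\<Sum>n. ennreal (e * (1/2)^Suc n)) = ennreal e"
      using e sums_mult[OF power_half_series, of e]
      by (intro suminf_ennreal_eq) auto
    finally show "h2_pre d (\<Union>n. A n) \<le> (\<Sum>n. h2_pre d (A n)) + ennreal e"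
      using h2_pre_le[OF K] by (rule order_trans[rotated])
  qed
qed simp

lemma hausdorff2_countably_subadditive: "hausdorff2 (\<Union>n. A n) \<le> (\<Sum>n. hausdorff2 (A n))"
  unfolding hausdorff2_eq[of "\<Union>n. A n"]
proof (rule SUP_least)
  fix d :: real
  assume "d \<in> {0<..}"
  then show "h2_pre d (\<Union>n. A n) \<le> (\<Sum>n. hausdorff2 (A n))"
    by (intro order_trans[OF h2_pre_countably_subadditive] suminf_le h2_pre_le_hausdorff2) auto
qed

lemma hausdorff2_outer_measure_space: "outer_measure_space UNIV hausdorff2"
  using hausdorff2_countably_subadditive
  by (auto simp: outer_measure_space_def positive_def increasing_def countably_subadditive_def
      hausdorff2_mono)

lemma hausdorff2_subadditive: "hausdorff2 (A \<union> B) \<le> hausdorff2 A + hausdorff2 B"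
proof -
  have "subadditive UNIV hausdorff2"
    using hausdorff2_outer_measure_space ring_of_sets_Pow[of "UNIV :: space set"]
    by (intro ring_of_sets.countably_subadditive_subadditive[of UNIV]) (auto simp: outer_measure_space_def)
  from subadditiveD[OF this, of A "B - A"] have "hausdorff2 (A \<union> B) \<le> hausdorff2 A + hausdorff2 (B - A)"
    by auto
  also have "\<dots> \<le> hausdorff2 A + hausdorff2 B"
    by (intro add_left_mono hausdorff2_mono) auto
  finally show ?thesis .
qed

text \<open>A set of diameter less than the distance of A and B meets at most one of them, so fine covers
  of the union split.\<close>

lemma hausdorff2_separated:
  assumes "\<delta> > 0" and sep: "\<And>x y. x \<in> A \<Longrightarrow> y \<in> B \<Longrightarrow> dist x y \<ge> \<delta>"
  shows "hausdorff2 A + hausdorff2 B \<le> hausdorff2 (A \<union> B)"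
proof -
  have split: "h2_pre d A + h2_pre d B \<le> h2_pre d (A \<union> B)" if d: "0 < d" "d < \<delta>" for d
    unfolding h2_pre_def[of d "A \<union> B"]
  proof (rule INF_greatest)
    fix C assume C: "C \<in> h2_covers d (A \<union> B)"
    \<comment> \<open>Sets that do not meet the part in question are replaced by the empty set,
      which has diameter 0 and adds nothing to the size.\<close>
    define C1 where "C1 n = (if C n \<inter> A \<noteq> {} then C n else {})" for n
    define C2 where "C2 n = (if C n \<inter> B \<noteq> {} then C n else {})" for n
    have excl: "C1 n = {} \<or> C2 n = {}" for n
    proof (rule ccontr)
      assume "\<not> ?thesis"
      then obtain x y where "x \<in> C n" "x \<in> A" "y \<in> C n" "y \<in> B"
        by (auto simp: C1_def C2_def split: if_splits)
      moreover have "bounded (C n)" "diameter (C n) \<le> d" using C by (auto simp: h2_covers_def)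
      ultimately show False
        using diameter_bounded_bound[of "C n" x y] sep[of x y] d by linarith
    qed
    have "C1 \<in> h2_covers d A" "C2 \<in> h2_covers d B"
      using C d unfolding h2_covers_def C1_def C2_def by (auto, blast+)
    then have "h2_pre d A + h2_pre d B \<le> h2_size C1 + h2_size C2"
      by (intro add_mono h2_pre_le)
    also have "\<dots> = (\<Sum>n. ennreal (pi / 4 * (diameter (C1 n))\<^sup>2) + ennreal (pi / 4 * (diameter (C2 n))\<^sup>2))"
      unfolding h2_size_def by (intro suminf_add) auto
    also have "\<dots> \<le> h2_size C"
      unfolding h2_size_def
    proof (intro suminf_le)
      fix n
      have "C1 n = {} \<or> C1 n = C n" "C2 n = {} \<or> C2 n = C n" by (auto simp: C1_def C2_def)
      with excl[of n]
      show "ennreal (pi / 4 * (diameter (C1 n))\<^sup>2) + ennreal (pi / 4 * (diameter (C2 n))\<^sup>2)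
          \<le> ennreal (pi / 4 * (diameter (C n))\<^sup>2)" by auto
    qed auto
    finally show "h2_pre d A + h2_pre d B \<le> h2_size C" .
  qed
  have *: "h2_pre d1 A + h2_pre d2 B \<le> h2_pre (min (min d1 d2) (\<delta>/2)) A + h2_pre (min (min d1 d2) (\<delta>/2)) B"
    for d1 d2
    by (intro add_mono h2_pre_antimono) auto
  \<comment> \<open>The sum of the suprema is the supremum of the sums because both premeasures grow
    as the scale shrinks; \<delta>/2 keeps the common scale below the separation.\<close>
  have "hausdorff2 A + hausdorff2 B = (SUP d\<in>{0<..}. h2_pre d A + h2_pre d B)"
    unfolding hausdorff2_eq
  proof (rule SUP_add_directed_ennreal[symmetric])
    fix d1 d2 :: real assume "d1 \<in> {0<..}" "d2 \<in> {0<..}"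
    then show "\<exists>k\<in>{0<..}. h2_pre d1 A + h2_pre d2 B \<le> h2_pre k A + h2_pre k B"
      using * assms(1) by (intro bexI[of _ "min (min d1 d2) (\<delta>/2)"]) auto
  qed
  also have "\<dots> \<le> hausdorff2 (A \<union> B)"
  proof (rule SUP_least)
    fix d :: real assume d: "d \<in> {0<..}"
    have "h2_pre d A + h2_pre d B \<le> h2_pre (min d (\<delta>/2)) A + h2_pre (min d (\<delta>/2)) B"
      by (intro add_mono h2_pre_antimono) auto
    also have "\<dots> \<le> h2_pre (min d (\<delta>/2)) (A \<union> B)"
      using d assms(1) by (intro split) auto
    also have "\<dots> \<le> hausdorff2 (A \<union> B)"
      using d assms(1) by (intro h2_pre_le_hausdorff2) auto
    finally show "h2_pre d A + h2_pre d B \<le> hausdorff2 (A \<union> B)" .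
  qed
  finally show ?thesis .
qed

section \<open>Caratheodory measurability of closed sets\<close>

lemma hausdorff2_separated_sum:
  fixes E :: "nat \<Rightarrow> space set"
  assumes "\<And>n. E n \<subseteq> A"
    and "\<And>n. \<exists>\<delta>>0. \<forall>x\<in>(\<Union>j<n. E j). \<forall>y\<in>E n. dist x y \<ge> \<delta>"
  shows "(\<Sum>n. hausdorff2 (E n)) \<le> hausdorff2 A"
proof (rule suminf_le_const)
  fix n
  have "(\<Sum>j<n. hausdorff2 (E j)) \<le> hausdorff2 (\<Union>j<n. E j)"
  proof (induction n)
    case (Suc n)
    obtain \<delta> where "\<delta> > 0" "\<forall>x\<in>(\<Union>j<n. E j). \<forall>y\<in>E n. dist x y \<ge> \<delta>" using assms(2) by blast
    then have "hausdorff2 (\<Union>j<n. E j) + hausdorff2 (E n) \<le> hausdorff2 ((\<Union>j<n. E j) \<union> E n)"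
      by (intro hausdorff2_separated[of \<delta>]) auto
    moreover have "(\<Union>j<n. E j) \<union> E n = (\<Union>j<Suc n. E j)" by (auto simp: less_Suc_eq)
    ultimately show ?case using Suc by (auto intro: order_trans add_right_mono)
  qed simp
  also have "\<dots> \<le> hausdorff2 A" using assms(1) by (intro hausdorff2_mono) auto
  finally show "(\<Sum>j<n. hausdorff2 (E j)) \<le> hausdorff2 A" .
qed simp

text \<open>Caratheodory's argument for metric outer measures. The set \<open>E k\<close> of points
  of A farther than 1/(k+1) from F is separated from F, so it suffices that A - F exceeds
  \<open>E k\<close> by little. The remainder consists of shells \<open>D j\<close>; every second
  shell is separated from the earlier ones, so the shell measures add up to at most twice the
  measure of A and have small tails. F is nonempty because \<open>infdist\<close> to the empty set
  is 0.\<close>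

lemma closed_hausdorff2_split:
  assumes F: "closed F" "F \<noteq> {}"
  shows "hausdorff2 (A \<inter> F) + hausdorff2 (A - F) \<le> hausdorff2 A"
proof (cases "hausdorff2 A = \<infinity>")
  case False
  define E where "E k = {x\<in>A. infdist x F > 1 / real (Suc k)}" for k
  define D where "D k = E (Suc k) - E k" for k
  have E_sub: "E k \<subseteq> A" for k by (auto simp: E_def)
  have "1 / real (Suc j) \<ge> 1 / real (Suc k)" if "j \<le> k" for j k
    using that by (simp add: frac_le)
  then have E_mono: "E j \<subseteq> E k" if "j \<le> k" for j k
    using that by (fastforce simp: E_def)
  \<comment> \<open>Points of \<open>E (Suc k)\<close> have distance more than 1/(k+2) from F,
    points of \<open>D (Suc (Suc k))\<close> at most 1/(k+3); the difference is the gap.\<close>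
  have sepD: "\<exists>\<delta>>0. \<forall>x\<in>E (Suc k). \<forall>y\<in>D (Suc (Suc k)). dist x y \<ge> \<delta>" for k
  proof (intro exI conjI ballI)
    show "0 < 1 / real (Suc (Suc k)) - 1 / real (Suc (Suc (Suc k)))"
      using divide_strict_left_mono[of "real (Suc (Suc k))" "real (Suc (Suc (Suc k)))" 1] by simp
    fix x y assume x: "x \<in> E (Suc k)" and y: "y \<in> D (Suc (Suc k))"
    have "infdist x F \<le> infdist y F + dist x y" by (rule infdist_triangle)
    then show "1 / real (Suc (Suc k)) - 1 / real (Suc (Suc (Suc k))) \<le> dist x y"
      using x y by (auto simp: E_def D_def)
  qed
  \<comment> \<open>The offset b selects the even shells (0) or the odd shells (1).\<close>
  have even: "(\<Sum>n. hausdorff2 (D (2*n+b))) \<le> hausdorff2 A" for b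
  proof (rule hausdorff2_separated_sum)
    show "D (2*n+b) \<subseteq> A" for n using E_sub by (auto simp: D_def)
    fix n
    show "\<exists>\<delta>>0. \<forall>x\<in>(\<Union>j<n. D (2*j+b)). \<forall>y\<in>D (2*n+b). dist x y \<ge> \<delta>"
    proof (cases n)
      case (Suc k)
      have "(\<Union>j<n. D (2*j+b)) \<subseteq> E (Suc (2*k+b))"
      proof (intro UN_least)
        fix j assume "j \<in> {..<n}"
        then have "Suc (2*j+b) \<le> Suc (2*k+b)" using Suc by auto
        then show "D (2*j+b) \<subseteq> E (Suc (2*k+b))" using E_mono unfolding D_def by blast
      qed
      moreover have "2 * n + b = Suc (Suc (2 * k + b))" using Suc by simp
      ultimately show ?thesis using sepD[of "2*k+b"] by (metis subset_iff)
    qed (auto intro: exI[of _ 1])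
  qed
  have tot: "(\<Sum>n. hausdorff2 (D n)) \<le> hausdorff2 A + hausdorff2 A"
  proof (rule suminf_le_const)
    fix n
    have "(\<Sum>j<n. hausdorff2 (D j)) \<le> (\<Sum>j<2*n. hausdorff2 (D j))"
      by (intro sum_mono2) auto
    also have "\<dots> = (\<Sum>j<n. hausdorff2 (D (2*j+0))) + (\<Sum>j<n. hausdorff2 (D (2*j+1)))"
      by (induction n) (auto simp: algebra_simps)
    also have "\<dots> \<le> (\<Sum>n. hausdorff2 (D (2*n+0))) + (\<Sum>n. hausdorff2 (D (2*n+1)))"
      by (intro add_mono sum_le_suminf) auto
    also have "\<dots> \<le> hausdorff2 A + hausdorff2 A" by (intro add_mono even)
    finally show "(\<Sum>j<n. hausdorff2 (D j)) \<le> hausdorff2 A + hausdorff2 A" .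
  qed simp
  have fin: "(\<Sum>n. hausdorff2 (D n)) \<noteq> \<infinity>"
    using tot False by (auto simp: top_unique ennreal_add_eq_top)
  show ?thesis
  proof (rule ennreal_le_epsilon)
    fix e :: real assume e: "e > 0"
    show "hausdorff2 (A \<inter> F) + hausdorff2 (A - F) \<le> hausdorff2 A + ennreal e"
    proof -
      obtain k where k: "(\<Sum>n. hausdorff2 (D (n + k))) \<le> ennreal e"
      proof -
        have r: "hausdorff2 (D n) = ennreal (enn2real (hausdorff2 (D n)))" for n
          using fin ennreal_suminf_lessD[of "\<lambda>n. hausdorff2 (D n)" \<infinity> n] by (auto simp: less_top)
        have sm: "summable (\<lambda>n. enn2real (hausdorff2 (D n)))"
          using fin by (subst (asm) r) (auto intro!: summable_suminf_not_top simp: top_ennreal.rep_eq)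
        obtain N where "\<forall>n\<ge>N. norm (\<Sum>i. enn2real (hausdorff2 (D (i + n)))) < e"
          using suminf_exist_split[OF e sm] by blast
        then have "(\<Sum>i. enn2real (hausdorff2 (D (i + N)))) \<le> e" by (auto simp: abs_less_iff)
        then have "(\<Sum>i. ennreal (enn2real (hausdorff2 (D (i + N))))) \<le> ennreal e"
          using sm by (subst suminf_ennreal2) (auto simp: summable_iff_shift[of "\<lambda>n. enn2real (hausdorff2 (D n))"] ennreal_leI)
        then show thesis using that[of N] r by simp
      qed
      have "A - F \<subseteq> E k \<union> (\<Union>n. D (n + k))"
      proof
        fix x assume x: "x \<in> A - F"
        then have "infdist x F > 0"
          using F by (metis DiffD2 in_closed_iff_infdist_zero infdist_nonneg less_eq_real_def)
        then obtain n where "1 / real (Suc n) < infdist x F" using nat_approx_posE by blast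
        then have ex: "x \<in> E n" using x by (auto simp: E_def)
        \<comment> \<open>The first index at which x enters: if it exceeds k, then x lies in the
          shell \<open>D (l - 1)\<close>, which belongs to the tail.\<close>
        define l where "l = (LEAST n. x \<in> E n)"
        have l: "x \<in> E l" "\<And>j. j < l \<Longrightarrow> x \<notin> E j"
          unfolding l_def using ex by (auto intro: LeastI dest: not_less_Least)
        show "x \<in> E k \<union> (\<Union>n. D (n + k))"
        proof (cases "l \<le> k")
          case True then show ?thesis using l(1) E_mono by blast
        next
          case False
          then have "x \<in> D ((l - Suc k) + k)" using l by (auto simp: D_def)
          then show ?thesis by blast
        qed
      qed
      then have "hausdorff2 (A - F) \<le> hausdorff2 (E k \<union> (\<Union>n. D (n + k)))" by (rule hausdorff2_mono)
      also have "\<dots> \<le> hausdorff2 (E k) + hausdorff2 (\<Union>n. D (n + k))" by (rule hausdorff2_subadditive)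
      also have "\<dots> \<le> hausdorff2 (E k) + ennreal e"
        by (intro add_left_mono order_trans[OF hausdorff2_countably_subadditive k])
      finally have 1: "hausdorff2 (A - F) \<le> hausdorff2 (E k) + ennreal e" .
      have "hausdorff2 (A \<inter> F) + hausdorff2 (E k) \<le> hausdorff2 ((A \<inter> F) \<union> E k)"
      proof (rule hausdorff2_separated[of "1 / real (Suc k)"])
        fix x y assume "x \<in> A \<inter> F" "y \<in> E k"
        then show "1 / real (Suc k) \<le> dist x y"
          using infdist_le[of x F y] by (auto simp: E_def dist_commute)
      qed simp
      also have "\<dots> \<le> hausdorff2 A" using E_sub by (intro hausdorff2_mono) auto
      finally have 2: "hausdorff2 (A \<inter> F) + hausdorff2 (E k) \<le> hausdorff2 A" .
      have "hausdorff2 (A \<inter> F) + hausdorff2 (A - F) \<le> hausdorff2 (A \<inter> F) + (hausdorff2 (E k) + ennreal e)"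
        by (intro add_left_mono 1)
      also have "\<dots> \<le> hausdorff2 A + ennreal e" using 2 by (simp add: add.assoc[symmetric] add_right_mono)
      finally show ?thesis .
    qed
  qed
qed simp

text \<open>Closed sets satisfy Caratheodory's condition and generate the Borel sets. Without
  countable additivity \<open>measure_of\<close> would assign 0 to every set, so all statements on
  areas rest on this fact.\<close>

lemma measure_space_hausdorff2: "measure_space UNIV (sets borel) hausdorff2"
proof -
  let ?L = "lambda_system UNIV UNIV hausdorff2"
  interpret sigma_algebra UNIV "UNIV :: space set set" using sigma_algebra_Pow[of UNIV] by simp
  have ms: "measure_space UNIV ?L hausdorff2"
    using caratheodory_lemma[OF hausdorff2_outer_measure_space] .
  then have sa: "sigma_algebra UNIV ?L" by (simp add: measure_space_def)
  have "F \<in> ?L" if F: "closed F" for F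
  proof (cases "F = {}")
    case False
    have "hausdorff2 (x \<inter> F) + hausdorff2 (x - F) = hausdorff2 x" for x
    proof (rule antisym)
      show "hausdorff2 x \<le> hausdorff2 (x \<inter> F) + hausdorff2 (x - F)"
        using hausdorff2_subadditive[of "x \<inter> F" "x - F"] by (simp add: Int_Diff_Un)
    qed (rule closed_hausdorff2_split[OF F False])
    then show ?thesis by (simp add: lambda_system_eq)
  qed (auto simp: lambda_system_eq)
  then have "sigma_sets UNIV (Collect closed) \<subseteq> ?L"
    by (intro sigma_algebra.sigma_sets_subset[OF sa]) auto
  then have "sets borel \<subseteq> ?L" by (simp add: borel_eq_closed)
  then show ?thesis
    using ms sets.sigma_algebra_axioms[of "borel :: space measure"]
    by (auto simp: measure_space_def positive_def countably_additive_def)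
qed

lemma sets_surface_measure [simp, measurable_cong]: "sets surface_measure = sets borel"
  by (simp add: surface_measure_def sets.sigma_sets_eq[of borel, simplified])

lemma space_surface_measure [simp]: "space surface_measure = UNIV"
  by (simp add: surface_measure_def)

lemma emeasure_surface_measure:
  "A \<in> sets borel \<Longrightarrow> emeasure surface_measure A = hausdorff2 A"
  using measure_space_hausdorff2 unfolding surface_measure_def
  by (intro emeasure_measure_of_sigma) (auto simp: measure_space_def)

section \<open>Areas of subsets of lines and planes\<close>

lemma h2_pre_finite_cover:
  assumes "finite \<C>" "A \<subseteq> \<Union>\<C>" "0 \<le> r" "r \<le> d"
    and small: "\<And>S. S \<in> \<C> \<Longrightarrow> bounded S \<and> diameter S \<le> r"
  shows "h2_pre d A \<le> ennreal (real (card \<C>) * (pi / 4 * r\<^sup>2))"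
proof -
  obtain h where h: "bij_betw h {0..<card \<C>} \<C>" using ex_bij_betw_nat_finite assms(1) by blast
  define C where "C n = (if n < card \<C> then h n else {})" for n
  have hC: "h n \<in> \<C>" if "n < card \<C>" for n using h that by (auto simp: bij_betw_def)
  have C: "C \<in> h2_covers d A"
    unfolding h2_covers_def
  proof (intro CollectI conjI allI subsetI)
    fix x assume "x \<in> A"
    then obtain S where S: "S \<in> \<C>" "x \<in> S" using assms(2) by blast
    then have "S \<in> h ` {0..<card \<C>}" using h by (simp add: bij_betw_def)
    then obtain n where "n < card \<C>" "S = h n" by auto
    then show "x \<in> (\<Union>n. C n)" using S by (auto simp: C_def)
  qed (use hC small assms(3,4) in \<open>auto simp: C_def intro: order_trans\<close>)
  have "h2_size C = (\<Sum>n<card \<C>. ennreal (pi / 4 * (diameter (C n))\<^sup>2))"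
    unfolding h2_size_def by (rule suminf_finite) (auto simp: C_def)
  also have "\<dots> \<le> (\<Sum>n<card \<C>. ennreal (pi / 4 * r\<^sup>2))"
    using hC small by (intro sum_mono ennreal_leI mult_left_mono power_mono)
      (auto simp: C_def diameter_ge_0)
  also have "\<dots> = ennreal (real (card \<C>) * (pi / 4 * r\<^sup>2))"
    by (subst ennreal_mult) (auto simp: ennreal_of_nat_eq_real_of_nat)
  finally show ?thesis using h2_pre_le[OF C] by (rule order_trans[rotated])
qed

text \<open>The i-th of N equal closed pieces of the interval from -R to R; adjacent pieces share an
  endpoint, which is harmless because they only serve as covers.\<close>

definition grid_cell :: "real \<Rightarrow> nat \<Rightarrow> nat \<Rightarrow> real set" where
  "grid_cell R N i = {-R + 2 * R * real i / real N .. -R + 2 * R * real (Suc i) / real N}"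

lemma grid_cell_cover:
  assumes "R > 0" "N > 0" "\<bar>x\<bar> \<le> R"
  shows "\<exists>i<N. x \<in> grid_cell R N i"
proof (cases "x = R")
  case True
  then show ?thesis using assms
    by (intro exI[of _ "N - 1"]) (auto simp: grid_cell_def of_nat_diff field_simps)
next
  case False
  define z where "z = (x + R) * real N / (2 * R)"
  have "0 \<le> z" using assms by (auto simp: z_def)
  moreover have "z < real N"
    using assms False by (auto simp: z_def field_simps)
  ultimately have z: "0 \<le> z" "z < real N" .
  have x: "x = -R + 2 * R * z / real N" using assms by (simp add: z_def)
  define i where "i = nat \<lfloor>z\<rfloor>"
  have i: "real i \<le> z" "z \<le> real (Suc i)" "i < N" using z by (auto simp: i_def, linarith+)
  then have "2 * R * real i / real N \<le> 2 * R * z / real N"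
    "2 * R * z / real N \<le> 2 * R * real (Suc i) / real N"
    using assms by (intro divide_right_mono mult_left_mono; simp)+
  then show ?thesis using i x by (intro exI[of _ i]) (auto simp: grid_cell_def)
qed

lemma grid_cell_dist:
  assumes "s \<in> grid_cell R N i" "t \<in> grid_cell R N i"
  shows "\<bar>s - t\<bar> \<le> 2 * R / real N"
proof -
  have "2 * R * real (Suc i) / real N = 2 * R * real i / real N + 2 * R / real N"
    by (simp add: field_simps add_divide_distrib)
  then show ?thesis using assms by (auto simp: grid_cell_def)
qed

text \<open>N segments of length 2R/N cover A, and their sizes add up to pi R^2 / N, which is small
  for large N.\<close>

lemma collinear_bounded_null:
  assumes "collinear A" "bounded A"
  shows "hausdorff2 A = 0"
proof (cases "A = {}")
  case False
  then obtain p where p: "p \<in> A" by blast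
  obtain u where u: "\<forall>x\<in>A. \<forall>y\<in>A. \<exists>c. x - y = c *\<^sub>R u" using assms(1) collinear_def by blast
  \<comment> \<open>If u is 0 then A is a single point and any unit vector serves as
    direction.\<close>
  define w where "w = (if u = 0 then axis 1 1 else u /\<^sub>R norm u)"
  have w: "norm w = 1" by (simp add: w_def)
  obtain R where R: "R > 0" "\<And>x. x \<in> A \<Longrightarrow> norm (x - p) \<le> R"
  proof -
    obtain R where "\<forall>x\<in>A. norm (x - p) \<le> R"
      using bounded_any_center[of A p] assms(2) by (auto simp: dist_norm norm_minus_commute)
    then show thesis using that[of "max R 1"] by fastforce
  qed
  have rep: "\<exists>c. x = p + c *\<^sub>R w \<and> \<bar>c\<bar> \<le> R" if "x \<in> A" for x
  proof -
    obtain c where "x - p = c *\<^sub>R u" using u p \<open>x \<in> A\<close> by blast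
    then obtain c' where c': "x - p = c' *\<^sub>R w"
      by (cases "u = 0") (auto simp: w_def intro: that[of 0] that[of "c * norm u"])
    then have "norm (x - p) = \<bar>c'\<bar>" using w by simp
    then show ?thesis using c' R(2)[OF \<open>x \<in> A\<close>] by (intro exI[of _ c']) (auto simp: algebra_simps)
  qed
  have bound: "h2_pre d A \<le> ennreal (pi * R\<^sup>2 / real N)"
    if "N > 0" "2 * R / real N \<le> d" for d N
  proof -
    let ?f = "\<lambda>i. (\<lambda>c. p + c *\<^sub>R w) ` grid_cell R N i"
    have "h2_pre d A \<le> ennreal (real (card (?f ` {..<N})) * (pi / 4 * (2 * R / real N)\<^sup>2))"
    proof (rule h2_pre_finite_cover)
      show "A \<subseteq> \<Union> (?f ` {..<N})"
      proof
        fix x assume "x \<in> A"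
        then obtain c where "x = p + c *\<^sub>R w" "\<bar>c\<bar> \<le> R" using rep by blast
        then show "x \<in> \<Union> (?f ` {..<N})" using grid_cell_cover[OF R(1) \<open>N > 0\<close>, of c] by blast
      qed
      fix S assume "S \<in> ?f ` {..<N}"
      then obtain i where S: "S = ?f i" by blast
      have "norm (x - y) \<le> 2 * R / real N" if "x \<in> S" "y \<in> S" for x y
        using that grid_cell_dist[of _ R N i] w
        by (auto simp: S scaleR_left_diff_distrib[symmetric])
      moreover from this have "bounded S"
        unfolding bounded_two_points by (auto simp: dist_norm)
      ultimately show "bounded S \<and> diameter S \<le> 2 * R / real N"
        using R(1) by (auto intro!: diameter_le)
    qed (use that R(1) in auto)
    also have "\<dots> \<le> ennreal (real N * (pi / 4 * (2 * R / real N)\<^sup>2))"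
      using card_image_le[of "{..<N}" ?f] by (intro ennreal_leI mult_right_mono) auto
    also have "real N * (pi / 4 * (2 * R / real N)\<^sup>2) = pi * R\<^sup>2 / real N"
      using that by (simp add: power2_eq_square field_simps)
    finally show ?thesis .
  qed
  have "h2_pre d A = 0" if d: "d > 0" for d
  proof -
    have "h2_pre d A \<le> 0 + ennreal e" if e: "e > 0" for e
    proof -
      obtain N :: nat where N: "real N > max (2 * R / d) (pi * R\<^sup>2 / e)" using reals_Archimedean2 by blast
      moreover have "2 * R / d > 0" using R(1) d by simp
      ultimately have N0: "N > 0" by (metis max_less_iff_conj of_nat_0_less_iff order.strict_trans)
      have "2 * R / real N \<le> d" "pi * R\<^sup>2 / real N \<le> e"
        using N N0 d e by (auto simp: field_simps max_less_iff_conj)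
      then show ?thesis using bound[OF N0, of d] by (auto intro: order_trans ennreal_leI)
    qed
    then show ?thesis using ennreal_le_epsilon[of 0 "h2_pre d A"] by auto
  qed
  then show ?thesis by (simp add: hausdorff2_eq)
qed simp

lemma hausdorff2_collinear:
  assumes "collinear A"
  shows "hausdorff2 A = 0"
proof -
  have "A = (\<Union>n. A \<inter> cball 0 (real n))"
    using real_arch_simple by (auto simp: dist_norm)
  then have "hausdorff2 A \<le> (\<Sum>n. hausdorff2 (A \<inter> cball 0 (real n)))"
    using hausdorff2_countably_subadditive[of "\<lambda>n. A \<inter> cball 0 (real n)"] by simp
  also have "\<dots> = 0"
    using collinear_bounded_null[OF collinear_subset[OF assms]] by (simp add: bounded_Int)
  finally show ?thesis by simp
qed

lemma plane_frame:
  assumes "plane H"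
  obtains p e1 e2 where "norm e1 = 1" "norm e2 = 1" "e1 \<bullet> e2 = 0"
    "H = {p + s *\<^sub>R e1 + t *\<^sub>R e2 | s t. True}"
proof -
  have H: "affine H" "aff_dim H = 2" using assms by (auto simp: plane_def)
  then have "H \<noteq> {}" by auto
  then obtain p where p: "p \<in> H" by blast
  let ?S = "(\<lambda>x. - p + x) ` H"
  have sub: "subspace ?S" using affine_diffs_subspace[OF H(1) p] by simp
  have "dim ?S = 2" using aff_dim_eq_dim[of p H] H p by (simp add: hull_inc)
  then obtain B where B: "pairwise orthogonal B" "\<And>x. x \<in> B \<Longrightarrow> norm x = 1" "card B = 2" "span B = ?S"
    using orthonormal_basis_subspace[OF sub] by metis
  then obtain e1 e2 where e: "B = {e1, e2}" "e1 \<noteq> e2" by (auto simp: card_2_iff)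
  have "span B = {s *\<^sub>R e1 + t *\<^sub>R e2 | s t. True}"
    by (auto simp: e span_insert span_singleton algebra_simps)
  then have "H = (\<lambda>x. p + x) ` {s *\<^sub>R e1 + t *\<^sub>R e2 | s t. True}"
    using B(4) by (metis (no_types, lifting) ext add_minus_cancel image_ident image_image)
  then have "H = {p + s *\<^sub>R e1 + t *\<^sub>R e2 | s t. True}"
    by (auto simp: add.assoc image_iff)
  then show thesis
    using that[of e1 e2 p] B(1,2) e by (auto simp: pairwise_def orthogonal_def)
qed

text \<open>At every scale a grid of N^2 squares, each of diameter at most 4R/N, covers A. The sizes
  add up to 4 pi R^2 independently of N, which bounds the supremum over the scales.\<close>

lemma hausdorff2_bounded_in_plane:
  assumes "plane H" "A \<subseteq> H" "bounded A"
  shows "hausdorff2 A < \<infinity>"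
proof -
  obtain p e1 e2 where e: "norm e1 = 1" "norm e2 = 1" "e1 \<bullet> e2 = 0"
    and H: "H = {p + s *\<^sub>R e1 + t *\<^sub>R e2 | s t. True}" using plane_frame[OF assms(1)] .
  obtain R where R: "R > 0" "\<And>x. x \<in> A \<Longrightarrow> norm (x - p) \<le> R"
  proof -
    obtain R where "\<forall>x\<in>A. norm (x - p) \<le> R"
      using bounded_any_center[of A p] assms(3) by (auto simp: dist_norm norm_minus_commute)
    then show thesis using that[of "max R 1"] by fastforce
  qed
  have rep: "\<exists>s t. x = p + s *\<^sub>R e1 + t *\<^sub>R e2 \<and> \<bar>s\<bar> \<le> R \<and> \<bar>t\<bar> \<le> R" if "x \<in> A" for x
  proof -
    obtain s t where x: "x = p + s *\<^sub>R e1 + t *\<^sub>R e2" using H assms(2) \<open>x \<in> A\<close> by blast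
    have "s = (x - p) \<bullet> e1" "t = (x - p) \<bullet> e2"
      using e by (auto simp: x inner_add_left norm_eq_1 inner_commute[of e2 e1])
    then have "\<bar>s\<bar> \<le> norm (x - p)" "\<bar>t\<bar> \<le> norm (x - p)"
      using Cauchy_Schwarz_ineq2[of "x - p" e1] Cauchy_Schwarz_ineq2[of "x - p" e2] e by auto
    then show ?thesis using x R(2)[OF that] by force
  qed
  have "h2_pre d A \<le> ennreal (4 * pi * R\<^sup>2)" if d: "d > 0" for d
  proof -
    obtain N :: nat where N: "real N > 4 * R / d" using reals_Archimedean2 by blast
    moreover have "4 * R / d > 0" using R(1) d by simp
    ultimately have N0: "N > 0" by (metis of_nat_0_less_iff order.strict_trans)
    have Nd: "4 * R / real N \<le> d" using N N0 d by (simp add: field_simps)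
    let ?f = "\<lambda>(i, j). (\<lambda>(s, t). p + s *\<^sub>R e1 + t *\<^sub>R e2) ` (grid_cell R N i \<times> grid_cell R N j)"
    have "h2_pre d A \<le> ennreal (real (card (?f ` ({..<N} \<times> {..<N}))) * (pi / 4 * (4 * R / real N)\<^sup>2))"
    proof (rule h2_pre_finite_cover)
      show "A \<subseteq> \<Union> (?f ` ({..<N} \<times> {..<N}))"
      proof
        fix x assume "x \<in> A"
        then obtain s t where x: "x = p + s *\<^sub>R e1 + t *\<^sub>R e2" "\<bar>s\<bar> \<le> R" "\<bar>t\<bar> \<le> R" using rep by blast
        then obtain i j where "i < N" "j < N" "s \<in> grid_cell R N i" "t \<in> grid_cell R N j"
          using grid_cell_cover[OF R(1) N0] by blast
        then have "(i, j) \<in> {..<N} \<times> {..<N}" "x \<in> ?f (i, j)" using x by auto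
        then show "x \<in> \<Union> (?f ` ({..<N} \<times> {..<N}))" by blast
      qed
      fix S assume "S \<in> ?f ` ({..<N} \<times> {..<N})"
      then obtain i j where S: "S = ?f (i, j)" by blast
      have "norm (x - y) \<le> 4 * R / real N" if "x \<in> S" "y \<in> S" for x y
      proof -
        obtain s t s' t' where st: "x = p + s *\<^sub>R e1 + t *\<^sub>R e2" "y = p + s' *\<^sub>R e1 + t' *\<^sub>R e2"
          "s \<in> grid_cell R N i" "t \<in> grid_cell R N j" "s' \<in> grid_cell R N i" "t' \<in> grid_cell R N j"
          using \<open>x \<in> S\<close> \<open>y \<in> S\<close> by (auto simp: S)
        have "norm (x - y) = norm ((s - s') *\<^sub>R e1 + (t - t') *\<^sub>R e2)" by (simp add: st algebra_simps)
        also have "\<dots> \<le> \<bar>s - s'\<bar> + \<bar>t - t'\<bar>" using norm_triangle_ineq[of "(s - s') *\<^sub>R e1" "(t - t') *\<^sub>R e2"] e by simp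
        finally show ?thesis using grid_cell_dist[OF st(3,5)] grid_cell_dist[OF st(4,6)] by linarith
      qed
      moreover from this have "bounded S"
        unfolding bounded_two_points by (auto simp: dist_norm)
      ultimately show "bounded S \<and> diameter S \<le> 4 * R / real N"
        using R(1) by (auto intro!: diameter_le)
    qed (use Nd R(1) in auto)
    also have "\<dots> \<le> ennreal (real (N * N) * (pi / 4 * (4 * R / real N)\<^sup>2))"
    proof (intro ennreal_leI mult_right_mono)
      show "real (card (?f ` ({..<N} \<times> {..<N}))) \<le> real (N * N)"
        using card_image_le[of "{..<N} \<times> {..<N}" ?f] by (simp only: of_nat_le_iff) (simp add: card_cartesian_product)
    qed auto
    also have "real (N * N) * (pi / 4 * (4 * R / real N)\<^sup>2) = 4 * pi * R\<^sup>2"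
      using N0 by (simp add: power2_eq_square field_simps)
    finally show ?thesis .
  qed
  then have "hausdorff2 A \<le> ennreal (4 * pi * R\<^sup>2)"
    unfolding hausdorff2_eq by (intro SUP_least) auto
  also have "\<dots> < \<infinity>" by simp
  finally show ?thesis .
qed

text \<open>The orthogonal projection to the coordinates of the plane maps a set of diameter d into a
  square of side 2d; comparing with planar Lebesgue measure bounds every covering sum from below.\<close>

lemma hausdorff2_openin_plane:
  assumes "plane H" "openin (top_of_set H) A" "A \<noteq> {}"
  shows "0 < hausdorff2 A"
proof -
  obtain p e1 e2 where e: "norm e1 = 1" "norm e2 = 1" "e1 \<bullet> e2 = 0"
    and H: "H = {p + s *\<^sub>R e1 + t *\<^sub>R e2 | s t. True}" using plane_frame[OF assms(1)] .
  obtain x0 where x0: "x0 \<in> A" using assms(3) by blast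
  then obtain r where r: "r > 0" "ball x0 r \<inter> H \<subseteq> A" "x0 \<in> H"
    using assms(2) openin_contains_ball[of H A] by (metis Int_commute openin_imp_subset subsetD)
  then obtain s0 t0 where st0: "x0 = p + s0 *\<^sub>R e1 + t0 *\<^sub>R e2" using H by blast
  define \<pi> where "\<pi> x = ((x - p) \<bullet> e1, (x - p) \<bullet> e2)" for x
  have \<pi>: "\<pi> (p + s *\<^sub>R e1 + t *\<^sub>R e2) = (s, t)" for s t
    using e by (auto simp: \<pi>_def inner_add_left norm_eq_1 inner_commute[of e2 e1])
  define Q where "Q z d = cbox (fst z - d, snd z - d) (fst z + d, snd z + d)" for z :: "real \<times> real" and d
  have Q: "emeasure lborel (Q z d) = ennreal (4 * d\<^sup>2)" if "d \<ge> 0" for z d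
    unfolding Q_def using that
    by (subst emeasure_lborel_cbox) (auto simp: Basis_prod_def power2_eq_square)
  have low: "ennreal (r\<^sup>2 / 4) \<le> ennreal (16 / pi) * h2_size C" if C: "C \<in> h2_covers 1 A" for C
  proof -
    \<comment> \<open>Any point of \<open>C n\<close> serves as centre: the projection of
      \<open>C n\<close> lies in the square around the projected centre with half side
      \<open>diameter (C n)\<close>. The area of this square is 16/pi times the summand of
      \<open>C n\<close>.\<close>
    define z where "z n = (SOME x. x \<in> C n)" for n
    define K where "K n = (if C n = {} then {} else Q (\<pi> (z n)) (diameter (C n)))" for n
    have "Q (s0, t0) (r / 4) \<subseteq> (\<Union>n. K n)"
    proof
      fix q assume q: "q \<in> Q (s0, t0) (r / 4)"
      obtain s t where st: "q = (s, t)" by fastforce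
      have "s0 - r / 4 \<le> s" "s \<le> s0 + r / 4" "t0 - r / 4 \<le> t" "t \<le> t0 + r / 4"
        using q by (auto simp: st Q_def cbox_Pair_eq)
      then have b: "\<bar>s - s0\<bar> \<le> r / 4" "\<bar>t - t0\<bar> \<le> r / 4" by linarith+
      let ?x = "p + s *\<^sub>R e1 + t *\<^sub>R e2"
      have "?x - x0 = (s - s0) *\<^sub>R e1 + (t - t0) *\<^sub>R e2" by (simp add: st0 algebra_simps)
      then have "norm (?x - x0) \<le> \<bar>s - s0\<bar> + \<bar>t - t0\<bar>"
        using norm_triangle_ineq[of "(s - s0) *\<^sub>R e1" "(t - t0) *\<^sub>R e2"] e by simp
      then have "?x \<in> ball x0 r" using b r(1) by (simp add: dist_norm norm_minus_commute)
      then have "?x \<in> A" using r(2) H by blast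
      then obtain n where n: "?x \<in> C n" using C by (auto simp: h2_covers_def)
      have zn: "z n \<in> C n" unfolding z_def using n by (rule someI)
      have "bounded (C n)" using C by (auto simp: h2_covers_def)
      then have d: "norm (?x - z n) \<le> diameter (C n)" using diameter_bounded_bound n zn by (fastforce simp: dist_norm)
      have "\<pi> ?x - \<pi> (z n) = ((?x - z n) \<bullet> e1, (?x - z n) \<bullet> e2)"
        by (simp add: \<pi>_def inner_diff_left inner_add_left)
      moreover have "\<bar>(?x - z n) \<bullet> e1\<bar> \<le> diameter (C n)" "\<bar>(?x - z n) \<bullet> e2\<bar> \<le> diameter (C n)"
        using Cauchy_Schwarz_ineq2[of "?x - z n" e1] Cauchy_Schwarz_ineq2[of "?x - z n" e2] e d by auto
      ultimately have "q \<in> Q (\<pi> (z n)) (diameter (C n))"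
        by (cases "\<pi> (z n)") (auto simp: \<pi> st Q_def cbox_Pair_eq)
      then show "q \<in> (\<Union>n. K n)" using n by (auto simp: K_def)
    qed
    then have "emeasure lborel (Q (s0, t0) (r / 4)) \<le> emeasure lborel (\<Union>n. K n)"
      by (intro emeasure_mono) (auto simp: K_def Q_def)
    also have "\<dots> \<le> (\<Sum>n. emeasure lborel (K n))"
      by (intro emeasure_subadditive_countably) (auto simp: K_def Q_def)
    also have "\<dots> \<le> (\<Sum>n. ennreal (16 / pi) * ennreal (pi / 4 * (diameter (C n))\<^sup>2))"
    proof (intro suminf_le)
      fix n
      have "bounded (C n)" using C by (auto simp: h2_covers_def)
      then show "emeasure lborel (K n) \<le> ennreal (16 / pi) * ennreal (pi / 4 * (diameter (C n))\<^sup>2)"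
        by (auto simp: K_def Q diameter_ge_0 ennreal_mult'[symmetric])
    qed auto
    also have "\<dots> = ennreal (16 / pi) * h2_size C" by (simp add: h2_size_def)
    finally show ?thesis using r(1) by (simp add: Q power2_eq_square)
  qed
  have "h2_pre 1 A \<noteq> 0"
  proof
    assume z: "h2_pre 1 A = 0"
    \<comment> \<open>The threshold is chosen so that 16/pi times it is r^2/4, the area of the
      square of half side r/4 that the projected cover has to contain.\<close>
    have "0 < ennreal (pi * r\<^sup>2 / 64)" using r(1) by simp
    then obtain C where C: "C \<in> h2_covers 1 A" "h2_size C < ennreal (pi * r\<^sup>2 / 64)"
      using z unfolding h2_pre_def by (metis INF_less_iff)
    have "ennreal (r\<^sup>2 / 4) \<le> ennreal (16 / pi) * h2_size C" by (rule low[OF C(1)])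
    also have "\<dots> < ennreal (16 / pi) * ennreal (pi * r\<^sup>2 / 64)"
      using C(2) by (intro ennreal_mult_strict_left_mono) auto
    also have "\<dots> = ennreal (r\<^sup>2 / 4)" by (simp add: ennreal_mult'[symmetric])
    finally show False by simp
  qed
  then show ?thesis using h2_pre_le_hausdorff2[of 1 A] by (auto simp: zero_less_iff_neq_zero)
qed

section \<open>Polyhedral sets near generic points\<close>

lemma polytope_halfspaces:
  fixes K :: "'a::euclidean_space set"
  assumes "polytope K"
  shows "\<exists>\<Phi>. finite \<Phi> \<and> (\<forall>h\<in>\<Phi>. fst h \<noteq> 0) \<and> K = {x. \<forall>h\<in>\<Phi>. fst h \<bullet> x \<le> snd h}"
proof -
  obtain F where F: "finite F" "K = \<Inter>F" "\<forall>h\<in>F. \<exists>a b. a \<noteq> 0 \<and> h = {x. a \<bullet> x \<le> b}"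
    using polytope_imp_polyhedron[OF assms] unfolding polyhedron_def by blast
  then obtain a b where ab: "\<And>h. h \<in> F \<Longrightarrow> a h \<noteq> 0 \<and> h = {x. a h \<bullet> x \<le> b h}" by metis
  show ?thesis
  proof (intro exI[of _ "(\<lambda>h. (a h, b h)) ` F"] conjI)
    show "K = {x. \<forall>h\<in>(\<lambda>h. (a h, b h)) ` F. fst h \<bullet> x \<le> snd h}"
    proof (rule set_eqI)
      fix x
      have "x \<in> h \<longleftrightarrow> a h \<bullet> x \<le> b h" if "h \<in> F" for h using ab[OF that] by blast
      then show "x \<in> K \<longleftrightarrow> x \<in> {x. \<forall>h\<in>(\<lambda>h. (a h, b h)) ` F. fst h \<bullet> x \<le> snd h}"
        unfolding F(2) by simp
    qed
  qed (use F(1) ab in auto)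
qed

definition hyperplane :: "'a::euclidean_space \<times> real \<Rightarrow> 'a set" where
  "hyperplane h = {x. fst h \<bullet> x = snd h}"

text \<open>Hyperplanes are compared as sets, since one hyperplane has many equations; only
  geometrically different ones count. In three-space the intersections are lines or empty, hence of
  area zero.\<close>

definition crossings :: "('a::euclidean_space \<times> real) set \<Rightarrow> 'a set" where
  "crossings \<Phi> = (\<Union>(h, h')\<in>{(h, h'). h \<in> \<Phi> \<and> h' \<in> \<Phi> \<and> hyperplane h \<noteq> hyperplane h'}.
     hyperplane h \<inter> hyperplane h')"

lemma collinear_hyperplane_Int:
  fixes h h' :: "space \<times> real"
  assumes "fst h \<noteq> 0" "fst h' \<noteq> 0" "hyperplane h \<noteq> hyperplane h'"
  shows "collinear (hyperplane h \<inter> hyperplane h')"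
proof -
  have d: "aff_dim (hyperplane h) = 2" "aff_dim (hyperplane h') = 2"
    using assms by (auto simp: hyperplane_def)
  have aff: "affine (hyperplane h)" "affine (hyperplane h')"
    by (auto simp: hyperplane_def affine_hyperplane)
  have ns: "\<not> hyperplane h \<subseteq> hyperplane h'"
  proof
    assume "hyperplane h \<subseteq> hyperplane h'"
    then have "hyperplane h = hyperplane h'"
      using d aff by (metis aff_dim_empty affine_dim_equal neg_one_neq_numeral)
    then show False using assms(3) by simp
  qed
  have "aff_dim (hyperplane h \<inter> hyperplane h') \<le> 1"
    using aff_dim_affine_Int_hyperplane[OF aff(1), of "fst h'" "snd h'"] d ns
    by (auto simp: hyperplane_def split: if_splits)
  then show ?thesis by (simp add: collinear_aff_dim)
qed

lemma null_sets_crossings: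
  assumes "finite \<Phi>" "\<And>h. h \<in> \<Phi> \<Longrightarrow> fst h \<noteq> 0"
  shows "crossings \<Phi> \<in> null_sets surface_measure"
proof -
  let ?P = "{(h, h'). h \<in> \<Phi> \<and> h' \<in> \<Phi> \<and> hyperplane h \<noteq> hyperplane h'}"
  have fin: "finite ?P" by (rule finite_subset[of _ "\<Phi> \<times> \<Phi>"]) (use assms(1) in auto)
  have null: "(case p of (h, h') \<Rightarrow> hyperplane h \<inter> hyperplane h') \<in> null_sets surface_measure"
    if "p \<in> ?P" for p
  proof -
    obtain h h' where p: "p = (h, h')" by (rule prod.exhaust)
    have "closed (hyperplane h \<inter> hyperplane h')"
      by (intro closed_Int) (auto simp: hyperplane_def closed_hyperplane)
    then have "hyperplane h \<inter> hyperplane h' \<in> sets borel" by (rule borel_closed)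
    moreover have "hausdorff2 (hyperplane h \<inter> hyperplane h') = 0"
      using that assms(2) p by (intro hausdorff2_collinear collinear_hyperplane_Int) auto
    ultimately show ?thesis by (simp add: p null_sets_def emeasure_surface_measure)
  qed
  show ?thesis
    unfolding crossings_def using fin null by (intro null_sets_UN' countable_finite)
qed

text \<open>All hyperplanes of \<Phi> through y coincide, and c is their normal. If none passes
  through y, any nonzero c qualifies.\<close>

definition generic_normal :: "('a::euclidean_space \<times> real) set \<Rightarrow> 'a \<Rightarrow> 'a \<Rightarrow> bool" where
  "generic_normal \<Phi> y c \<longleftrightarrow> c \<noteq> 0 \<and>
     (\<forall>h\<in>\<Phi>. y \<in> hyperplane h \<longrightarrow> hyperplane h = {x. c \<bullet> x = c \<bullet> y})"

lemma generic_normal_exists: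
  assumes "y \<notin> crossings \<Phi>" "\<And>h. h \<in> \<Phi> \<Longrightarrow> fst h \<noteq> 0"
  shows "\<exists>c. generic_normal \<Phi> y c"
proof (cases "\<exists>h\<in>\<Phi>. y \<in> hyperplane h")
  case True
  then obtain h where h: "h \<in> \<Phi>" "y \<in> hyperplane h" by blast
  then have "hyperplane h = {x. fst h \<bullet> x = fst h \<bullet> y}" by (auto simp: hyperplane_def)
  then show ?thesis using h assms unfolding generic_normal_def crossings_def
    by (intro exI[of _ "fst h"]) blast
next
  case False
  obtain b :: 'a where "b \<in> Basis" using nonempty_Basis by blast
  then show ?thesis using False unfolding generic_normal_def
    by (intro exI[of _ b]) (auto simp: nonzero_Basis)
qed

lemma hyperplane_parallel:
  fixes c :: "'a::euclidean_space"
  assumes "c \<noteq> 0" "a \<noteq> 0" "{x. a \<bullet> x = b} = {x. c \<bullet> x = c \<bullet> y}"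
  obtains k where "k \<noteq> 0" "a = k *\<^sub>R c" "b = k * (c \<bullet> y)"
proof -
  define k where "k = (a \<bullet> c) / (c \<bullet> c)"
  define v where "v = a - k *\<^sub>R c"
  have cv: "c \<bullet> v = 0" using assms(1) by (simp add: v_def k_def inner_diff_right inner_commute)
  have y: "a \<bullet> y = b" using assms(3) by auto
  have "y + v \<in> {x. a \<bullet> x = b}" unfolding assms(3) using cv by (simp add: inner_add_right)
  then have "a \<bullet> v = 0" using y by (simp add: inner_add_right)
  then have "v \<bullet> v = 0" using cv by (simp add: v_def inner_diff_left)
  then have "a = k *\<^sub>R c" by (simp add: v_def)
  moreover then have "b = k * (c \<bullet> y)" "k \<noteq> 0" using y assms(2) by auto
  ultimately show thesis using that by blast
qed

text \<open>Near y the set S is a union of some of the plane through y with normal c and the two open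
  half-spaces bounded by it.\<close>

definition sign_local :: "'a::euclidean_space \<Rightarrow> 'a \<Rightarrow> 'a set \<Rightarrow> bool" where
  "sign_local c y S \<longleftrightarrow> (\<exists>T. \<forall>\<^sub>F x in nhds y. x \<in> S \<longleftrightarrow> sgn (c \<bullet> (x - y)) \<in> T)"

text \<open>If the bounding plane passes through y, it is the generic plane and the sign of
  \<open>c \<bullet> (x - y)\<close> decides membership; otherwise the half-space is locally
  everything or nothing.\<close>

lemma sign_local_halfspace:
  assumes g: "generic_normal \<Phi> y c" and h: "h \<in> \<Phi>" "fst h \<noteq> 0"
  shows "sign_local c y {x. fst h \<bullet> x \<le> snd h}"
proof (cases "y \<in> hyperplane h")
  case True
  then obtain k where k: "k \<noteq> 0" "fst h = k *\<^sub>R c" "snd h = k * (c \<bullet> y)"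
    using hyperplane_parallel[of c "fst h" "snd h" y] g h
    unfolding generic_normal_def hyperplane_def by metis
  have "fst h \<bullet> x \<le> snd h \<longleftrightarrow> k * (c \<bullet> (x - y)) \<le> 0" for x
    by (simp add: k inner_diff_right algebra_simps)
  then have "x \<in> {x. fst h \<bullet> x \<le> snd h} \<longleftrightarrow> sgn (c \<bullet> (x - y)) \<in> {s. k * s \<le> 0}" for x
    using k(1) by (auto simp: sgn_if mult_le_0_iff split: if_splits)
  then show ?thesis unfolding sign_local_def by (intro exI always_eventually allI)
next
  case False
  have cont: "isCont (\<lambda>x. fst h \<bullet> x) y" by (intro continuous_intros)
  from False consider "fst h \<bullet> y < snd h" | "fst h \<bullet> y > snd h"
    by (force simp: hyperplane_def)
  then show ?thesis
  proof cases
    case 1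
    then have "\<forall>\<^sub>F x in nhds y. fst h \<bullet> x < snd h"
      using cont by (intro order_tendstoD(2)[of _ "fst h \<bullet> y"]) (auto simp: continuous_at tendsto_at_iff_tendsto_nhds)
    then have "\<forall>\<^sub>F x in nhds y. x \<in> {x. fst h \<bullet> x \<le> snd h} \<longleftrightarrow> sgn (c \<bullet> (x - y)) \<in> UNIV"
      by eventually_elim auto
    then show ?thesis unfolding sign_local_def by blast
  next
    case 2
    then have "\<forall>\<^sub>F x in nhds y. fst h \<bullet> x > snd h"
      using cont by (intro order_tendstoD(1)[of _ "fst h \<bullet> y"]) (auto simp: continuous_at tendsto_at_iff_tendsto_nhds)
    then have "\<forall>\<^sub>F x in nhds y. x \<in> {x. fst h \<bullet> x \<le> snd h} \<longleftrightarrow> sgn (c \<bullet> (x - y)) \<in> {}"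
      by eventually_elim auto
    then show ?thesis unfolding sign_local_def by blast
  qed
qed

lemma sign_local_INT:
  assumes "finite I" "\<And>i. i \<in> I \<Longrightarrow> sign_local c y (S i)"
  shows "sign_local c y {x. \<forall>i\<in>I. x \<in> S i}"
proof -
  obtain T where "\<And>i. i \<in> I \<Longrightarrow> \<forall>\<^sub>F x in nhds y. x \<in> S i \<longleftrightarrow> sgn (c \<bullet> (x - y)) \<in> T i"
    using assms(2) unfolding sign_local_def by metis
  then have "\<forall>\<^sub>F x in nhds y. \<forall>i\<in>I. x \<in> S i \<longleftrightarrow> sgn (c \<bullet> (x - y)) \<in> T i"
    using assms(1) by (simp add: eventually_ball_finite_distrib)
  then have "\<forall>\<^sub>F x in nhds y. x \<in> {x. \<forall>i\<in>I. x \<in> S i} \<longleftrightarrow> sgn (c \<bullet> (x - y)) \<in> {s. \<forall>i\<in>I. s \<in> T i}"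
    by eventually_elim auto
  then show ?thesis unfolding sign_local_def by blast
qed

lemma sign_local_Union:
  assumes "finite F" "\<And>S. S \<in> F \<Longrightarrow> sign_local c y S"
  shows "sign_local c y (\<Union>F)"
proof -
  obtain T where "\<And>S. S \<in> F \<Longrightarrow> \<forall>\<^sub>F x in nhds y. x \<in> S \<longleftrightarrow> sgn (c \<bullet> (x - y)) \<in> T S"
    using assms(2) unfolding sign_local_def by metis
  then have "\<forall>\<^sub>F x in nhds y. \<forall>S\<in>F. x \<in> S \<longleftrightarrow> sgn (c \<bullet> (x - y)) \<in> T S"
    using assms(1) by (simp add: eventually_ball_finite_distrib)
  then have "\<forall>\<^sub>F x in nhds y. x \<in> \<Union>F \<longleftrightarrow> sgn (c \<bullet> (x - y)) \<in> (\<Union>S\<in>F. T S)"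
    by eventually_elim auto
  then show ?thesis unfolding sign_local_def by blast
qed

text \<open>The conclusion covers all larger families \<Psi>, so that a further plane, such as that
  of a polygon, can be added before a generic point is chosen.\<close>

lemma polytopes_generic:
  fixes F :: "'a::euclidean_space set set"
  assumes "finite F" "\<And>K. K \<in> F \<Longrightarrow> polytope K"
  obtains \<Phi> where "finite \<Phi>" "\<And>h. h \<in> \<Phi> \<Longrightarrow> fst h \<noteq> 0"
    "\<And>\<Psi> y c K. \<Phi> \<subseteq> \<Psi> \<Longrightarrow> generic_normal \<Psi> y c \<Longrightarrow> K \<in> F \<Longrightarrow> sign_local c y K"
proof -
  have "\<forall>K\<in>F. \<exists>\<Phi>. finite \<Phi> \<and> (\<forall>h\<in>\<Phi>. fst h \<noteq> 0) \<and> K = {x. \<forall>h\<in>\<Phi>. fst h \<bullet> x \<le> snd h}"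
    using polytope_halfspaces assms(2) by blast
  from bchoice[OF this] obtain \<Phi> where \<Phi>: "\<forall>K\<in>F. finite (\<Phi> K) \<and> (\<forall>h\<in>\<Phi> K. fst h \<noteq> 0) \<and>
      K = {x. \<forall>h\<in>\<Phi> K. fst h \<bullet> x \<le> snd h}" ..
  show thesis
  proof (rule that[of "\<Union>K\<in>F. \<Phi> K"])
    fix \<Psi> y c K
    assume *: "(\<Union>K\<in>F. \<Phi> K) \<subseteq> \<Psi>" "generic_normal \<Psi> y c" "K \<in> F"
    have "sign_local c y {x. \<forall>h\<in>\<Phi> K. x \<in> {x. fst h \<bullet> x \<le> snd h}}"
    proof (rule sign_local_INT)
      fix h assume "h \<in> \<Phi> K"
      then show "sign_local c y {x. fst h \<bullet> x \<le> snd h}"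
        using * \<Phi> by (intro sign_local_halfspace[OF *(2)]) auto
    qed (use \<Phi> * in auto)
    moreover have "K = {x. \<forall>h\<in>\<Phi> K. fst h \<bullet> x \<le> snd h}" using \<Phi> * by blast
    ultimately show "sign_local c y K" by simp
  qed (use assms(1) \<Phi> in auto)
qed

section \<open>Germs of open polyhedral sets\<close>

definition half_local :: "'a::euclidean_space \<Rightarrow> 'a \<Rightarrow> 'a set \<Rightarrow> bool" where
  "half_local c y D \<longleftrightarrow>
     (\<forall>\<^sub>F x in nhds y. x \<notin> D) \<or> (\<forall>\<^sub>F x in nhds y. x \<in> D) \<or>
     (\<forall>\<^sub>F x in nhds y. x \<in> D \<longleftrightarrow> c \<bullet> (x - y) > 0) \<or>
     (\<forall>\<^sub>F x in nhds y. x \<in> D \<longleftrightarrow> c \<bullet> (x - y) < 0)"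

lemma shift_along_normal:
  fixes c :: "'a::euclidean_space"
  assumes "open U" "x \<in> U" "c \<noteq> 0"
  obtains t where "t > 0" "x + t *\<^sub>R c \<in> U" "x - t *\<^sub>R c \<in> U"
proof -
  obtain e where e: "e > 0" "ball x e \<subseteq> U" using assms open_contains_ball by blast
  define t where "t = e / 2 / norm c"
  have "t > 0" "norm (t *\<^sub>R c) < e" using e(1) assms(3) by (auto simp: t_def)
  then show thesis using e(2) by (intro that[of t]) (auto simp: dist_norm)
qed

text \<open>Passing to the interior removes the plane if one of its sides is missing. If both sides
  belong to S, closedness adds the plane itself, so that no slit remains. Only the membership of 1
  and -1 in T matters, which leaves four germs.\<close>

lemma half_local_interior:
  assumes "closed S" "c \<noteq> 0" "sign_local c y S"
  shows "half_local c y (interior S)"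
proof -
  obtain T where "\<forall>\<^sub>F x in nhds y. x \<in> S \<longleftrightarrow> sgn (c \<bullet> (x - y)) \<in> T"
    using assms(3) unfolding sign_local_def by blast
  then obtain U where U: "open U" "y \<in> U" and T: "\<And>x. x \<in> U \<Longrightarrow> x \<in> S \<longleftrightarrow> sgn (c \<bullet> (x - y)) \<in> T"
    unfolding eventually_nhds by blast
  have nh: "\<forall>\<^sub>F x in nhds y. x \<in> U" using U by (rule eventually_nhds_in_open)
  have cc: "c \<bullet> c > 0" using assms(2) by simp
  \<comment> \<open>An interior point on the plane or above it can be shifted along c into the upper
    side without leaving S, so this side belongs to S near y. \<open>down\<close> is the mirror
    image.\<close>
  have up: "1 \<in> T" if x: "x \<in> U" "x \<in> interior S" "c \<bullet> (x - y) \<ge> 0" for x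
  proof -
    obtain t where t: "t > 0" "x + t *\<^sub>R c \<in> U \<inter> interior S"
      using shift_along_normal[of "U \<inter> interior S" x c] U x assms(2) by auto
    have "c \<bullet> (x + t *\<^sub>R c - y) = c \<bullet> (x - y) + t * (c \<bullet> c)" by (simp add: inner_diff_right inner_add_right)
    also have "\<dots> > 0" using x(3) t(1) cc by (simp add: add_nonneg_pos)
    finally show ?thesis using T[of "x + t *\<^sub>R c"] t(2) interior_subset by auto
  qed
  have down: "-1 \<in> T" if x: "x \<in> U" "x \<in> interior S" "c \<bullet> (x - y) \<le> 0" for x
  proof -
    obtain t where t: "t > 0" "x - t *\<^sub>R c \<in> U \<inter> interior S"
      using shift_along_normal[of "U \<inter> interior S" x c] U x assms(2) by auto
    have "c \<bullet> (x - t *\<^sub>R c - y) = c \<bullet> (x - y) - t * (c \<bullet> c)" by (simp add: inner_diff_right)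
    also have "\<dots> < 0" using x(3) t(1) cc by (simp add: le_less_trans)
    finally show ?thesis using T[of "x - t *\<^sub>R c"] t(2) interior_subset by auto
  qed
  have half_open: "open (U \<inter> {x. c \<bullet> (x - y) > 0})" "open (U \<inter> {x. c \<bullet> (x - y) < 0})"
    using U by (auto intro!: open_Int open_Collect_less continuous_on_inner continuous_on_diff)
  have pos: "x \<in> interior S" if "1 \<in> T" "x \<in> U" "c \<bullet> (x - y) > 0" for x
    using that T half_open by (intro interiorI[of "U \<inter> {x. c \<bullet> (x - y) > 0}"]) auto
  have neg: "x \<in> interior S" if "-1 \<in> T" "x \<in> U" "c \<bullet> (x - y) < 0" for x
    using that T half_open by (intro interiorI[of "U \<inter> {x. c \<bullet> (x - y) < 0}"]) auto
  consider "1 \<in> T" "-1 \<in> T" | "1 \<in> T" "-1 \<notin> T" | "1 \<notin> T" "-1 \<in> T" | "1 \<notin> T" "-1 \<notin> T" by blast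
  then show ?thesis
  proof cases
    case 1
    \<comment> \<open>The upper side accumulates at y, so closedness of S puts y into S; this yields
      the sign 0.\<close>
    have "y \<in> closure S"
      unfolding closure_iff_nhds_not_empty
    proof (intro allI impI)
      fix A V assume "V \<subseteq> A" "open V" "y \<in> V"
      then obtain t where t: "t > 0" "y + t *\<^sub>R c \<in> U \<inter> V"
        using shift_along_normal[of "U \<inter> V" y c] U assms(2) by auto
      moreover have "c \<bullet> (y + t *\<^sub>R c - y) > 0" using t(1) cc by simp
      ultimately have "y + t *\<^sub>R c \<in> S" using T 1 by auto
      then show "S \<inter> A \<noteq> {}" using t(2) \<open>V \<subseteq> A\<close> by blast
    qed
    then have "0 \<in> T" using T[OF U(2)] assms(1) by (simp add: closure_closed)
    then have "U \<subseteq> S" using T 1 by (auto simp: sgn_if)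
    then have "U \<subseteq> interior S" using U(1) by (simp add: interior_maximal)
    then have "\<forall>\<^sub>F x in nhds y. x \<in> interior S" using nh by (auto elim: eventually_mono)
    then show ?thesis by (simp add: half_local_def)
  next
    case 2
    have "\<forall>\<^sub>F x in nhds y. x \<in> interior S \<longleftrightarrow> c \<bullet> (x - y) > 0"
      using nh by eventually_elim (use 2 pos down in force)
    then show ?thesis by (simp add: half_local_def)
  next
    case 3
    have "\<forall>\<^sub>F x in nhds y. x \<in> interior S \<longleftrightarrow> c \<bullet> (x - y) < 0"
      using nh by eventually_elim (use 3 neg up in force)
    then show ?thesis by (simp add: half_local_def)
  next
    case 4
    have "\<forall>\<^sub>F x in nhds y. x \<notin> interior S"
      using nh by eventually_elim (use 4 up down in force)
    then show ?thesis by (simp add: half_local_def)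
  qed
qed

lemma open_polyhedralE:
  assumes "open_polyhedral D"
  obtains F where "finite F" "\<And>K. K \<in> F \<Longrightarrow> polytope K" "D = interior (\<Union>F)"
  using assms unfolding open_polyhedral_in_def by (metis euclidean_interior_of subtopology_UNIV)

lemma compact_Union_polytopes:
  fixes F :: "'a::euclidean_space set set"
  shows "finite F \<Longrightarrow> (\<And>K. K \<in> F \<Longrightarrow> polytope K) \<Longrightarrow> compact (\<Union>F)"
  by (intro compact_Union polytope_imp_compact) auto

text \<open>All sets share one family of planes, hence one normal c. This common direction makes the
  germs of different sets at the same point comparable.\<close>

lemma open_polyhedral_generic:
  assumes "finite \<D>" "\<And>D. D \<in> \<D> \<Longrightarrow> open_polyhedral D"
  obtains N where "N \<in> null_sets surface_measure"
    "\<And>y. y \<notin> N \<Longrightarrow> \<exists>c. c \<noteq> 0 \<and> (\<forall>D\<in>\<D>. half_local c y D)"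
proof -
  have "\<forall>D\<in>\<D>. \<exists>F. finite F \<and> (\<forall>K\<in>F. polytope K) \<and> D = interior (\<Union>F)"
    using assms(2) open_polyhedralE by metis
  then obtain F where F: "\<And>D. D \<in> \<D> \<Longrightarrow> finite (F D) \<and> (\<forall>K\<in>F D. polytope K) \<and> D = interior (\<Union>(F D))"
    by metis
  have FF: "finite (\<Union>D\<in>\<D>. F D)" "\<And>K. K \<in> (\<Union>D\<in>\<D>. F D) \<Longrightarrow> polytope K" using assms(1) F by auto
  obtain \<Phi> where \<Phi>: "finite \<Phi>" "\<And>h. h \<in> \<Phi> \<Longrightarrow> fst h \<noteq> 0"
    and loc: "\<And>\<Psi> y c K. \<Phi> \<subseteq> \<Psi> \<Longrightarrow> generic_normal \<Psi> y c \<Longrightarrow> K \<in> (\<Union>D\<in>\<D>. F D) \<Longrightarrow> sign_local c y K"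
    using polytopes_generic[OF FF] by blast
  show thesis
  proof (rule that[OF null_sets_crossings[OF \<Phi>]])
    fix y assume "y \<notin> crossings \<Phi>"
    then obtain c where c: "generic_normal \<Phi> y c" using generic_normal_exists \<Phi>(2) by blast
    have "half_local c y D" if D: "D \<in> \<D>" for D
    proof -
      have "sign_local c y (\<Union>(F D))"
        using F[OF D] loc[OF order_refl c] D by (intro sign_local_Union) auto
      moreover have "closed (\<Union>(F D))"
        using F[OF D] by (intro compact_imp_closed compact_Union_polytopes) auto
      ultimately have "half_local c y (interior (\<Union>(F D)))"
        using c by (intro half_local_interior) (auto simp: generic_normal_def)
      then show ?thesis using F[OF D] by simp
    qed
    then show "\<exists>c. c \<noteq> 0 \<and> (\<forall>D\<in>\<D>. half_local c y D)" using c by (auto simp: generic_normal_def)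
  qed
qed

lemma plane_hyperplane:
  assumes "plane H"
  obtains h where "fst h \<noteq> 0" "H = hyperplane h"
proof -
  have "affine H" "aff_dim H = 2" using assms by (auto simp: plane_def)
  then have "\<exists>a b. a \<noteq> 0 \<and> affine hull H = {x. a \<bullet> x = b}" "affine hull H = H"
    using aff_dim_eq_hyperplane[of H] by (simp_all add: hull_same)
  then obtain a b where "a \<noteq> 0" "H = {x. a \<bullet> x = b}" by auto
  then show thesis using that[of "(a, b)"] by (auto simp: hyperplane_def)
qed

text \<open>The plane H is added to the family. At a point of the closure outside the crossings the
  generic plane is then H itself, so a polytope within H that contains the point contains a
  neighbourhood of it relative to H. Hence all points of \<open>closure S - S\<close> are
  crossings.\<close>

lemma polygon_closure_null:
  assumes H: "plane H" and S: "open_polyhedral_in H S"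
  shows "closure S - S \<in> null_sets surface_measure"
    and "S \<subseteq> H" and "bounded S" and "openin (top_of_set H) S"
proof -
  obtain F where F: "finite F" "\<And>K. K \<in> F \<Longrightarrow> polytope K \<and> K \<subseteq> H" "S = top_of_set H interior_of (\<Union>F)"
    using S unfolding open_polyhedral_in_def by blast
  have cpt: "compact (\<Union>F)" using F by (intro compact_Union_polytopes) auto
  have SF: "S \<subseteq> \<Union>F" unfolding F(3) by (rule interior_of_subset)
  show "S \<subseteq> H" using SF F(2) by blast
  show "bounded S" using SF cpt bounded_subset compact_imp_bounded by blast
  show op: "openin (top_of_set H) S" unfolding F(3) by (rule openin_interior_of)
  obtain h0 where h0: "fst h0 \<noteq> 0" "H = hyperplane h0" using plane_hyperplane[OF H] .
  have pF: "\<And>K. K \<in> F \<Longrightarrow> polytope K" using F(2) by blast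
  obtain \<Phi> where \<Phi>: "finite \<Phi>" "\<And>h. h \<in> \<Phi> \<Longrightarrow> fst h \<noteq> 0"
    and loc: "\<And>\<Psi> y c K. \<Phi> \<subseteq> \<Psi> \<Longrightarrow> generic_normal \<Psi> y c \<Longrightarrow> K \<in> F \<Longrightarrow> sign_local c y K"
    using polytopes_generic[OF F(1) pF] by blast
  let ?\<Psi> = "insert h0 \<Phi>"
  have sub: "closure S - S \<subseteq> crossings ?\<Psi>"
  proof
    fix y assume y: "y \<in> closure S - S"
    show "y \<in> crossings ?\<Psi>"
    proof (rule ccontr)
      assume "y \<notin> crossings ?\<Psi>"
      then obtain c where c: "generic_normal ?\<Psi> y c"
        using generic_normal_exists[of y ?\<Psi>] \<Phi>(2) h0(1) by auto
      have "y \<in> \<Union>F" using y SF cpt closure_minimal[of S "\<Union>F"] compact_imp_closed by blast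
      then obtain K where K: "K \<in> F" "y \<in> K" by blast
      then have "y \<in> hyperplane h0" using F(2) h0(2) by blast
      then have Hc: "H = {x. c \<bullet> x = c \<bullet> y}" using c h0(2) by (auto simp: generic_normal_def)
      obtain T where "\<forall>\<^sub>F x in nhds y. x \<in> K \<longleftrightarrow> sgn (c \<bullet> (x - y)) \<in> T"
        using loc[of ?\<Psi> y c K] c K unfolding sign_local_def by blast
      then obtain U where U: "open U" "y \<in> U" and T: "\<And>x. x \<in> U \<Longrightarrow> x \<in> K \<longleftrightarrow> sgn (c \<bullet> (x - y)) \<in> T"
        unfolding eventually_nhds by blast
      \<comment> \<open>Sign 0 describes the points of H, so all of H near y belongs to K.\<close>
      have "0 \<in> T" using T[OF U(2)] K(2) by simp
      then have "U \<inter> H \<subseteq> K" using T by (auto simp: Hc inner_diff_right)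
      moreover have "openin (top_of_set H) (U \<inter> H)" using U(1) by (metis Int_commute openin_open_Int)
      moreover have "y \<in> U \<inter> H" using U(2) by (simp add: Hc)
      ultimately have "y \<in> S" unfolding F(3) interior_of_def using K(1) by blast
      then show False using y by blast
    qed
  qed
  have "S \<in> sets borel"
  proof -
    obtain V where "open V" "S = V \<inter> H" using op by (metis Int_commute openin_open)
    moreover have "closed H" unfolding h0(2) hyperplane_def by (rule closed_hyperplane)
    ultimately show ?thesis by auto
  qed
  then have "closure S - S \<in> sets surface_measure" by auto
  moreover have "crossings ?\<Psi> \<in> null_sets surface_measure"
    using \<Phi> h0 by (intro null_sets_crossings) auto
  ultimately show "closure S - S \<in> null_sets surface_measure" using sub null_sets_subset by blast
qed

section \<open>Half-space germs and regular boundary points\<close>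

lemma frontier_of_half:
  fixes c :: "'a::euclidean_space"
  assumes "c \<noteq> 0" "\<forall>\<^sub>F x in nhds y. x \<in> D \<longleftrightarrow> c \<bullet> (x - y) > 0"
  shows "y \<in> frontier D"
proof -
  obtain U where U: "open U" "y \<in> U" "\<And>x. x \<in> U \<Longrightarrow> x \<in> D \<longleftrightarrow> c \<bullet> (x - y) > 0"
    using assms(2) unfolding eventually_nhds by blast
  have "y \<notin> D" using U(3)[OF U(2)] by simp
  moreover have "y \<in> closure D"
    unfolding closure_iff_nhds_not_empty
  proof (intro allI impI)
    fix A V assume "V \<subseteq> A" "open V" "y \<in> V"
    then obtain t where t: "t > 0" "y + t *\<^sub>R c \<in> U \<inter> V"
      using shift_along_normal[of "U \<inter> V" y c] open_Int[OF U(1)] U(2) assms(1) by blast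
    then show "D \<inter> A \<noteq> {}" using U(3)[of "y + t *\<^sub>R c"] \<open>V \<subseteq> A\<close> assms(1) by auto
  qed
  ultimately show ?thesis using interior_subset by (auto simp: frontier_def)
qed

text \<open>A half-space germ has the normal v0 opposite to c. A second normal v would place the
  direction v0 - v inside D, because its product with v is negative, and yet outside D, because its
  product with v0 is positive.\<close>

lemma regular_boundary_half:
  assumes c: "c \<noteq> 0" and D: "\<forall>\<^sub>F x in nhds y. x \<in> D \<longleftrightarrow> c \<bullet> (x - y) > 0"
  shows "y \<in> regular_boundary D"
proof -
  obtain r where r: "r > 0" "\<And>x. x \<in> ball y r \<Longrightarrow> x \<in> D \<longleftrightarrow> c \<bullet> (x - y) > 0"
    using D unfolding eventually_nhds_metric by (auto simp: dist_commute)
  have fr: "y \<in> frontier D" by (rule frontier_of_half[OF assms])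
  define v0 where "v0 = - (c /\<^sub>R norm c)"
  have cv: "c \<bullet> z = - norm c * (v0 \<bullet> z)" for z using c by (simp add: v0_def)
  have nv0: "norm v0 = 1" using c by (simp add: v0_def)
  have "outer_unit_normal D y v0"
    unfolding outer_unit_normal_def
  proof (intro conjI allI impI fr nv0)
    fix k :: real assume k: "k > 0"
    show "\<exists>r>0. \<forall>x\<in>ball y r. ((x - y) \<bullet> v0 < - k * norm (x - y) \<longrightarrow> x \<in> D) \<and>
        ((x - y) \<bullet> v0 > k * norm (x - y) \<longrightarrow> x \<notin> D)"
    proof (intro exI[of _ r] conjI ballI impI r(1))
      fix x assume x: "x \<in> ball y r"
      have kn: "k * norm (x - y) \<ge> 0" using k by simp
      show "x \<in> D" if "(x - y) \<bullet> v0 < - k * norm (x - y)"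
        using r(2)[OF x] that kn c by (simp add: cv mult_less_0_iff inner_commute)
      show "x \<notin> D" if "(x - y) \<bullet> v0 > k * norm (x - y)"
        using r(2)[OF x] that kn c by (simp add: cv mult_less_0_iff inner_commute)
    qed
  qed
  moreover have "v = v0" if v: "outer_unit_normal D y v" for v
  proof (rule ccontr)
    assume ne: "v \<noteq> v0"
    have nv: "norm v = 1" using v by (simp add: outer_unit_normal_def)
    define z where "z = v0 - v"
    have "(v0 - v) \<bullet> (v0 - v) > 0" using ne by simp
    then have lt: "v0 \<bullet> v < 1"
      using nv nv0 by (simp add: inner_diff_left inner_diff_right inner_commute[of v v0] norm_eq_1)
    \<comment> \<open>Half of -(z \<bullet> v) / norm z, so that the cone condition for v holds
      strictly in the direction z.\<close>
    define k where "k = (1 - v0 \<bullet> v) / (2 * norm z)"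
    have nz: "norm z > 0" using ne by (simp add: z_def)
    have k: "k > 0" using lt nz by (simp add: k_def)
    obtain r' where r': "r' > 0" "\<And>x. x \<in> ball y r' \<Longrightarrow> (x - y) \<bullet> v < - k * norm (x - y) \<Longrightarrow> x \<in> D"
      using v k unfolding outer_unit_normal_def by blast
    define t where "t = min r r' / (2 * norm z)"
    have t: "t > 0" using r(1) r'(1) nz by (simp add: t_def)
    have tn: "t * norm z = min r r' / 2" using nz by (simp add: t_def)
    have b: "y + t *\<^sub>R z \<in> ball y r" "y + t *\<^sub>R z \<in> ball y r'"
      using tn t r(1) r'(1) by (auto simp: dist_norm)
    have "z \<bullet> v = v0 \<bullet> v - 1" using nv by (simp add: z_def inner_diff_left norm_eq_1)
    moreover have "k * norm z = (1 - v0 \<bullet> v) / 2" using nz by (simp add: k_def)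
    ultimately have "z \<bullet> v < - (k * norm z)" using lt by simp
    then have "t * (z \<bullet> v) < t * (- (k * norm z))" using t by (rule mult_strict_left_mono)
    then have "y + t *\<^sub>R z \<in> D" using r'(2)[OF b(2)] t by (simp add: mult.left_commute)
    then have "c \<bullet> (t *\<^sub>R z) > 0" using r(2)[OF b(1)] by simp
    moreover have "v0 \<bullet> z > 0" using lt nv0 by (simp add: z_def inner_diff_right norm_eq_1)
    ultimately have "c \<bullet> z < 0" using c by (simp add: cv mult_less_0_iff)
    then show False using t \<open>c \<bullet> (t *\<^sub>R z) > 0\<close> by (simp add: zero_less_mult_iff)
  qed
  ultimately show ?thesis using fr by (auto simp: regular_boundary_def)
qed

lemma in_closure_iff: "y \<in> closure A \<longleftrightarrow> (\<exists>\<^sub>F x in nhds y. x \<in> A)"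
  unfolding frequently_def eventually_nhds closure_iff_nhds_not_empty by blast

lemma closure_cong_nhds:
  assumes "\<forall>\<^sub>F x in nhds y. x \<in> A \<longleftrightarrow> x \<in> B"
  shows "y \<in> closure A \<longleftrightarrow> y \<in> closure B"
proof -
  have "(\<forall>\<^sub>F x in nhds y. x \<notin> A) \<longleftrightarrow> (\<forall>\<^sub>F x in nhds y. x \<notin> B)"
    using assms by (intro eventually_cong) (auto elim: eventually_mono)
  then show ?thesis by (simp add: in_closure_iff frequently_def)
qed

lemma frontier_cong_nhds:
  assumes "\<forall>\<^sub>F x in nhds y. x \<in> A \<longleftrightarrow> x \<in> B"
  shows "y \<in> frontier A \<longleftrightarrow> y \<in> frontier B"
  using closure_cong_nhds[of A B y] closure_cong_nhds[of "- A" "- B" y] assms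
  by (auto simp: frontier_closures)

text \<open>The direction carries the side: the opposite half-space is \<open>half_at (- c)\<close>,
  and one argument serves both sides.\<close>

definition half_at :: "'a::euclidean_space \<Rightarrow> 'a \<Rightarrow> 'a set \<Rightarrow> bool" where
  "half_at c y D \<longleftrightarrow> (\<forall>\<^sub>F x in nhds y. x \<in> D \<longleftrightarrow> c \<bullet> (x - y) > 0)"

lemma half_local_cases:
  assumes "half_local c y D"
  obtains "\<forall>\<^sub>F x in nhds y. x \<notin> D" | "\<forall>\<^sub>F x in nhds y. x \<in> D" | "half_at c y D" | "half_at (- c) y D"
  using assms unfolding half_local_def half_at_def by auto

lemma half_local_frontier:
  assumes "half_local c y D" "y \<in> frontier D"
  shows "half_at c y D \<or> half_at (- c) y D"
  using assms(1)
proof (cases rule: half_local_cases)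
  case 1
  then show ?thesis using assms(2) by (auto simp: frontier_closures in_closure_iff frequently_def)
next
  case 2
  then show ?thesis using assms(2) by (auto simp: frontier_closures in_closure_iff frequently_def)
qed auto

lemma half_at_ex:
  assumes "half_at d y A" "d \<noteq> 0" "\<forall>\<^sub>F x in nhds y. Q x"
  shows "\<exists>x\<in>A. d \<bullet> (x - y) > 0 \<and> Q x"
proof -
  have "\<forall>\<^sub>F x in nhds y. (x \<in> A \<longleftrightarrow> d \<bullet> (x - y) > 0) \<and> Q x"
    using assms(1,3) unfolding half_at_def by (rule eventually_conj)
  then obtain U where U: "open U" "y \<in> U" "\<And>x. x \<in> U \<Longrightarrow> (x \<in> A \<longleftrightarrow> d \<bullet> (x - y) > 0) \<and> Q x"
    unfolding eventually_nhds by blast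
  obtain t where t: "t > 0" "y + t *\<^sub>R d \<in> U" using shift_along_normal[OF U(1,2) assms(2)] by blast
  have "d \<bullet> (y + t *\<^sub>R d - y) > 0" using t(1) assms(2) by simp
  then show ?thesis using U(3)[OF t(2)] by blast
qed

lemma half_at_meet: "half_at d y A \<Longrightarrow> half_at d y B \<Longrightarrow> d \<noteq> 0 \<Longrightarrow> A \<inter> B \<noteq> {}"
  using half_at_ex[of d y A "\<lambda>x. x \<in> B \<longleftrightarrow> d \<bullet> (x - y) > 0"] by (auto simp: half_at_def)

lemma half_at_not_subset: "half_at d y A \<Longrightarrow> half_at (- d) y B \<Longrightarrow> d \<noteq> 0 \<Longrightarrow> \<not> A \<subseteq> B"
  using half_at_ex[of d y A "\<lambda>x. x \<in> B \<longleftrightarrow> - d \<bullet> (x - y) > 0"] by (auto simp: half_at_def)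

lemma half_at_opposite_Int:
  assumes "half_at d y A" "half_at (- d) y B"
  shows "y \<notin> closure (A \<inter> B)"
proof -
  have "\<forall>\<^sub>F x in nhds y. x \<notin> A \<inter> B"
    using assms unfolding half_at_def by eventually_elim auto
  then show ?thesis by (simp add: in_closure_iff frequently_def)
qed

lemma half_at_Int:
  assumes "half_at d y A" "half_at d y B"
  shows "half_at d y (A \<inter> B)"
  using assms unfolding half_at_def by eventually_elim auto

text \<open>Regular openness comes from D being the interior of a closed set; the frontier is
  negligible since it lies in the frontiers of finitely many convex sets.\<close>

lemma open_polyhedral_facts:
  assumes "open_polyhedral D"
  shows "open D" "bounded D" "interior (closure D) = D" "negligible (frontier D)"
proof -
  obtain F where F: "finite F" "\<And>K. K \<in> F \<Longrightarrow> polytope K" "D = interior (\<Union>F)"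
    using open_polyhedralE[OF assms] by blast
  have cpt: "compact (\<Union>F)" using F by (intro compact_Union_polytopes) auto
  show op: "open D" by (simp add: F(3))
  have DF: "D \<subseteq> \<Union>F" unfolding F(3) by (rule interior_subset)
  then show "bounded D" using cpt bounded_subset compact_imp_bounded by blast
  have cl: "closure D \<subseteq> \<Union>F" using DF cpt by (intro closure_minimal compact_imp_closed)
  show "interior (closure D) = D"
  proof
    show "interior (closure D) \<subseteq> D" using interior_mono[OF cl] F(3) by simp
    show "D \<subseteq> interior (closure D)" using op by (simp add: interior_maximal closure_subset)
  qed
  have "frontier D \<subseteq> (\<Union>K\<in>F. frontier K)"
  proof
    fix y assume y: "y \<in> frontier D"
    then obtain K where K: "K \<in> F" "y \<in> K" using cl by (auto simp: frontier_def)
    have "y \<notin> interior K"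
      using y K(1) op interior_mono[of K "\<Union>F"] by (auto simp: frontier_def F(3))
    then show "y \<in> (\<Union>K\<in>F. frontier K)" using K closure_subset by (auto simp: frontier_def)
  qed
  moreover have "negligible (\<Union>K\<in>F. frontier K)"
    using F(1,2) by (intro negligible_Union) (auto intro!: negligible_convex_frontier polytope_imp_convex)
  ultimately show "negligible (frontier D)" using negligible_subset by blast
qed

text \<open>X and the union of the elements in J agree almost everywhere: closures add only null
  sets, and elements outside J meet X in null sets.\<close>

lemma measure_partition_sum:
  assumes "finite A" "disjoint_family_on p A" "J \<subseteq> A"
    and p: "\<And>\<alpha>. \<alpha> \<in> A \<Longrightarrow> p \<alpha> \<in> sets borel \<and> emeasure surface_measure (p \<alpha>) < \<infinity>
      \<and> closure (p \<alpha>) - p \<alpha> \<in> null_sets surface_measure"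
    and X: "X \<in> sets borel" "X \<subseteq> (\<Union>\<alpha>\<in>A. closure (p \<alpha>))"
    and inside: "\<And>\<alpha>. \<alpha> \<in> J \<Longrightarrow> AE y in surface_measure. y \<in> p \<alpha> \<longrightarrow> y \<in> X"
    and outside: "\<And>\<alpha>. \<alpha> \<in> A - J \<Longrightarrow> lambda2 (p \<alpha> \<inter> X) = 0"
  shows "(\<Sum>\<alpha>\<in>J. lambda2 (p \<alpha>)) = lambda2 X"
proof -
  have finJ: "finite J" using assms(1,3) finite_subset by blast
  have pJ: "p \<alpha> \<in> sets surface_measure" "emeasure surface_measure (p \<alpha>) \<noteq> \<infinity>" if "\<alpha> \<in> J" for \<alpha>
    using p[of \<alpha>] that assms(3) by auto
  have out: "AE y in surface_measure. y \<notin> p \<alpha> \<inter> X" if a: "\<alpha> \<in> A - J" for \<alpha>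
  proof -
    \<comment> \<open>The real-valued measure is 0 also for sets of infinite measure; finiteness of
      the element excludes this.\<close>
    have "emeasure surface_measure (p \<alpha> \<inter> X) \<le> emeasure surface_measure (p \<alpha>)"
      using p[of \<alpha>] a X(1) by (intro emeasure_mono) auto
    then have "emeasure surface_measure (p \<alpha> \<inter> X) < \<infinity>" using p[of \<alpha>] a by (auto intro: le_less_trans)
    then have "p \<alpha> \<inter> X \<in> null_sets surface_measure"
      using outside[OF a] p[of \<alpha>] a X(1) by (intro null_setsI) (auto simp: emeasure_eq_ennreal_measure)
    then show ?thesis by (rule AE_not_in)
  qed
  have "AE y in surface_measure. \<forall>\<alpha>\<in>A. y \<notin> closure (p \<alpha>) - p \<alpha>"
    using p assms(1) by (intro AE_finite_allI AE_not_in) auto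
  moreover have "AE y in surface_measure. \<forall>\<alpha>\<in>J. y \<in> p \<alpha> \<longrightarrow> y \<in> X"
    using inside finJ by (intro AE_finite_allI) auto
  moreover have "AE y in surface_measure. \<forall>\<alpha>\<in>A-J. y \<notin> p \<alpha> \<inter> X"
    using out assms(1) by (intro AE_finite_allI) auto
  ultimately have "AE y in surface_measure. y \<in> X \<longleftrightarrow> y \<in> (\<Union>\<alpha>\<in>J. p \<alpha>)"
  proof eventually_elim
    case (elim y)
    show ?case
    proof
      assume y: "y \<in> X"
      then obtain \<alpha> where \<alpha>: "\<alpha> \<in> A" "y \<in> closure (p \<alpha>)" using X(2) by blast
      then have "y \<in> p \<alpha>" using elim(1) by blast
      moreover from this have "\<alpha> \<in> J" using elim(3) \<alpha>(1) y by blast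
      ultimately show "y \<in> (\<Union>\<alpha>\<in>J. p \<alpha>)" by blast
    qed (use elim(2) in blast)
  qed
  then have "lambda2 X = lambda2 (\<Union>\<alpha>\<in>J. p \<alpha>)"
    using X(1) pJ finJ by (intro measure_eq_AE) (auto intro!: sets.finite_UN)
  also have "\<dots> = (\<Sum>\<alpha>\<in>J. lambda2 (p \<alpha>))"
    using finJ pJ disjoint_family_on_mono[OF assms(3,2)]
    by (intro measure_finite_Union) auto
  finally show ?thesis ..
qed

section \<open>Areas and volumes of the cells\<close>

context fv_setting
begin

lemma polyhedral_sets:
  "open (domain P)" "bounded (domain P)" "open (subdomain P m)"
  "i \<in> cells P \<Longrightarrow> open (cell P i)" "i \<in> cells P \<Longrightarrow> bounded (cell P i)"
  using open_polyhedral_facts(1,2)[OF domain_polyhedral(2)] open_polyhedral_facts(1)[OF subdomain_polyhedral(2)]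
    open_polyhedral_facts(1,2)[of "cell P i"] cell_polyhedral[of i] by simp_all

lemma finite_cells: "finite (cells P)"
  and cell_subset: "i \<in> cells P \<Longrightarrow> cell P i \<subseteq> domain P"
  and cells_disjoint: "i \<in> cells P \<Longrightarrow> k \<in> cells P \<Longrightarrow> i \<noteq> k \<Longrightarrow> cell P i \<inter> cell P k = {}"
  using cells_partition by (auto simp: partition_of_def disjoint_family_on_def)

lemma cells_nonempty: "cells P \<noteq> {}"
  using cells_partition domain_polyhedral(1) by (auto simp: partition_of_def)

lemma finite_elems: "finite (elems_domain P)" "finite (elems_interface P)"
  using elems_domain_partition elems_interface_partition by (auto simp: partition_of_def)

lemma Gamma_domain_subset: "Gamma_domain P \<subseteq> frontier (domain P)"
proof -
  have "open_cavity P \<subseteq> - domain P" using closure_subset by (auto simp: open_cavity_def)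
  then have "closure (open_cavity P) \<subseteq> - domain P"
    using polyhedral_sets(1) by (intro closure_minimal) auto
  then show ?thesis using interior_open[OF polyhedral_sets(1)] by (auto simp: Gamma_domain_def frontier_def)
qed

lemma closed_Gamma_domain: "closed (Gamma_domain P)"
  by (simp add: Gamma_domain_def closed_Int)

lemma interface_subset: "interface P \<subseteq> frontier (subdomain P Solid)"
  using frontier_solid(1) by (auto simp: interface_def)

text \<open>The outer boundary avoids the boundary of the gas region, so near y only solid is
  present. There the domain is an open subset of the closure of the solid region, and regular
  openness removes the closure.\<close>

lemma domain_solid_near_frontier:
  assumes "y \<in> frontier (domain P)"
  shows "\<forall>\<^sub>F x in nhds y. x \<in> domain P \<longleftrightarrow> x \<in> subdomain P Solid"
proof -
  have reg: "interior (closure (domain P)) = domain P"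
    "interior (closure (subdomain P Solid)) = subdomain P Solid"
    using open_polyhedral_facts(3) domain_polyhedral(2) subdomain_polyhedral(2) by blast+
  have "subdomain P m \<subseteq> closure (domain P)" for m
    unfolding subdomain_cover by (cases m) (use closure_subset in auto)
  then have sub: "subdomain P m \<subseteq> domain P" for m
    using interior_maximal[OF _ polyhedral_sets(3)] reg(1) by blast
  have "y \<notin> domain P" using assms interior_open[OF polyhedral_sets(1)] by (auto simp: frontier_def)
  then have "y \<notin> subdomain P Gas" using sub by blast
  moreover have "y \<notin> frontier (subdomain P Gas)" using assms frontier_solid(2) by blast
  ultimately have y: "y \<in> - closure (subdomain P Gas)"
    using interior_open[OF polyhedral_sets(3)[of Gas]] by (auto simp: frontier_def)
  have "x \<in> subdomain P Solid" if x: "x \<in> - closure (subdomain P Gas)" "x \<in> domain P" for x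
  proof -
    have "domain P \<inter> - closure (subdomain P Gas) \<subseteq> closure (subdomain P Solid)"
      using subdomain_cover closure_subset[of "domain P"] by blast
    moreover have "open (domain P \<inter> - closure (subdomain P Gas))"
      using polyhedral_sets(1) by (intro open_Int) auto
    ultimately have "domain P \<inter> - closure (subdomain P Gas) \<subseteq> interior (closure (subdomain P Solid))"
      by (rule interior_maximal)
    then show ?thesis using x reg(2) by blast
  qed
  moreover have "\<forall>\<^sub>F x in nhds y. x \<in> - closure (subdomain P Gas)"
    using y by (intro eventually_nhds_in_open) auto
  ultimately show ?thesis using sub by (auto elim!: eventually_mono)
qed

lemma frontier_subcell_outer:
  assumes "i \<in> cells P" "y \<in> frontier (domain P)"
  shows "y \<in> frontier (subcell P Solid i) \<longleftrightarrow> y \<in> frontier (cell P i)"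
proof (rule frontier_cong_nhds)
  show "\<forall>\<^sub>F x in nhds y. x \<in> subcell P Solid i \<longleftrightarrow> x \<in> cell P i"
    using domain_solid_near_frontier[OF assms(2)]
    by eventually_elim (use cell_subset[OF assms(1)] in \<open>auto simp: subcell_def\<close>)
qed

lemma frontier_subcell_Gamma:
  assumes "i \<in> cells P"
  shows "frontier (subcell P Solid i) \<inter> Gamma_domain P = frontier (cell P i) \<inter> Gamma_domain P"
  using frontier_subcell_outer[OF assms] Gamma_domain_subset by blast

lemma frontier_subcell_interface:
  assumes "i \<in> cells P"
  shows "cell P i \<inter> interface P \<subseteq> frontier (subcell P Solid i)"
proof
  fix y assume y: "y \<in> cell P i \<inter> interface P"
  have "\<forall>\<^sub>F x in nhds y. x \<in> cell P i"
    using y polyhedral_sets(4)[OF assms] by (intro eventually_nhds_in_open) auto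
  then have "\<forall>\<^sub>F x in nhds y. x \<in> subcell P Solid i \<longleftrightarrow> x \<in> subdomain P Solid"
    by eventually_elim (auto simp: subcell_def)
  then show "y \<in> frontier (subcell P Solid i)"
    using frontier_cong_nhds y interface_subset by blast
qed

text \<open>Positive area puts an element into the index set of its own cell; finite area keeps the
  real-valued measure meaningful.\<close>

lemma elem_facts:
  assumes "\<alpha> \<in> elems_domain P \<union> elems_interface P"
  shows "elem P \<alpha> \<in> sets borel \<and> emeasure surface_measure (elem P \<alpha>) < \<infinity>
      \<and> closure (elem P \<alpha>) - elem P \<alpha> \<in> null_sets surface_measure"
    and "0 < lambda2 (elem P \<alpha>)"
proof -
  obtain H where H: "plane H" "open_polyhedral_in H (elem P \<alpha>)" "elem P \<alpha> \<noteq> {}"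
    using elem_polygon[OF assms] by blast
  note pc = polygon_closure_null[OF H(1,2)]
  obtain h where h: "H = hyperplane h" using plane_hyperplane[OF H(1)] by blast
  have "closed H" unfolding h hyperplane_def by (rule closed_hyperplane)
  moreover obtain V where "open V" "elem P \<alpha> = H \<inter> V" using pc(4) openin_open by blast
  ultimately have b: "elem P \<alpha> \<in> sets borel" by auto
  have "hausdorff2 (elem P \<alpha>) < \<infinity>" using hausdorff2_bounded_in_plane[OF H(1) pc(2,3)] .
  then have fin: "emeasure surface_measure (elem P \<alpha>) < \<infinity>" by (simp add: emeasure_surface_measure b)
  then show "elem P \<alpha> \<in> sets borel \<and> emeasure surface_measure (elem P \<alpha>) < \<infinity>
      \<and> closure (elem P \<alpha>) - elem P \<alpha> \<in> null_sets surface_measure"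
    using b pc(1) by blast
  have "0 < hausdorff2 (elem P \<alpha>)" using hausdorff2_openin_plane[OF H(1) pc(4) H(3)] .
  then show "0 < lambda2 (elem P \<alpha>)"
    using fin by (simp add: measure_def enn2real_positive_iff emeasure_surface_measure b)
qed

section \<open>Generic points and the elements of a cell\<close>

definition generic :: "space \<Rightarrow> space \<Rightarrow> bool" where
  "generic c y \<longleftrightarrow> c \<noteq> 0 \<and> half_local c y (domain P) \<and> (\<forall>m. half_local c y (subdomain P m))
     \<and> (\<forall>i\<in>cells P. half_local c y (cell P i))"

lemma generic_outside_null:
  obtains N where "N \<in> null_sets surface_measure" "\<And>y. y \<notin> N \<Longrightarrow> \<exists>c. generic c y"
proof -
  let ?D = "insert (domain P) (range (subdomain P) \<union> cell P ` cells P)"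
  have "range (subdomain P) \<subseteq> {subdomain P Solid, subdomain P Gas}"
  proof (rule image_subsetI)
    show "subdomain P m \<in> {subdomain P Solid, subdomain P Gas}" for m by (cases m) simp_all
  qed
  then have "finite (range (subdomain P))" by (rule finite_subset) simp
  then have fin: "finite ?D" using finite_cells by simp
  have poly: "\<And>D. D \<in> ?D \<Longrightarrow> open_polyhedral D"
    using domain_polyhedral subdomain_polyhedral cell_polyhedral by blast
  obtain N where N: "N \<in> null_sets surface_measure"
    "\<And>y. y \<notin> N \<Longrightarrow> \<exists>c. c \<noteq> 0 \<and> (\<forall>D\<in>?D. half_local c y D)"
    using open_polyhedral_generic[OF fin poly] by blast
  show thesis
  proof (rule that[OF N(1)])
    fix y assume "y \<notin> N"
    then obtain c where "c \<noteq> 0" "\<forall>D\<in>?D. half_local c y D" using N(2) by blast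
    then show "\<exists>c. generic c y" unfolding generic_def by (intro exI[of _ c]) auto
  qed
qed

lemma point_outside_null:
  assumes "lambda2 A \<noteq> 0" "N \<in> null_sets surface_measure"
  shows "\<exists>y\<in>A. y \<notin> N"
proof (rule ccontr)
  assume "\<not> ?thesis"
  then have "A \<subseteq> N" by blast
  \<comment> \<open>\<open>measure\<close> is 0 outside the sigma algebra, so a nonzero value yields
    measurability.\<close>
  moreover have "A \<in> sets surface_measure" using assms(1) measure_notin_sets by blast
  ultimately have "A \<in> null_sets surface_measure" using assms(2) null_sets_subset by blast
  then show False using assms(1) by (simp add: measure_eq_0_null_sets)
qed

text \<open>At a generic point of the outer boundary the domain is a half-space. Every cell with
  this point on its frontier is contained in the domain and must be the same half-space near it, so
  two such cells would overlap.\<close>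

lemma J_domain_eq:
  assumes i: "i \<in> cells P"
  shows "J_domain P i = {\<alpha> \<in> elems_domain P. cell_of P \<alpha> = i}"
proof (intro equalityI subsetI)
  fix \<alpha> assume "\<alpha> \<in> J_domain P i"
  then have \<alpha>: "\<alpha> \<in> elems_domain P" "lambda2 (elem P \<alpha> \<inter> frontier (cell P i)) \<noteq> 0"
    by (auto simp: J_domain_def)
  let ?k = "cell_of P \<alpha>"
  have k: "?k \<in> cells P" using cell_of_in \<alpha>(1) by blast
  have sub: "elem P \<alpha> \<subseteq> frontier (cell P ?k) \<inter> Gamma_domain P" using cell_of_domain[OF \<alpha>(1) k] by blast
  have "?k = i"
  proof (rule ccontr)
    assume ne: "?k \<noteq> i"
    obtain N where N: "N \<in> null_sets surface_measure" "\<And>y. y \<notin> N \<Longrightarrow> \<exists>c. generic c y"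
      using generic_outside_null by blast
    obtain y where y: "y \<in> elem P \<alpha>" "y \<in> frontier (cell P i)" "y \<notin> N"
      using point_outside_null[OF \<alpha>(2) N(1)] by blast
    obtain c where c: "c \<noteq> 0" "half_local c y (domain P)" "\<forall>i\<in>cells P. half_local c y (cell P i)"
      using N(2)[OF y(3)] unfolding generic_def by blast
    have "half_at c y (domain P) \<or> half_at (- c) y (domain P)"
      using half_local_frontier[OF c(2)] y(1) sub Gamma_domain_subset by blast
    then obtain d where d: "d = c \<or> d = - c" "half_at d y (domain P)" by blast
    have same: "half_at d y (cell P j)" if j: "j \<in> cells P" "y \<in> frontier (cell P j)" for j
    proof -
      have "half_at d y (cell P j) \<or> half_at (- d) y (cell P j)"
        using half_local_frontier[of c y "cell P j"] c(3) j d(1) by auto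
      then show ?thesis
        using half_at_not_subset[of "- d" y "cell P j" "domain P"] d c(1) cell_subset[OF j(1)] by auto
    qed
    have "half_at d y (cell P ?k)" using y(1) sub by (intro same[OF k]) blast
    then have "cell P i \<inter> cell P ?k \<noteq> {}"
      using same[OF i y(2)] d(1) c(1) by (intro half_at_meet[of d y]) auto
    then show False using cells_disjoint[OF i k] ne by auto
  qed
  then show "\<alpha> \<in> {\<alpha> \<in> elems_domain P. cell_of P \<alpha> = i}" using \<alpha>(1) by simp
next
  fix \<alpha> assume "\<alpha> \<in> {\<alpha> \<in> elems_domain P. cell_of P \<alpha> = i}"
  then have \<alpha>: "\<alpha> \<in> elems_domain P" "cell_of P \<alpha> = i" by auto
  then have "elem P \<alpha> \<inter> frontier (cell P i) = elem P \<alpha>" using cell_of_domain[OF \<alpha>(1) i] by blast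
  then show "\<alpha> \<in> J_domain P i" using \<alpha>(1) elem_facts(2)[of \<alpha>] by (auto simp: J_domain_def)
qed

lemma J_domain_area:
  assumes i: "i \<in> cells P"
  shows "(\<Sum>\<alpha>\<in>J_domain P i. lambda2 (elem P \<alpha>))
    = lambda2 (frontier (subcell P Solid i) \<inter> Gamma_domain P)"
proof (rule measure_partition_sum)
  show "finite (elems_domain P)" "disjoint_family_on (elem P) (elems_domain P)"
    using elems_domain_partition by (auto simp: partition_of_def)
  show "frontier (subcell P Solid i) \<inter> Gamma_domain P \<subseteq> (\<Union>\<alpha>\<in>elems_domain P. closure (elem P \<alpha>))"
    using elems_domain_partition by (auto simp: partition_of_def)
  show "frontier (subcell P Solid i) \<inter> Gamma_domain P \<in> sets borel"
    using closed_Gamma_domain by (intro borel_closed closed_Int) auto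
  show "J_domain P i \<subseteq> elems_domain P" by (auto simp: J_domain_def)
  fix \<alpha>
  show "AE y in surface_measure. y \<in> elem P \<alpha> \<longrightarrow> y \<in> frontier (subcell P Solid i) \<inter> Gamma_domain P"
    if "\<alpha> \<in> J_domain P i"
    using that cell_of_domain[of \<alpha> i] i unfolding J_domain_eq[OF i] frontier_subcell_Gamma[OF i]
    by (intro AE_I2) blast
  show "lambda2 (elem P \<alpha> \<inter> (frontier (subcell P Solid i) \<inter> Gamma_domain P)) = 0"
    if a: "\<alpha> \<in> elems_domain P - J_domain P i"
  proof -
    have "elem P \<alpha> \<subseteq> Gamma_domain P" using elems_domain_partition a by (auto simp: partition_of_def)
    then have "elem P \<alpha> \<inter> (frontier (cell P i) \<inter> Gamma_domain P) = elem P \<alpha> \<inter> frontier (cell P i)" by blast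
    then show ?thesis using a by (simp add: frontier_subcell_Gamma[OF i] J_domain_def)
  qed
qed (use elem_facts in blast)

lemma generic_interface_point:
  assumes "c \<noteq> 0" "\<forall>m. half_local c y (subdomain P m)" "y \<in> interface P"
  obtains d where "d = c \<or> d = - c" "half_at d y (subdomain P Solid)" "half_at (- d) y (subdomain P Gas)"
proof -
  have "half_at c y (subdomain P Solid) \<or> half_at (- c) y (subdomain P Solid)"
    using half_local_frontier assms interface_subset by blast
  then obtain d where d: "d = c \<or> d = - c" "half_at d y (subdomain P Solid)" by blast
  have "half_at c y (subdomain P Gas) \<or> half_at (- c) y (subdomain P Gas)"
    using half_local_frontier assms by (auto simp: interface_def)
  then have "half_at d y (subdomain P Gas) \<or> half_at (- d) y (subdomain P Gas)" using d(1) by auto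
  moreover have "\<not> half_at d y (subdomain P Gas)"
    using half_at_meet[OF d(2)] subdomain_disjoint d(1) assms(1) by auto
  ultimately show thesis using that d by blast
qed

text \<open>On the interface a cell may extend to both sides, so the germ of the domain does not
  help. Instead, if the solid parts of two cells both reach y, neither cell is full at y; each is
  then the half-space on the solid side, and the two overlap.\<close>

lemma J_interface_eq:
  assumes i: "i \<in> cells P"
  shows "J_interface P i = {\<alpha> \<in> elems_interface P. cell_of P \<alpha> = i}"
proof (intro equalityI subsetI)
  fix \<alpha> assume "\<alpha> \<in> J_interface P i"
  then have \<alpha>: "\<alpha> \<in> elems_interface P" "lambda2 (elem P \<alpha> \<inter> frontier (subcell P Solid i)) \<noteq> 0"
    by (auto simp: J_interface_def)
  let ?k = "cell_of P \<alpha>"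
  have k: "?k \<in> cells P" using cell_of_in \<alpha>(1) by blast
  have sub: "elem P \<alpha> \<subseteq> frontier (subcell P Solid ?k) \<inter> interface P"
    using cell_of_interface[OF \<alpha>(1) k] by blast
  have "?k = i"
  proof (rule ccontr)
    assume ne: "?k \<noteq> i"
    obtain N where N: "N \<in> null_sets surface_measure" "\<And>y. y \<notin> N \<Longrightarrow> \<exists>c. generic c y"
      using generic_outside_null by blast
    obtain y where y: "y \<in> elem P \<alpha>" "y \<in> frontier (subcell P Solid i)" "y \<notin> N"
      using point_outside_null[OF \<alpha>(2) N(1)] by blast
    obtain c where c: "c \<noteq> 0" "\<forall>m. half_local c y (subdomain P m)"
      "\<forall>i\<in>cells P. half_local c y (cell P i)"
      using N(2)[OF y(3)] unfolding generic_def by blast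
    obtain d where d: "d = c \<or> d = - c" "half_at d y (subdomain P Solid)"
      using generic_interface_point[OF c(1,2)] y(1) sub by blast
    have same: "half_at d y (cell P j)"
      if j: "j \<in> cells P" "y \<in> closure (subcell P Solid j)" "l \<in> cells P" "l \<noteq> j"
        "y \<in> closure (subcell P Solid l)" for j l
    proof -
      have cl: "y \<in> closure (cell P j)" "y \<in> closure (cell P l)"
        using j(2,5) closure_mono[of "subcell P Solid _" "cell P _"] by (auto simp: subcell_def)
      have "\<not> (\<forall>\<^sub>F x in nhds y. x \<in> cell P j)"
      proof
        assume "\<forall>\<^sub>F x in nhds y. x \<in> cell P j"
        then have "\<forall>\<^sub>F x in nhds y. x \<notin> cell P l"
          by eventually_elim (use cells_disjoint[OF j(1,3)] j(4) in blast)
        then show False using cl(2) by (simp add: in_closure_iff frequently_def)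
      qed
      moreover have "\<not> (\<forall>\<^sub>F x in nhds y. x \<notin> cell P j)"
        using cl(1) by (simp add: in_closure_iff frequently_def)
      ultimately have "half_at c y (cell P j) \<or> half_at (- c) y (cell P j)"
        using c(3) j(1) half_local_cases by blast
      \<comment> \<open>With the opposite half-space as germ, the cell would not meet the solid
        region near y.\<close>
      moreover have "\<not> half_at (- d) y (cell P j)"
        using half_at_opposite_Int[of d y "subdomain P Solid" "cell P j"] d(2) j(2)
        by (auto simp: subcell_def Int_commute)
      ultimately show ?thesis using d(1) by auto
    qed
    have cl: "y \<in> closure (subcell P Solid i)" "y \<in> closure (subcell P Solid ?k)"
      using y(1,2) sub by (auto simp: frontier_def)
    have "half_at d y (cell P ?k)" using ne by (intro same[OF k cl(2) i _ cl(1)]) simp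
    then have "cell P i \<inter> cell P ?k \<noteq> {}"
      using same[OF i cl(1) k ne cl(2)] d(1) c(1) by (intro half_at_meet[of d y]) auto
    then show False using cells_disjoint[OF i k] ne by auto
  qed
  then show "\<alpha> \<in> {\<alpha> \<in> elems_interface P. cell_of P \<alpha> = i}" using \<alpha>(1) by simp
next
  fix \<alpha> assume "\<alpha> \<in> {\<alpha> \<in> elems_interface P. cell_of P \<alpha> = i}"
  then have \<alpha>: "\<alpha> \<in> elems_interface P" "cell_of P \<alpha> = i" by auto
  then have "elem P \<alpha> \<inter> frontier (subcell P Solid i) = elem P \<alpha>" using cell_of_interface[OF \<alpha>(1) i] by blast
  then show "\<alpha> \<in> J_interface P i" using \<alpha>(1) elem_facts(2)[of \<alpha>] by (auto simp: J_interface_def)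
qed

text \<open>If a generic interface point of the boundary of the solid part of a cell were not interior to
  the cell, the gas part would be missing there, contradicting the matching of the regular boundaries.\<close>

lemma J_interface_area:
  assumes i: "i \<in> cells P"
  shows "(\<Sum>\<alpha>\<in>J_interface P i. lambda2 (elem P \<alpha>)) = lambda2 (cell P i \<inter> interface P)"
proof (rule measure_partition_sum)
  show "finite (elems_interface P)" "disjoint_family_on (elem P) (elems_interface P)"
    using elems_interface_partition by (auto simp: partition_of_def)
  show "cell P i \<inter> interface P \<subseteq> (\<Union>\<alpha>\<in>elems_interface P. closure (elem P \<alpha>))"
    using elems_interface_partition by (auto simp: partition_of_def)
  show "cell P i \<inter> interface P \<in> sets borel"
    using polyhedral_sets(4)[OF i] by (auto simp: interface_def)
  show "J_interface P i \<subseteq> elems_interface P" by (auto simp: J_interface_def)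
  fix \<alpha>
  show "AE y in surface_measure. y \<in> elem P \<alpha> \<longrightarrow> y \<in> cell P i \<inter> interface P"
    if a: "\<alpha> \<in> J_interface P i"
  proof -
    have \<alpha>: "\<alpha> \<in> elems_interface P" "cell_of P \<alpha> = i" using a unfolding J_interface_eq[OF i] by auto
    have sub: "elem P \<alpha> \<subseteq> frontier (subcell P Solid i) \<inter> interface P"
      using cell_of_interface[OF \<alpha>(1) i] \<alpha>(2) by blast
    obtain N where N: "N \<in> null_sets surface_measure" "\<And>y. y \<notin> N \<Longrightarrow> \<exists>c. generic c y"
      using generic_outside_null by blast
    have "y \<in> cell P i \<inter> interface P" if y: "y \<in> elem P \<alpha>" "y \<notin> N" for y
    proof (rule ccontr)
      assume "\<not> ?thesis"
      then have yc: "y \<notin> cell P i" using y(1) sub by blast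
      have yi: "y \<in> interface P" and ycl: "y \<in> closure (subcell P Solid i)"
        using y(1) sub by (auto simp: frontier_def)
      obtain c where c: "c \<noteq> 0" "\<forall>m. half_local c y (subdomain P m)"
        "\<forall>i\<in>cells P. half_local c y (cell P i)"
        using N(2)[OF y(2)] unfolding generic_def by blast
      obtain d where d: "d = c \<or> d = - c" "half_at d y (subdomain P Solid)" "half_at (- d) y (subdomain P Gas)"
        using generic_interface_point[OF c(1,2) yi] by blast
      have "y \<in> closure (cell P i)"
        using ycl closure_mono[of "subcell P Solid i" "cell P i"] by (auto simp: subcell_def)
      then have "\<not> (\<forall>\<^sub>F x in nhds y. x \<notin> cell P i)" by (simp add: in_closure_iff frequently_def)
      moreover have "\<not> (\<forall>\<^sub>F x in nhds y. x \<in> cell P i)" using yc eventually_nhds_x_imp_x by blast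
      ultimately have "half_at c y (cell P i) \<or> half_at (- c) y (cell P i)"
        using c(3) i half_local_cases by blast
      moreover have "\<not> half_at (- d) y (cell P i)"
        using half_at_opposite_Int[of d y "subdomain P Solid" "cell P i"] d(2) ycl
        by (auto simp: subcell_def Int_commute)
      ultimately have hd: "half_at d y (cell P i)" using d(1) by auto
      then have "half_at d y (subcell P Solid i)" unfolding subcell_def using d(2) by (rule half_at_Int)
      then have "y \<in> regular_boundary (subcell P Solid i)"
        using regular_boundary_half[where c = d and y = y] d(1) c(1) unfolding half_at_def by auto
      then have "y \<in> regular_boundary (subcell P Gas i)" using cell_interface[OF i] yi by blast
      then have "y \<in> closure (subcell P Gas i)" by (auto simp: regular_boundary_def frontier_def)
      then show False using half_at_opposite_Int[OF hd d(3)] by (simp add: subcell_def)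
    qed
    then show ?thesis using AE_not_in[OF N(1)] by (auto elim!: eventually_mono)
  qed
  show "lambda2 (elem P \<alpha> \<inter> (cell P i \<inter> interface P)) = 0"
    if a: "\<alpha> \<in> elems_interface P - J_interface P i"
  proof -
    have e: "elem P \<alpha> \<in> sets borel" "emeasure surface_measure (elem P \<alpha>) < \<infinity>" using elem_facts a by auto
    have "emeasure surface_measure (elem P \<alpha> \<inter> frontier (subcell P Solid i)) \<le> emeasure surface_measure (elem P \<alpha>)"
      using e by (intro emeasure_mono) auto
    then have fin: "emeasure surface_measure (elem P \<alpha> \<inter> frontier (subcell P Solid i)) \<noteq> \<infinity>"
      using e(2) by auto
    have "lambda2 (elem P \<alpha> \<inter> (cell P i \<inter> interface P)) \<le> lambda2 (elem P \<alpha> \<inter> frontier (subcell P Solid i))"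
      using frontier_subcell_interface[OF i] e polyhedral_sets(4)[OF i] fin
      by (intro measure_mono_fmeasurable fmeasurableI) (auto simp: interface_def less_top)
    also have "\<dots> = 0" using a by (simp add: J_interface_def)
    finally show ?thesis using measure_nonneg[of surface_measure] by (meson antisym)
  qed
qed (use elem_facts in blast)

section \<open>Volumes of the cells\<close>

lemma cell_volume_pos:
  assumes "i \<in> cells P"
  shows "0 < lambda3 (cell P i)"
proof -
  have "emeasure lborel (cell P i) < \<infinity>" using polyhedral_sets(5)[OF assms] by (rule emeasure_bounded_finite)
  moreover have "emeasure lborel (cell P i) \<noteq> 0"
  proof
    assume "emeasure lborel (cell P i) = 0"
    then have "cell P i \<in> null_sets lborel" using polyhedral_sets(4)[OF assms] by (intro null_setsI) auto
    then have "negligible (cell P i)" by (simp add: negligible_iff_null_sets null_sets_completionI)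
    then show False using open_not_negligible polyhedral_sets(4)[OF assms] cell_polyhedral[OF assms] by blast
  qed
  ultimately show ?thesis by (simp add: measure_def enn2real_positive_iff zero_less_iff_neq_zero)
qed

text \<open>The cell lies in the union of the closures of the two phases, and the frontiers of the
  phases have volume zero.\<close>

lemma cell_volume_split:
  assumes i: "i \<in> cells P"
  shows "lambda3 (cell P i) = lambda3 (subcell P Solid i) + lambda3 (subcell P Gas i)"
proof -
  have borel: "subcell P m i \<in> sets borel" for m
    using polyhedral_sets(3)[of m] polyhedral_sets(4)[OF i] by (auto simp: subcell_def)
  have "bounded (subcell P m i)" for m
    using polyhedral_sets(5)[OF i] by (auto simp: subcell_def bounded_Int)
  then have fin: "emeasure lborel (subcell P m i) \<noteq> \<infinity>" for m using emeasure_bounded_finite by (metis less_irrefl infinity_ennreal_def)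
  have null: "frontier (subdomain P m) \<in> null_sets lborel" for m
  proof -
    have "frontier (subdomain P m) \<in> null_sets lebesgue"
      using open_polyhedral_facts(4)[OF subdomain_polyhedral(2)] by (simp add: negligible_iff_null_sets)
    then show ?thesis by (subst (asm) null_sets_completion_iff) auto
  qed
  have "cell P i \<subseteq> closure (subdomain P Solid) \<union> closure (subdomain P Gas)"
    using cell_subset[OF i] closure_subset[of "domain P"] subdomain_cover by blast
  then have cover: "x \<in> cell P i \<Longrightarrow> x \<notin> frontier (subdomain P Solid) \<Longrightarrow> x \<notin> frontier (subdomain P Gas)
      \<Longrightarrow> x \<in> subcell P Solid i \<union> subcell P Gas i" for x
    using interior_open[OF polyhedral_sets(3)] by (fastforce simp: frontier_def subcell_def)
  have "AE x in lborel. x \<notin> frontier (subdomain P Solid)" "AE x in lborel. x \<notin> frontier (subdomain P Gas)"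
    using null by (auto intro: AE_not_in)
  then have "AE x in lborel. x \<in> cell P i \<longleftrightarrow> x \<in> subcell P Solid i \<union> subcell P Gas i"
    by eventually_elim (use cover in \<open>auto simp: subcell_def\<close>)
  then have "lambda3 (cell P i) = lambda3 (subcell P Solid i \<union> subcell P Gas i)"
    using borel polyhedral_sets(4)[OF i] by (intro measure_eq_AE) auto
  also have "\<dots> = lambda3 (subcell P Solid i) + lambda3 (subcell P Gas i)"
    using fin borel subdomain_disjoint by (intro measure_Union) (auto simp: subcell_def)
  finally show ?thesis .
qed

end

section \<open>Contractions and one-sided systems\<close>

text \<open>Contraction in the maximum norm, phrased without the norm: every bound D on the coordinate
  differences shrinks by the factor q.\<close>

lemma contraction_fixed_point:
  fixes T :: "('i \<Rightarrow> real) \<Rightarrow> 'i \<Rightarrow> real"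
  assumes "finite A" and X: "\<And>i. i \<in> A \<Longrightarrow> closed (X i)" and "PiE A X \<noteq> {}"
    and T: "\<And>x. x \<in> PiE A X \<Longrightarrow> T x \<in> PiE A X" and q: "0 \<le> q" "q < 1"
    and contr: "\<And>x y D i. x \<in> PiE A X \<Longrightarrow> y \<in> PiE A X \<Longrightarrow> (\<And>j. j \<in> A \<Longrightarrow> \<bar>x j - y j\<bar> \<le> D)
      \<Longrightarrow> i \<in> A \<Longrightarrow> \<bar>T x i - T y i\<bar> \<le> q * D"
  shows "\<exists>x\<in>PiE A X. T x = x"
proof -
  obtain x0 where x0: "x0 \<in> PiE A X" using assms(3) by blast
  define x where "x k = (T ^^ k) x0" for k
  have xS: "x (Suc k) = T (x k)" for k by (simp add: x_def)
  have xX: "x k \<in> PiE A X" for k by (induction k) (auto simp: x_def x0 intro!: T)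
  \<comment> \<open>Any common bound of the first increments will do, because the hypothesis
    contracts every bound; the sum also works for an empty A.\<close>
  define D0 where "D0 = (\<Sum>j\<in>A. \<bar>x 1 j - x 0 j\<bar>)"
  have D0: "\<bar>x 1 j - x 0 j\<bar> \<le> D0" if "j \<in> A" for j
    unfolding D0_def using that assms(1) by (intro member_le_sum) auto
  have step: "\<bar>x (Suc k) j - x k j\<bar> \<le> q ^ k * D0" if "j \<in> A" for k j
    using that
  proof (induction k arbitrary: j)
    case (Suc k)
    have "\<bar>T (x (Suc k)) j - T (x k) j\<bar> \<le> q * (q ^ k * D0)"
      using Suc by (intro contr xX) auto
    then show ?case by (simp add: xS mult.assoc)
  qed (use D0 in auto)
  define l where "l = (\<lambda>i\<in>A. lim (\<lambda>k. x k i))"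
  have conv: "(\<lambda>k. x k i) \<longlonglongrightarrow> l i" if i: "i \<in> A" for i
  proof -
    have "summable (\<lambda>k. q ^ k * D0)" using q by (intro summable_mult2 summable_geometric) auto
    then have "summable (\<lambda>k. x (Suc k) i - x k i)"
      by (rule summable_comparison_test'[where N = 0]) (use step[OF i] in auto)
    then have "(\<lambda>n. \<Sum>k<n. x (Suc k) i - x k i) \<longlonglongrightarrow> (\<Sum>k. x (Suc k) i - x k i)" by (rule summable_LIMSEQ)
    moreover have "(\<Sum>k<n. x (Suc k) i - x k i) = x n i - x 0 i" for n
      by (rule sum_lessThan_telescope)
    ultimately have "(\<lambda>n. x n i - x 0 i) \<longlonglongrightarrow> (\<Sum>k. x (Suc k) i - x k i)" by simp
    then have "(\<lambda>n. (x n i - x 0 i) + x 0 i) \<longlonglongrightarrow> (\<Sum>k. x (Suc k) i - x k i) + x 0 i"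
      by (intro tendsto_add tendsto_const)
    then have "convergent (\<lambda>k. x k i)" by (auto simp: convergent_def)
    then show ?thesis using i by (simp add: l_def convergent_LIMSEQ_iff)
  qed
  have lX: "l \<in> PiE A X"
  proof (rule PiE_I)
    fix i assume i: "i \<in> A"
    show "l i \<in> X i"
      using closed_sequentially[OF X[OF i] _ conv[OF i]] xX i by (auto simp: PiE_iff)
  qed (simp add: l_def)
  have "T l i = l i" for i
  proof (cases "i \<in> A")
    case True
    \<comment> \<open>The sum of the coordinate distances to the limit bounds each of them and tends
      to 0, so it can serve as D in the contraction hypothesis.\<close>
    have "(\<lambda>k. \<Sum>j\<in>A. \<bar>x k j - l j\<bar>) \<longlonglongrightarrow> (\<Sum>j\<in>A. 0)"
      using conv by (intro tendsto_sum tendsto_rabs_zero) (simp add: LIM_zero)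
    then have "(\<lambda>k. q * (\<Sum>j\<in>A. \<bar>x k j - l j\<bar>)) \<longlonglongrightarrow> 0"
      using tendsto_mult_right_zero by auto
    moreover have "\<bar>x (Suc k) i - T l i\<bar> \<le> q * (\<Sum>j\<in>A. \<bar>x k j - l j\<bar>)" for k
      unfolding xS using assms(1) True by (intro contr xX lX member_le_sum) auto
    then have "\<forall>\<^sub>F k in sequentially. norm (x (Suc k) i - T l i) \<le> q * (\<Sum>j\<in>A. \<bar>x k j - l j\<bar>)"
      by (intro always_eventually allI) (simp only: real_norm_def)
    ultimately have "(\<lambda>k. x (Suc k) i - T l i) \<longlonglongrightarrow> 0"
      by (rule Lim_null_comparison[rotated])
    then have "(\<lambda>k. x (Suc k) i) \<longlonglongrightarrow> T l i" by (simp add: LIM_zero_iff)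
    then show ?thesis using LIMSEQ_unique LIMSEQ_Suc[OF conv[OF True]] by blast
  next
    case False
    \<comment> \<open>Outside A both functions take the value \<open>undefined\<close>.\<close>
    then show ?thesis using T[OF lX] lX by (simp add: PiE_arb[of _ A X])
  qed
  then show ?thesis using lX by (intro bexI[of _ l]) auto
qed

lemma finite_argmax:
  fixes f :: "'i \<Rightarrow> real"
  assumes "finite A" "A \<noteq> {}"
  obtains a where "a \<in> A" "\<And>b. b \<in> A \<Longrightarrow> f b \<le> f a"
proof -
  have "Max (f ` A) \<in> f ` A" using assms by (intro Max_in) auto
  then obtain a where a: "a \<in> A" "Max (f ` A) = f a" by blast
  have "f b \<le> f a" if "b \<in> A" for b using Max_ge[of "f ` A" "f b"] assms(1) that a(2) by simp
  then show thesis using that[OF a(1)] by blast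
qed

text \<open>The sign conditions on the faces give, for every w in the box, a root of equation i in
  its own coordinate. If two such roots differ by x > 0 and the data by at most D, the one-sided
  estimate gives \<open>a i * x \<le> b i * max D x\<close>; since b i < a i this forces
  \<open>x \<le> b i / a i * D\<close>. The operator of roots is thus a contraction, and its fixed
  points solve the system.\<close>

lemma one_sided_system_unique_solution:
  fixes H :: "'i \<Rightarrow> ('i \<Rightarrow> real) \<Rightarrow> real" and I :: "'i set" and lo hi :: real
  defines "B \<equiv> I \<rightarrow>\<^sub>E {lo..hi}"
  assumes I: "finite I" and le: "lo \<le> hi"
    and ab: "\<And>i. i \<in> I \<Longrightarrow> 0 \<le> b i \<and> b i < a i"
    and mono: "\<And>i u w D. i \<in> I \<Longrightarrow> u \<in> B \<Longrightarrow> w \<in> B \<Longrightarrow> (\<And>j. j \<in> I \<Longrightarrow> \<bar>u j - w j\<bar> \<le> D) \<Longrightarrow> w i \<le> u i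
      \<Longrightarrow> a i * (u i - w i) - b i * D \<le> H i u - H i w"
    and at_hi: "\<And>i w. i \<in> I \<Longrightarrow> w \<in> B \<Longrightarrow> w i = hi \<Longrightarrow> 0 \<le> H i w"
    and at_lo: "\<And>i w. i \<in> I \<Longrightarrow> w \<in> B \<Longrightarrow> w i = lo \<Longrightarrow> H i w \<le> 0"
    and cont: "\<And>i w. i \<in> I \<Longrightarrow> w \<in> B \<Longrightarrow> continuous_on {lo..hi} (\<lambda>x. H i (w(i := x)))"
  shows "\<exists>!w. w \<in> B \<and> (\<forall>i\<in>I. H i w = 0)"
proof -
  have upd: "w(i := x) \<in> B" if "w \<in> B" "i \<in> I" "x \<in> {lo..hi}" for w i x
    using that by (auto simp: B_def PiE_iff extensional_def)
  have "\<exists>x\<in>{lo..hi}. H i (w(i := x)) = 0" if "w \<in> B" "i \<in> I" for w i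
    using IVT'[of "\<lambda>x. H i (w(i := x))" lo 0 hi] at_lo[of i "w(i := lo)"] at_hi[of i "w(i := hi)"]
      upd[of w i] cont[of i w] that le by auto
  then obtain r where r: "\<And>w i. w \<in> B \<Longrightarrow> i \<in> I \<Longrightarrow> r w i \<in> {lo..hi} \<and> H i (w(i := r w i)) = 0" by metis
  define T where "T w = (\<lambda>i\<in>I. r w i)" for w
  have TB: "T w \<in> B" if "w \<in> B" for w using r that unfolding T_def B_def by auto
  \<comment> \<open>The 0 covers an empty index set and makes q nonnegative.\<close>
  define q where "q = Max (insert 0 ((\<lambda>i. b i / a i) ` I))"
  have q: "0 \<le> q" "q < 1" using I ab by (auto simp: q_def intro!: divide_less_eq_1_pos[THEN iffD2]) (use ab in fastforce)+
  have bq: "b i \<le> q * a i" if "i \<in> I" for i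
  proof -
    have "b i / a i \<le> q" unfolding q_def using I that by (intro Max_ge) auto
    then show ?thesis using ab[OF that] by (simp add: field_simps)
  qed
  have one: "r u i - r w i \<le> q * D"
    if uw: "u \<in> B" "w \<in> B" "i \<in> I" and D: "\<And>j. j \<in> I \<Longrightarrow> \<bar>u j - w j\<bar> \<le> D" for u w i D
  proof (rule ccontr)
    assume "\<not> ?thesis"
    then have gt: "r u i - r w i > q * D" by simp
    have "D \<ge> 0" using D[OF uw(3)] by linarith
    then have x0: "r u i - r w i > 0" using gt q(1) by (meson le_less_trans mult_nonneg_nonneg)
    define x where "x = r u i - r w i"
    \<comment> \<open>After the update the distance in coordinate i is x, so the bound for the pair
      is max D x.\<close>
    have est: "a i * x - b i * max D x \<le> 0"
    proof -
      have "a i * ((u(i := r u i)) i - (w(i := r w i)) i) - b i * max D x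
          \<le> H i (u(i := r u i)) - H i (w(i := r w i))"
        using uw r[of u i] r[of w i] D x0 by (intro mono upd) (auto simp: x_def le_max_iff_disj)
      then show ?thesis using r uw by (simp add: x_def)
    qed
    show False
    proof (cases "x \<le> D")
      case True
      then have "a i * x \<le> b i * D" using est by simp
      also have "\<dots> \<le> q * a i * D" using bq[OF uw(3)] \<open>D \<ge> 0\<close> by (rule mult_right_mono)
      finally have "a i * x \<le> a i * (q * D)" by (simp add: mult_ac)
      moreover have "a i > 0" using ab[OF uw(3)] by linarith
      ultimately have "x \<le> q * D" by (simp add: mult_le_cancel_left_pos)
      then show False using gt by (simp add: x_def)
    next
      case False
      then have "(a i - b i) * x \<le> 0" using est by (simp add: algebra_simps)
      moreover have "(a i - b i) * x > 0" using ab[OF uw(3)] x0 by (simp add: x_def)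
      ultimately show False by simp
    qed
  qed
  have "\<exists>w\<in>PiE I (\<lambda>_. {lo..hi}). T w = w"
  proof (rule contraction_fixed_point[OF I _ _ _ q])
    show "PiE I (\<lambda>_. {lo..hi}) \<noteq> {}" using le by (simp add: PiE_eq_empty_iff)
    fix x y D i
    assume *: "x \<in> PiE I (\<lambda>_. {lo..hi})" "y \<in> PiE I (\<lambda>_. {lo..hi})"
      "\<And>j. j \<in> I \<Longrightarrow> \<bar>x j - y j\<bar> \<le> D" "i \<in> I"
    then show "\<bar>T x i - T y i\<bar> \<le> q * D"
      using one[of x y i D] one[of y x i D] by (auto simp: T_def B_def abs_le_iff abs_minus_commute)
  qed (use TB in \<open>auto simp: B_def\<close>)
  then obtain w where w: "w \<in> B" "T w = w" by (auto simp: B_def)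
  have "H i w = 0" if i: "i \<in> I" for i
  proof -
    have "r w i = w i" using fun_cong[OF w(2), of i] i by (simp add: T_def)
    then show ?thesis using r[OF w(1) i] by simp
  qed
  moreover have "u = w" if u: "u \<in> B" "w \<in> B" "\<forall>i\<in>I. H i u = 0" "\<forall>i\<in>I. H i w = 0" for u w
  proof (cases "I = {}")
    case False
    \<comment> \<open>At a coordinate of maximal distance, D can be taken as the distance there,
      which leaves the positive factor a i - b i. The claim has its own u and w so that it applies
      with exchanged roles.\<close>
    have unique: "u i \<le> w i" if i: "i \<in> I" and mx: "\<And>j. j \<in> I \<Longrightarrow> \<bar>u j - w j\<bar> \<le> \<bar>u i - w i\<bar>"
      and u: "u \<in> B" "w \<in> B" "\<forall>i\<in>I. H i u = 0" "\<forall>i\<in>I. H i w = 0" for i u w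
    proof (rule ccontr)
      assume "\<not> ?thesis"
      then have lt: "w i < u i" by simp
      have "a i * (u i - w i) - b i * (u i - w i) \<le> H i u - H i w"
        using lt mx by (intro mono u i) auto
      then have "(a i - b i) * (u i - w i) \<le> 0" using u i by (simp add: algebra_simps)
      moreover have "(a i - b i) * (u i - w i) > 0" using ab[OF i] lt by simp
      ultimately show False by simp
    qed
    obtain i where i: "i \<in> I" and mx: "\<And>j. j \<in> I \<Longrightarrow> \<bar>u j - w j\<bar> \<le> \<bar>u i - w i\<bar>"
      using finite_argmax[OF I False, of "\<lambda>j. \<bar>u j - w j\<bar>"] by blast
    have "\<bar>w j - u j\<bar> \<le> \<bar>w i - u i\<bar>" if "j \<in> I" for j
      using mx[OF that] by (simp add: abs_minus_commute)
    then have "w i \<le> u i" by (rule unique[OF i _ u(2,1,4,3)])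
    moreover have "u i \<le> w i" by (rule unique[OF i mx u])
    ultimately have "u i = w i" by simp
    then have "u j = w j" if "j \<in> I" for j using mx[OF that] by simp
    then show ?thesis using u by (intro PiE_ext[of u I "\<lambda>_. {lo..hi}"]) (auto simp: B_def)
  qed (use u in \<open>auto simp: B_def\<close>)
  ultimately show ?thesis using w(1) by (intro ex1I[of _ w]) auto
qed

section \<open>Fourth powers and moduli of the emissivity\<close>

lemma power4_diff_le:
  fixes u w r :: real
  assumes "0 \<le> u" "u \<le> r" "0 \<le> w" "w \<le> r"
  shows "\<bar>u ^ 4 - w ^ 4\<bar> \<le> 4 * r ^ 3 * \<bar>u - w\<bar>"
proof -
  have r: "0 \<le> r" using assms by linarith
  have "u ^ 4 - w ^ 4 = (u ^ 3 + u ^ 2 * w + u * w ^ 2 + w ^ 3) * (u - w)"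
    by (simp add: power4_eq_xxxx power3_eq_cube power2_eq_square algebra_simps)
  then have "\<bar>u ^ 4 - w ^ 4\<bar> = (u ^ 3 + u ^ 2 * w + u * w ^ 2 + w ^ 3) * \<bar>u - w\<bar>"
    using assms by (simp add: abs_mult)
  also have "\<dots> \<le> (r ^ 3 + r ^ 2 * r + r * r ^ 2 + r ^ 3) * \<bar>u - w\<bar>"
    using assms r by (intro mult_right_mono add_mono mult_mono power_mono) auto
  finally show ?thesis by (simp add: power3_eq_cube power2_eq_square algebra_simps)
qed

lemma lip_const_le:
  assumes "bdd_above (lipschitz_quotients h r)" "x \<in> {0..r}" "y \<in> {0..r}"
  shows "\<bar>h x - h y\<bar> \<le> lip_const h r * \<bar>x - y\<bar>"
proof (cases "x = y")
  case False
  then have "r \<noteq> 0" using assms by auto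
  moreover have "\<bar>h x - h y\<bar> / \<bar>x - y\<bar> \<le> Sup (lipschitz_quotients h r)"
    using assms False by (intro cSup_upper) (auto simp: lipschitz_quotients_def)
  ultimately show ?thesis using False by (simp add: lip_const_def field_simps)
qed simp

lemma lip_const_nonneg:
  assumes "bdd_above (lipschitz_quotients h r)" "r > 0"
  shows "0 \<le> lip_const h r"
proof -
  have "0 \<le> lip_const h r * r" using lip_const_le[OF assms(1), of 0 r] assms(2) by simp
  then show ?thesis using assms(2) by (simp add: zero_le_mult_iff)
qed

text \<open>A real supremum carries information only for a set bounded above. The Lipschitz estimate
  bounds all partition sums by the Lipschitz constant times r, and the partition with a single step
  supplies a nonnegative member.\<close>

lemma neg_variation_nonneg:
  assumes "bdd_above (lipschitz_quotients h r)" "r > 0"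
  shows "0 \<le> neg_variation h r"
proof -
  let ?S = "{(\<Sum>k=1..n. - min 0 (h (s k) - h (s (k - 1)))) | (n::nat) (s :: nat \<Rightarrow> real).
            s 0 = 0 \<and> s n = r \<and> (\<forall>k\<in>{1..n}. s (k - 1) < s k)}"
  let ?L = "lip_const h r"
  have "z \<le> ?L * r" if zS: "z \<in> ?S" for z
  proof -
    obtain n and s :: "nat \<Rightarrow> real" where z: "z = (\<Sum>k=1..n. - min 0 (h (s k) - h (s (k - 1))))"
      and s: "s 0 = 0" "s n = r" "\<And>k. k \<in> {1..n} \<Longrightarrow> s (k - 1) < s k" using zS by blast
    have mono: "s j \<le> s k" if "j \<le> k" "k \<le> n" for j k
      using that
    proof (induction k)
      case (Suc k)
      then show ?case using s(3)[of "Suc k"] by (cases "j = Suc k") force+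
    qed simp
    have "z \<le> (\<Sum>k=1..n. ?L * (s k - s (k - 1)))"
      unfolding z
    proof (rule sum_mono)
      fix k assume k: "k \<in> {1..n}"
      then have "s k \<in> {0..r}" "s (k - 1) \<in> {0..r}"
        using mono[of 0 k] mono[of k n] mono[of 0 "k - 1"] mono[of "k - 1" n] s by auto
      then show "- min 0 (h (s k) - h (s (k - 1))) \<le> ?L * (s k - s (k - 1))"
        using lip_const_le[OF assms(1), of "s k" "s (k - 1)"] s(3)[OF k] by (auto simp: min_def)
    qed
    also have "\<dots> = ?L * (\<Sum>k=1..n. s k - s (k - 1))" by (simp add: sum_distrib_left)
    also have "(\<Sum>k=1..n. s k - s (k - 1)) = r"
      using sum_telescope''[of 0 n s] s by simp
    finally show ?thesis .
  qed
  then have "bdd_above ?S" by (intro bdd_aboveI)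
  moreover have "- min 0 (h r - h 0) \<in> ?S"
    using assms(2) by (intro CollectI exI[of _ 1] exI[of _ "\<lambda>k. real k * r"]) auto
  ultimately have "- min 0 (h r - h 0) \<le> Sup ?S" by (rule cSup_upper[rotated])
  then show ?thesis using assms(2) by (simp add: neg_variation_def)
qed

section \<open>Radiosity in an enclosure\<close>

text \<open>A finite radiation enclosure: \<open>L\<close> holds the view factors and \<open>p\<close> those of the open end, through
  which black-body radiation of intensity \<open>\<sigma> * \<tau>\<close> enters. The closed interface is the case p = 0.\<close>

locale enclosure =
  fixes A :: "'a set" and area :: "'a \<Rightarrow> real" and L :: "'a \<Rightarrow> 'a \<Rightarrow> real" and p :: "'a \<Rightarrow> real"
  assumes fin: "finite A" and area_pos: "\<And>i. i \<in> A \<Longrightarrow> 0 < area i"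
    and L_nonneg: "\<And>i j. i \<in> A \<Longrightarrow> j \<in> A \<Longrightarrow> 0 \<le> L i j"
    and p_nonneg: "\<And>i. i \<in> A \<Longrightarrow> 0 \<le> p i"
    and L_sum: "\<And>i. i \<in> A \<Longrightarrow> (\<Sum>j\<in>A. L i j) + p i = area i"
begin

definition G :: "('a \<Rightarrow> real) \<Rightarrow> 'a \<Rightarrow> 'a \<Rightarrow> real" where
  "G e i j = (if i = j then area i else 0) - (1 - e i) * L i j"

definition V :: "real \<Rightarrow> real \<Rightarrow> ('a \<Rightarrow> real) \<Rightarrow> ('a \<Rightarrow> real) \<Rightarrow> 'a \<Rightarrow> real" where
  "V \<sigma> \<tau> e u i = e i * (\<Sum>j\<in>A. matrix_vector_on A (matrix_inverse_on A (G e))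
      (\<lambda>j. \<sigma> * e j * u j ^ 4 * area j + \<sigma> * (1 - e j) * \<tau> * p j) j * L i j) + \<sigma> * e i * \<tau> * p i"

lemma G_sum:
  assumes "i \<in> A"
  shows "(\<Sum>j\<in>A. G e i j * x j) = area i * x i - (1 - e i) * (\<Sum>j\<in>A. L i j * x j)"
proof -
  have "(\<Sum>j\<in>A. G e i j * x j)
      = (\<Sum>j\<in>A. (if i = j then area i * x i else 0) - (1 - e i) * (L i j * x j))"
    by (intro sum.cong) (auto simp: G_def algebra_simps)
  also have "\<dots> = area i * x i - (1 - e i) * (\<Sum>j\<in>A. L i j * x j)"
    using assms fin by (simp add: sum_subtractf sum_distrib_left)
  finally show ?thesis .
qed

text \<open>The open end counts as a further element with value K; together with it the view factors
  of a row add up to the area.\<close>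

lemma L_weighted_le:
  assumes "i \<in> A" "\<And>j. j \<in> A \<Longrightarrow> x j \<le> K"
  shows "(\<Sum>j\<in>A. L i j * x j) + p i * K \<le> area i * K"
proof -
  have "(\<Sum>j\<in>A. L i j * x j) \<le> (\<Sum>j\<in>A. L i j * K)"
    using assms L_nonneg by (intro sum_mono mult_left_mono) auto
  also have "\<dots> = (area i - p i) * K" using L_sum[OF assms(1)] by (simp add: sum_distrib_right[symmetric])
  finally show ?thesis by (simp add: algebra_simps)
qed

text \<open>Monotonicity of the inverse: the right-hand side of the hypothesis is \<open>G e\<close> applied to the
  constant vector K.\<close>

lemma G_le_imp_le:
  assumes e: "\<And>i. i \<in> A \<Longrightarrow> 0 < e i \<and> e i \<le> 1"
    and Gx: "\<And>i. i \<in> A \<Longrightarrow> (\<Sum>j\<in>A. G e i j * x j) \<le> K * (e i * area i + (1 - e i) * p i)"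
    and i: "i \<in> A"
  shows "x i \<le> K"
proof -
  obtain j where j: "j \<in> A" and mx: "\<And>k. k \<in> A \<Longrightarrow> x k \<le> x j"
    using finite_argmax[OF fin, of x] i by blast
  \<comment> \<open>At a maximal coordinate the weighted sum is at most \<open>area j * x j\<close>,
    so row j of G applied to x is at least \<open>x j\<close> times the row sum of G.\<close>
  have "(1 - e j) * ((\<Sum>k\<in>A. L j k * x k) + p j * x j) \<le> (1 - e j) * (area j * x j)"
    using e[OF j] L_weighted_le[OF j mx] by (intro mult_left_mono) auto
  then have "x j * (e j * area j + (1 - e j) * p j) \<le> (\<Sum>k\<in>A. G e j k * x k)"
    unfolding G_sum[OF j] by (simp add: algebra_simps)
  also have "\<dots> \<le> K * (e j * area j + (1 - e j) * p j)" by (rule Gx[OF j])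
  finally have "x j * (e j * area j + (1 - e j) * p j) \<le> K * (e j * area j + (1 - e j) * p j)" .
  moreover have "0 < e j * area j + (1 - e j) * p j"
    using e[OF j] area_pos[OF j] p_nonneg[OF j] by (intro add_pos_nonneg) auto
  ultimately have "x j \<le> K" by (simp add: mult_le_cancel_right_pos)
  then show ?thesis using mx[OF i] by linarith
qed

lemma G_ge_imp_ge:
  assumes e: "\<And>i. i \<in> A \<Longrightarrow> 0 < e i \<and> e i \<le> 1"
    and Gx: "\<And>i. i \<in> A \<Longrightarrow> K * (e i * area i + (1 - e i) * p i) \<le> (\<Sum>j\<in>A. G e i j * x j)"
    and i: "i \<in> A"
  shows "K \<le> x i"
proof -
  have "- x i \<le> - K"
  proof (rule G_le_imp_le[where e = e and x = "\<lambda>j. - x j", OF e _ i])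
    fix j assume "j \<in> A"
    from Gx[OF this] show "(\<Sum>k\<in>A. G e j k * - x k) \<le> - K * (e j * area j + (1 - e j) * p j)"
      by (simp add: sum_negf)
  qed
  then show ?thesis by simp
qed

lemma G_injective:
  assumes e: "\<And>i. i \<in> A \<Longrightarrow> 0 < e i \<and> e i \<le> 1"
    and eq: "\<And>i. i \<in> A \<Longrightarrow> (\<Sum>j\<in>A. G e i j * x j) = (\<Sum>j\<in>A. G e i j * y j)"
    and i: "i \<in> A"
  shows "x i = y i"
proof -
  have "(\<Sum>j\<in>A. G e i j * (x j - y j)) = 0" if "i \<in> A" for i
    using eq[OF that] by (simp add: right_diff_distrib sum_subtractf)
  then have "x i - y i \<le> 0" "0 \<le> x i - y i"
    using e i by (intro G_le_imp_le[of e "\<lambda>j. x j - y j"] G_ge_imp_ge[of e _ "\<lambda>j. x j - y j"]; simp)+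
  then show ?thesis by simp
qed

text \<open>The system is the fixed point equation of a Jacobi iteration with the areas as diagonal.
  Its contraction factor is the largest reflectivity 1 - e i, since the view factors of a row add up
  to at most the area.\<close>

lemma G_solvable:
  assumes e: "\<And>i. i \<in> A \<Longrightarrow> 0 < e i \<and> e i \<le> 1"
  shows "\<exists>x\<in>A \<rightarrow>\<^sub>E UNIV. \<forall>i\<in>A. (\<Sum>j\<in>A. G e i j * x j) = b i"
proof -
  define q where "q = Max (insert 0 ((\<lambda>i. 1 - e i) ` A))"
  have q: "0 \<le> q" "q < 1" using fin e by (auto simp: q_def)
  have eq: "1 - e i \<le> q" if "i \<in> A" for i unfolding q_def using fin that by (intro Max_ge) auto
  define T where "T x = (\<lambda>i\<in>A. (b i + (1 - e i) * (\<Sum>j\<in>A. L i j * x j)) / area i)" for x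
  have "\<exists>x\<in>PiE A (\<lambda>_. UNIV). T x = x"
  proof (rule contraction_fixed_point[OF fin _ _ _ q])
    fix x y :: "'a \<Rightarrow> real" and D i
    assume D: "\<And>j. j \<in> A \<Longrightarrow> \<bar>x j - y j\<bar> \<le> D" and i: "i \<in> A"
    have D0: "0 \<le> D" using D[OF i] by linarith
    have "T x i - T y i = (1 - e i) * (\<Sum>j\<in>A. L i j * (x j - y j)) / area i"
      using i by (simp add: T_def diff_divide_distrib[symmetric] right_diff_distrib sum_subtractf)
    then have "\<bar>T x i - T y i\<bar> = (1 - e i) * \<bar>\<Sum>j\<in>A. L i j * (x j - y j)\<bar> / area i"
      using e[OF i] area_pos[OF i] by (simp add: abs_mult)
    also have "\<dots> \<le> q * (area i * D) / area i"
    proof (intro divide_right_mono mult_mono)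
      have "\<bar>\<Sum>j\<in>A. L i j * (x j - y j)\<bar> \<le> (\<Sum>j\<in>A. L i j * \<bar>x j - y j\<bar>)"
        using L_nonneg i by (intro order_trans[OF sum_abs] sum_mono) (simp add: abs_mult)
      also have "\<dots> \<le> area i * D"
        using L_weighted_le[OF i, of "\<lambda>j. \<bar>x j - y j\<bar>" D] D p_nonneg[OF i] D0
        by (smt (verit) mult_nonneg_nonneg)
      finally show "\<bar>\<Sum>j\<in>A. L i j * (x j - y j)\<bar> \<le> area i * D" .
    qed (use q eq[OF i] area_pos[OF i] in auto)
    also have "\<dots> = q * D" using area_pos[OF i] by simp
    finally show "\<bar>T x i - T y i\<bar> \<le> q * D" .
  qed (auto simp: T_def PiE_eq_empty_iff)
  then obtain x where x: "x \<in> A \<rightarrow>\<^sub>E UNIV" "T x = x" by blast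
  have "(\<Sum>j\<in>A. G e i j * x j) = b i" if i: "i \<in> A" for i
  proof -
    have "x i = (b i + (1 - e i) * (\<Sum>j\<in>A. L i j * x j)) / area i"
      using fun_cong[OF x(2), of i] i by (simp add: T_def)
    then show ?thesis using area_pos[OF i] unfolding G_sum[OF i] by (simp add: field_simps)
  qed
  then show ?thesis using x(1) by blast
qed

text \<open>\<open>matrix_inverse_on\<close> is a definite description, so a two-sided inverse has
  to exist and be unique. Solving for the unit vectors gives the columns of a right inverse H; it is
  also a left inverse because G (H G) = G and G is injective, and injectivity yields uniqueness as
  well.\<close>

lemma matrix_inverse_G:
  assumes e: "\<And>i. i \<in> A \<Longrightarrow> 0 < e i \<and> e i \<le> 1"
    and i: "i \<in> A"
  shows "(\<Sum>j\<in>A. G e i j * matrix_vector_on A (matrix_inverse_on A (G e)) b j) = b i"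
proof -
  have "\<forall>j. \<exists>x. x \<in> A \<rightarrow>\<^sub>E UNIV \<and> (\<forall>i\<in>A. (\<Sum>k\<in>A. G e i k * x k) = (if i = j then 1 else 0))"
  proof
    fix j
    show "\<exists>x. x \<in> A \<rightarrow>\<^sub>E UNIV \<and> (\<forall>i\<in>A. (\<Sum>k\<in>A. G e i k * x k) = (if i = j then 1 else 0))"
      using G_solvable[of e "\<lambda>i. if i = j then 1 else 0"] e by auto
  qed
  from choice[OF this] obtain C where C0: "\<forall>j. C j \<in> A \<rightarrow>\<^sub>E UNIV \<and>
    (\<forall>i\<in>A. (\<Sum>k\<in>A. G e i k * C j k) = (if i = j then 1 else 0))" ..
  then have C: "(\<Sum>k\<in>A. G e i k * C j k) = (if i = j then 1 else 0)" if "i \<in> A" for i j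
    using that by blast
  \<comment> \<open>Restriction to A in both arguments meets the extensionality demanded by the
    description.\<close>
  define H where "H = (\<lambda>i\<in>A. \<lambda>j\<in>A. C j i)"
  have GH: "(\<Sum>k\<in>A. G e i k * H k j) = (if i = j then 1 else 0)" if "i \<in> A" "j \<in> A" for i j
    using C[OF that(1), of j] that by (simp add: H_def)
  let ?Q = "\<lambda>H. H \<in> A \<rightarrow>\<^sub>E (A \<rightarrow>\<^sub>E UNIV) \<and>
     (\<forall>i\<in>A. \<forall>j\<in>A. (\<Sum>k\<in>A. G e i k * H k j) = (if i = j then 1 else 0) \<and>
                 (\<Sum>k\<in>A. H i k * G e k j) = (if i = j then 1 else 0))"
  have HG: "(\<Sum>k\<in>A. H i k * G e k j) = (if i = j then 1 else 0)" if "i \<in> A" "j \<in> A" for i j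
  proof (rule G_injective[where x = "\<lambda>i. \<Sum>k\<in>A. H i k * G e k j" and y = "\<lambda>i. if i = j then 1 else 0", OF e _ that(1)])
    fix l assume l: "l \<in> A"
    have "(\<Sum>i\<in>A. G e l i * (\<Sum>k\<in>A. H i k * G e k j)) = (\<Sum>k\<in>A. (\<Sum>i\<in>A. G e l i * H i k) * G e k j)"
      unfolding sum_distrib_left sum_distrib_right by (subst sum.swap) (simp add: mult.assoc)
    also have "\<dots> = (\<Sum>k\<in>A. (if l = k then 1 else 0) * G e k j)" using GH[OF l] by (intro sum.cong) auto
    also have "\<dots> = G e l j" using l fin by (simp add: if_distrib[of "\<lambda>x. x * _"] cong: if_cong)
    also have "\<dots> = (\<Sum>i\<in>A. G e l i * (if i = j then 1 else 0))"
      using that(2) fin by (simp add: if_distrib[of "\<lambda>x. _ * x"] cong: if_cong)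
    finally show "(\<Sum>i\<in>A. G e l i * (\<Sum>k\<in>A. H i k * G e k j))
        = (\<Sum>i\<in>A. G e l i * (if i = j then 1 else 0))" .
  qed
  have QH: "?Q H" using GH HG by (auto simp: H_def)
  have "matrix_inverse_on A (G e) = H"
    unfolding matrix_inverse_on_def
  proof (rule the_equality[of ?Q, OF QH])
    fix K assume K: "?Q K"
    have "K i j = H i j" if ab: "i \<in> A" "j \<in> A" for i j
      using K GH ab(2) by (intro G_injective[of e "\<lambda>i. K i j" "\<lambda>i. H i j", OF e _ ab(1)]) auto
    moreover have "K i \<in> A \<rightarrow>\<^sub>E UNIV" "H i \<in> A \<rightarrow>\<^sub>E UNIV" if "i \<in> A" for i
      using K QH that by blast+
    ultimately have "K i = H i" if "i \<in> A" for i using that by (intro PiE_ext[of "K i" A _ "H i"])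
    then show "K = H" using K QH by (intro PiE_ext[of K A "\<lambda>_. A \<rightarrow>\<^sub>E UNIV" H]) blast+
  qed
  moreover have "(\<Sum>j\<in>A. G e i j * (\<Sum>k\<in>A. H j k * b k)) = b i"
  proof -
    have "(\<Sum>j\<in>A. G e i j * (\<Sum>k\<in>A. H j k * b k)) = (\<Sum>k\<in>A. (\<Sum>j\<in>A. G e i j * H j k) * b k)"
      unfolding sum_distrib_left sum_distrib_right by (subst sum.swap) (simp add: mult.assoc)
    also have "\<dots> = (\<Sum>k\<in>A. (if i = k then 1 else 0) * b k)" using GH[OF i] by (intro sum.cong) auto
    also have "\<dots> = b i" using i fin by (simp add: if_distrib[of "\<lambda>x. x * _"] cong: if_cong)
    finally show ?thesis .
  qed
  ultimately show ?thesis by (simp add: matrix_vector_on_def)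
qed

text \<open>Replaces the matrix inverse by the balance equation for R and exhibits V as absorptivity
  times incoming flux, the flux through the open end included.\<close>

lemma radiosity:
  assumes e: "\<And>i. i \<in> A \<Longrightarrow> 0 < e i \<and> e i \<le> 1"
  obtains R where "\<And>i. i \<in> A \<Longrightarrow> (\<Sum>j\<in>A. G e i j * R j)
      = \<sigma> * e i * u i ^ 4 * area i + \<sigma> * (1 - e i) * \<tau> * p i"
    "\<And>i. V \<sigma> \<tau> e u i = e i * ((\<Sum>j\<in>A. L i j * R j) + p i * (\<sigma> * \<tau>))"
proof (rule that)
  fix i assume "i \<in> A"
  from matrix_inverse_G[OF e this]
  show "(\<Sum>j\<in>A. G e i j * matrix_vector_on A (matrix_inverse_on A (G e))
      (\<lambda>j. \<sigma> * e j * u j ^ 4 * area j + \<sigma> * (1 - e j) * \<tau> * p j) j)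
      = \<sigma> * e i * u i ^ 4 * area i + \<sigma> * (1 - e i) * \<tau> * p i" .
qed (simp add: V_def algebra_simps)

text \<open>In equilibrium at intensity Q the radiosity is the constant \<sigma> * Q. The comparison
  principle for G compares R with this constant, and the view factors, which together with the open
  end add up to the area, carry the bound over to the incoming flux.\<close>

lemma radiosity_bounds:
  assumes e: "\<And>i. i \<in> A \<Longrightarrow> 0 < e i \<and> e i \<le> 1" and \<sigma>: "0 \<le> \<sigma>"
    and R: "\<And>i. i \<in> A \<Longrightarrow> (\<Sum>j\<in>A. G e i j * R j)
      = \<sigma> * e i * u i ^ 4 * area i + \<sigma> * (1 - e i) * \<tau> * p i"
    and i: "i \<in> A"
  shows "(\<And>j. j \<in> A \<Longrightarrow> u j ^ 4 \<le> Q) \<Longrightarrow> \<tau> \<le> Q \<Longrightarrow>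
      (\<Sum>j\<in>A. L i j * R j) + p i * (\<sigma> * \<tau>) \<le> \<sigma> * Q * area i"
    and "(\<And>j. j \<in> A \<Longrightarrow> Q \<le> u j ^ 4) \<Longrightarrow> Q \<le> \<tau> \<Longrightarrow>
      \<sigma> * Q * area i \<le> (\<Sum>j\<in>A. L i j * R j) + p i * (\<sigma> * \<tau>)"
proof -
  assume Q: "\<And>j. j \<in> A \<Longrightarrow> u j ^ 4 \<le> Q" "\<tau> \<le> Q"
  have "R j \<le> \<sigma> * Q" if j: "j \<in> A" for j
  proof (rule G_le_imp_le[OF e _ j])
    fix k assume k: "k \<in> A"
    have "\<sigma> * e k * area k * u k ^ 4 + \<sigma> * (1 - e k) * p k * \<tau>
        \<le> \<sigma> * e k * area k * Q + \<sigma> * (1 - e k) * p k * Q"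
      using Q k e[OF k] area_pos[OF k] p_nonneg[OF k] \<sigma>
      by (intro add_mono mult_left_mono mult_nonneg_nonneg) auto
    then show "(\<Sum>j\<in>A. G e k j * R j) \<le> \<sigma> * Q * (e k * area k + (1 - e k) * p k)"
      unfolding R[OF k] by (simp add: algebra_simps)
  qed
  then have "(\<Sum>j\<in>A. L i j * R j) + p i * (\<sigma> * Q) \<le> area i * (\<sigma> * Q)" by (rule L_weighted_le[OF i])
  moreover have "p i * (\<sigma> * \<tau>) \<le> p i * (\<sigma> * Q)"
    using Q(2) \<sigma> p_nonneg[OF i] by (intro mult_left_mono) auto
  ultimately show "(\<Sum>j\<in>A. L i j * R j) + p i * (\<sigma> * \<tau>) \<le> \<sigma> * Q * area i" by (simp add: mult_ac)
next
  assume Q: "\<And>j. j \<in> A \<Longrightarrow> Q \<le> u j ^ 4" "Q \<le> \<tau>"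
  have "\<sigma> * Q \<le> R j" if j: "j \<in> A" for j
  proof (rule G_ge_imp_ge[OF e _ j])
    fix k assume k: "k \<in> A"
    have "\<sigma> * e k * area k * Q + \<sigma> * (1 - e k) * p k * Q
        \<le> \<sigma> * e k * area k * u k ^ 4 + \<sigma> * (1 - e k) * p k * \<tau>"
      using Q k e[OF k] area_pos[OF k] p_nonneg[OF k] \<sigma>
      by (intro add_mono mult_left_mono mult_nonneg_nonneg) auto
    then show "\<sigma> * Q * (e k * area k + (1 - e k) * p k) \<le> (\<Sum>j\<in>A. G e k j * R j)"
      unfolding R[OF k] by (simp add: algebra_simps)
  qed
  then have "(\<Sum>j\<in>A. L i j * - R j) + p i * - (\<sigma> * Q) \<le> area i * - (\<sigma> * Q)"
    by (intro L_weighted_le[OF i]) simp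
  moreover have "p i * (\<sigma> * Q) \<le> p i * (\<sigma> * \<tau>)"
    using Q(2) \<sigma> p_nonneg[OF i] by (intro mult_left_mono) auto
  ultimately show "\<sigma> * Q * area i \<le> (\<Sum>j\<in>A. L i j * R j) + p i * (\<sigma> * \<tau>)"
    by (simp add: sum_negf mult_ac)
qed

lemma V_bounds:
  assumes e: "\<And>i. i \<in> A \<Longrightarrow> 0 < e i \<and> e i \<le> 1" and \<sigma>: "0 \<le> \<sigma>" and i: "i \<in> A"
  shows "(\<And>j. j \<in> A \<Longrightarrow> u j ^ 4 \<le> Q) \<Longrightarrow> \<tau> \<le> Q \<Longrightarrow> V \<sigma> \<tau> e u i \<le> \<sigma> * e i * Q * area i"
    and "(\<And>j. j \<in> A \<Longrightarrow> Q \<le> u j ^ 4) \<Longrightarrow> Q \<le> \<tau> \<Longrightarrow> \<sigma> * e i * Q * area i \<le> V \<sigma> \<tau> e u i"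
proof -
  obtain R where R: "\<And>i. i \<in> A \<Longrightarrow> (\<Sum>j\<in>A. G e i j * R j)
      = \<sigma> * e i * u i ^ 4 * area i + \<sigma> * (1 - e i) * \<tau> * p i"
    and V: "\<And>i. V \<sigma> \<tau> e u i = e i * ((\<Sum>j\<in>A. L i j * R j) + p i * (\<sigma> * \<tau>))"
    using radiosity[of e \<sigma> u \<tau>, OF e] by blast
  have ei: "0 \<le> e i" using e[OF i] by simp
  show "V \<sigma> \<tau> e u i \<le> \<sigma> * e i * Q * area i" if "\<And>j. j \<in> A \<Longrightarrow> u j ^ 4 \<le> Q" "\<tau> \<le> Q"
  proof -
    have "(\<Sum>j\<in>A. L i j * R j) + p i * (\<sigma> * \<tau>) \<le> \<sigma> * Q * area i"
      using that by (intro radiosity_bounds(1)[of e \<sigma> R u \<tau>] e \<sigma> R i)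
    from mult_left_mono[OF this ei] show ?thesis by (simp add: V mult_ac)
  qed
  show "\<sigma> * e i * Q * area i \<le> V \<sigma> \<tau> e u i" if "\<And>j. j \<in> A \<Longrightarrow> Q \<le> u j ^ 4" "Q \<le> \<tau>"
  proof -
    have "\<sigma> * Q * area i \<le> (\<Sum>j\<in>A. L i j * R j) + p i * (\<sigma> * \<tau>)"
      using that by (intro radiosity_bounds(2)[of e \<sigma> R u \<tau>] e \<sigma> R i)
    from mult_left_mono[OF this ei] show ?thesis by (simp add: V mult_ac)
  qed
qed

text \<open>The elements of one cell carry the temperature of the cell, hence share one emissivity
  c; this allows their areas to be summed.\<close>

lemma V_sum_bounds:
  assumes e: "\<And>i. i \<in> A \<Longrightarrow> 0 < e i \<and> e i \<le> 1" and \<sigma>: "0 \<le> \<sigma>"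
    and J: "\<And>i. i \<in> J \<Longrightarrow> i \<in> A \<and> e i = c"
  shows "(\<And>j. j \<in> A \<Longrightarrow> u j ^ 4 \<le> Q) \<Longrightarrow> \<tau> \<le> Q \<Longrightarrow>
      (\<Sum>i\<in>J. V \<sigma> \<tau> e u i) \<le> \<sigma> * c * Q * (\<Sum>i\<in>J. area i)"
    and "(\<And>j. j \<in> A \<Longrightarrow> Q \<le> u j ^ 4) \<Longrightarrow> Q \<le> \<tau> \<Longrightarrow>
      \<sigma> * c * Q * (\<Sum>i\<in>J. area i) \<le> (\<Sum>i\<in>J. V \<sigma> \<tau> e u i)"
proof -
  have "(\<Sum>i\<in>J. \<sigma> * e i * Q * area i) = \<sigma> * c * Q * (\<Sum>i\<in>J. area i)"
    unfolding sum_distrib_left using J by (intro sum.cong) auto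
  note eq = this[symmetric]
  show "(\<Sum>i\<in>J. V \<sigma> \<tau> e u i) \<le> \<sigma> * c * Q * (\<Sum>i\<in>J. area i)"
    if "\<And>j. j \<in> A \<Longrightarrow> u j ^ 4 \<le> Q" "\<tau> \<le> Q"
    unfolding eq using J that e by (intro sum_mono V_bounds(1) \<sigma>) blast+
  show "\<sigma> * c * Q * (\<Sum>i\<in>J. area i) \<le> (\<Sum>i\<in>J. V \<sigma> \<tau> e u i)"
    if "\<And>j. j \<in> A \<Longrightarrow> Q \<le> u j ^ 4" "Q \<le> \<tau>"
    unfolding eq using J that e by (intro sum_mono V_bounds(2) \<sigma>) blast+
qed

text \<open>A perturbation estimate that does not differentiate the inverse matrix. Applying the
  matrix of u to R - R' leaves the difference of the emissions and a term from the change of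
  emissivity; both are bounded relative to the row sums of the matrix, so the comparison principle
  bounds R - R' by K. The product rule for V adds the change of the prefactor.\<close>

lemma V_lipschitz:
  assumes \<sigma>: "0 \<le> \<sigma>" and \<tau>: "0 \<le> \<tau>" and i: "i \<in> A" and D: "0 \<le> D" and Lip: "0 \<le> Lip" and em: "0 < em" "em \<le> 1"
    and uw: "\<And>j. j \<in> A \<Longrightarrow> u j \<in> {0..r} \<and> w j \<in> {0..r} \<and> \<bar>u j - w j\<bar> \<le> D"
    and h: "\<And>x. x \<in> {0..r} \<Longrightarrow> em \<le> h x \<and> h x \<le> 1"
    and hL: "\<And>x y. x \<in> {0..r} \<Longrightarrow> y \<in> {0..r} \<Longrightarrow> \<bar>h x - h y\<bar> \<le> Lip * \<bar>x - y\<bar>"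
  shows "\<bar>V \<sigma> \<tau> (h \<circ> u) u i - V \<sigma> \<tau> (h \<circ> w) w i\<bar>
    \<le> \<sigma> * area i * (4 * inverse em * r ^ 3 + max (r ^ 4) \<tau> * Lip * (2 * inverse em + 1)) * D"
proof -
  define Q where "Q = max (r ^ 4) \<tau>"
  have Q: "0 \<le> Q" "\<tau> \<le> Q" using \<tau> by (auto simp: Q_def)
  have r: "0 \<le> r" using uw[OF i] by auto
  have eu: "0 < (h \<circ> u) j \<and> (h \<circ> u) j \<le> 1" "0 < (h \<circ> w) j \<and> (h \<circ> w) j \<le> 1"
    "em \<le> h (u j)" "\<bar>h (u j) - h (w j)\<bar> \<le> Lip * D" if "j \<in> A" for j
  proof -
    have "Lip * \<bar>u j - w j\<bar> \<le> Lip * D" using uw[OF that] Lip by (intro mult_left_mono) auto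
    then show "\<bar>h (u j) - h (w j)\<bar> \<le> Lip * D" using hL[of "u j" "w j"] uw[OF that] by auto
  qed (use h[of "u j"] h[of "w j"] uw[OF that] em in auto)
  obtain R where R: "\<And>i. i \<in> A \<Longrightarrow> (\<Sum>j\<in>A. G (h \<circ> u) i j * R j)
      = \<sigma> * (h \<circ> u) i * u i ^ 4 * area i + \<sigma> * (1 - (h \<circ> u) i) * \<tau> * p i"
    and V: "\<And>i. V \<sigma> \<tau> (h \<circ> u) u i = (h \<circ> u) i * ((\<Sum>j\<in>A. L i j * R j) + p i * (\<sigma> * \<tau>))"
    using radiosity[of "h \<circ> u" \<sigma> u \<tau>, OF eu(1)] by blast
  obtain R' where R': "\<And>i. i \<in> A \<Longrightarrow> (\<Sum>j\<in>A. G (h \<circ> w) i j * R' j)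
      = \<sigma> * (h \<circ> w) i * w i ^ 4 * area i + \<sigma> * (1 - (h \<circ> w) i) * \<tau> * p i"
    and V': "\<And>i. V \<sigma> \<tau> (h \<circ> w) w i = (h \<circ> w) i * ((\<Sum>j\<in>A. L i j * R' j) + p i * (\<sigma> * \<tau>))"
    using radiosity[of "h \<circ> w" \<sigma> w \<tau>, OF eu(2)] by blast
  \<comment> \<open>The incoming flux for w, which lies between 0 and the flux of uniform radiation
    of intensity Q.\<close>
  define S where "S i = (\<Sum>j\<in>A. L i j * R' j) + p i * (\<sigma> * \<tau>)" for i
  have w4: "0 \<le> w j ^ 4" "w j ^ 4 \<le> Q" if "j \<in> A" for j
    using power_mono[of "w j" r 4] uw[OF that] by (auto simp: Q_def le_max_iff_disj)
  have S: "0 \<le> S j" "S j \<le> \<sigma> * Q * area j" if j: "j \<in> A" for j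
  proof -
    have "\<sigma> * 0 * area j \<le> S j"
      unfolding S_def by (intro radiosity_bounds(2)[of "h \<circ> w" \<sigma> R' w \<tau>] eu(2) \<sigma> R' j w4(1) \<tau>)
    then show "0 \<le> S j" by simp
    show "S j \<le> \<sigma> * Q * area j"
      unfolding S_def by (intro radiosity_bounds(1)[of "h \<circ> w" \<sigma> R' w \<tau>] eu(2) \<sigma> R' j w4(2) Q(2))
  qed
  \<comment> \<open>The term 4 r^3 comes from the fourth powers, Q * Lip from the emissivities; the
    latter is divided by em because the comparison is relative to row sums of size at least em *
    area.\<close>
  define K where "K = \<sigma> * (4 * r ^ 3 + Q * Lip * inverse em) * D"
  have GD: "\<bar>\<Sum>k\<in>A. G (h \<circ> u) j k * (R k - R' k)\<bar> \<le> K * (h (u j) * area j + (1 - h (u j)) * p j)"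
    if j: "j \<in> A" for j
  proof -
    let ?a = "h (u j)" and ?b = "h (w j)"
    have a: "0 < ?a" "?a \<le> 1" "em \<le> ?a" using eu(1,3)[OF j] by auto
    have "(\<Sum>k\<in>A. G (h \<circ> u) j k * R' k)
        = (\<Sum>k\<in>A. G (h \<circ> w) j k * R' k) + (?a - ?b) * (\<Sum>k\<in>A. L j k * R' k)"
      by (simp only: G_sum[OF j] o_apply) (simp add: algebra_simps)
    then have GR': "(\<Sum>k\<in>A. G (h \<circ> u) j k * R' k) = (\<sigma> * ?b * w j ^ 4 * area j + \<sigma> * (1 - ?b) * \<tau> * p j)
        + (?a - ?b) * (S j - p j * (\<sigma> * \<tau>))"
      by (simp only: R'[OF j] S_def o_apply add_diff_cancel_right')
    have "(\<Sum>k\<in>A. G (h \<circ> u) j k * (R k - R' k))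
        = (\<Sum>k\<in>A. G (h \<circ> u) j k * R k) - (\<Sum>k\<in>A. G (h \<circ> u) j k * R' k)"
      by (simp only: right_diff_distrib sum_subtractf)
    \<comment> \<open>The contributions of the open end cancel once the term with R' is expressed
      through the incoming flux S.\<close>
    then have eq: "(\<Sum>k\<in>A. G (h \<circ> u) j k * (R k - R' k))
        = \<sigma> * area j * ?a * (u j ^ 4 - w j ^ 4) + (?a - ?b) * (\<sigma> * w j ^ 4 * area j - S j)"
      by (simp only: R[OF j] GR' o_apply) (simp add: algebra_simps)
    have 1: "\<bar>\<sigma> * area j * ?a * (u j ^ 4 - w j ^ 4)\<bar> \<le> \<sigma> * area j * ?a * (4 * r ^ 3 * D)"
    proof -
      have "\<bar>u j ^ 4 - w j ^ 4\<bar> \<le> 4 * r ^ 3 * \<bar>u j - w j\<bar>" using uw[OF j] by (intro power4_diff_le) auto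
      also have "\<dots> \<le> 4 * r ^ 3 * D" using uw[OF j] r by (intro mult_left_mono) auto
      finally show ?thesis
        using \<sigma> area_pos[OF j] a(1) by (simp add: abs_mult mult_left_mono)
    qed
    have 2: "\<bar>(?a - ?b) * (\<sigma> * w j ^ 4 * area j - S j)\<bar> \<le> (Lip * D) * (\<sigma> * Q * area j)"
      unfolding abs_mult
    proof (intro mult_mono)
      have "0 \<le> \<sigma> * w j ^ 4 * area j" "\<sigma> * w j ^ 4 * area j \<le> \<sigma> * Q * area j"
        using \<sigma> area_pos[OF j] w4[OF j] by (auto intro!: mult_right_mono mult_left_mono)
      then show "\<bar>\<sigma> * w j ^ 4 * area j - S j\<bar> \<le> \<sigma> * Q * area j" using S[OF j] by linarith
    qed (use eu(4)[OF j] Lip D in auto)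
    have 3: "(Lip * D) * (\<sigma> * Q * area j) \<le> \<sigma> * area j * ?a * (Q * Lip * inverse em * D)"
    proof -
      \<comment> \<open>The emissivity difference lacks the factor \<open>?a\<close> that the row
        sums carry; \<open>?a\<close> being at least em supplies it at the price of inverse
        em.\<close>
      have "1 \<le> ?a * inverse em" using a em by (simp add: field_simps)
      then have "(Lip * D * (\<sigma> * Q * area j)) * 1 \<le> (Lip * D * (\<sigma> * Q * area j)) * (?a * inverse em)"
        using Lip D \<sigma> Q(1) area_pos[OF j] by (intro mult_left_mono) auto
      then show ?thesis by (simp add: mult_ac)
    qed
    have "0 \<le> K" using \<sigma> r Q(1) Lip em D by (simp add: K_def)
    then have 4: "0 \<le> K * ((1 - ?a) * p j)" using a p_nonneg[OF j] by simp
    have "\<bar>\<Sum>k\<in>A. G (h \<circ> u) j k * (R k - R' k)\<bar> \<le>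
        \<sigma> * area j * ?a * (4 * r ^ 3 * D) + \<sigma> * area j * ?a * (Q * Lip * inverse em * D)"
      unfolding eq using 1 2 3 by linarith
    also have "\<dots> = K * (?a * area j)" by (simp add: K_def algebra_simps)
    finally show ?thesis using 4 by (simp add: distrib_left)
  qed
  have RR: "\<bar>R j - R' j\<bar> \<le> K" if j: "j \<in> A" for j
  proof -
    have "R j - R' j \<le> K"
      using GD by (intro G_le_imp_le[of "h \<circ> u" "\<lambda>j. R j - R' j", OF eu(1) _ j]) (auto simp: abs_le_iff)
    moreover have "- K \<le> R j - R' j"
      using GD by (intro G_ge_imp_ge[of "h \<circ> u" _ "\<lambda>j. R j - R' j", OF eu(1) _ j]) (fastforce simp: abs_le_iff)+
    ultimately show ?thesis by linarith
  qed
  have K0: "0 \<le> K" using RR[OF i] by linarith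
  have LR: "\<bar>\<Sum>j\<in>A. L i j * (R j - R' j)\<bar> \<le> area i * K"
  proof -
    have "\<bar>\<Sum>j\<in>A. L i j * (R j - R' j)\<bar> \<le> (\<Sum>j\<in>A. L i j * \<bar>R j - R' j\<bar>)"
      using L_nonneg i by (intro order_trans[OF sum_abs] sum_mono) (simp add: abs_mult)
    moreover have "0 \<le> p i * K" using p_nonneg[OF i] K0 by simp
    ultimately show ?thesis using L_weighted_le[OF i, of "\<lambda>j. \<bar>R j - R' j\<bar>" K] RR by fastforce
  qed
  let ?a = "h (u i)" and ?b = "h (w i)"
  have a: "0 < ?a" "?a \<le> 1" using eu(1)[OF i] by auto
  have "V \<sigma> \<tau> (h \<circ> u) u i - V \<sigma> \<tau> (h \<circ> w) w i
      = ?a * (\<Sum>j\<in>A. L i j * (R j - R' j)) + (?a - ?b) * S i"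
    by (simp add: V V' S_def right_diff_distrib sum_subtractf algebra_simps)
  moreover have "\<bar>?a * (\<Sum>j\<in>A. L i j * (R j - R' j))\<bar> \<le> 1 * (area i * K)"
    unfolding abs_mult using a LR by (intro mult_mono) auto
  moreover have "\<bar>(?a - ?b) * S i\<bar> \<le> (Lip * D) * (\<sigma> * Q * area i)"
    unfolding abs_mult using eu(4)[OF i] S[OF i] Lip D by (intro mult_mono) auto
  ultimately have "\<bar>V \<sigma> \<tau> (h \<circ> u) u i - V \<sigma> \<tau> (h \<circ> w) w i\<bar> \<le> area i * K + Lip * D * (\<sigma> * Q * area i)"
    by linarith
  also have "\<dots> = \<sigma> * area i * D * (4 * r ^ 3 + Q * Lip * (inverse em + 1))"
    by (simp add: K_def algebra_simps)
  also have "\<dots> \<le> \<sigma> * area i * D * (4 * inverse em * r ^ 3 + Q * Lip * (2 * inverse em + 1))"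
  proof (intro mult_left_mono add_mono)
    have "1 \<le> inverse em" using em by (simp add: field_simps)
    then show "4 * r ^ 3 \<le> 4 * inverse em * r ^ 3" using r by (intro mult_right_mono) auto
  qed (use \<sigma> area_pos[OF i] D Q(1) Lip em in auto)
  finally show ?thesis by (simp add: Q_def mult_ac)
qed

end

section \<open>Estimates for the scheme\<close>

context fv_setting
begin

text \<open>The surface \<open>elem_ph\<close> plays the open end: its radiation is prescribed by
  the external temperature, so it is not among the unknowns.\<close>

interpretation Gam: enclosure "elems_domain P" "\<lambda>\<alpha>. lambda2 (elem P \<alpha>)" "view_Gamma P"
  "\<lambda>\<alpha>. view_Gamma P \<alpha> (elem_ph P)"
proof
  fix \<alpha> assume \<alpha>: "\<alpha> \<in> elems_domain P"
  show "(\<Sum>\<beta>\<in>elems_domain P. view_Gamma P \<alpha> \<beta>) + view_Gamma P \<alpha> (elem_ph P) = lambda2 (elem P \<alpha>)"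
    using view_Gamma_sum[of \<alpha>] \<alpha> finite_elems(1) elem_ph_new by simp
qed (use finite_elems elem_facts(2) view_Gamma_nonneg in auto)

interpretation Int: enclosure "elems_interface P" "\<lambda>\<alpha>. lambda2 (elem P \<alpha>)" "view_interface P" "\<lambda>_. 0"
  by unfold_locales (use finite_elems elem_facts(2) view_interface_nonneg view_interface_sum in auto)

lemma V_Gamma_eq:
  "V_Gamma P u = Gam.V (boltzmann P) (theta_ext P ^ 4) (emissivity P \<circ> u) u"
proof
  fix \<alpha>
  have "G_Gamma P u = Gam.G (emissivity P \<circ> u)" by (intro ext) (simp add: G_Gamma_def Gam.G_def)
  then show "V_Gamma P u \<alpha> = Gam.V (boltzmann P) (theta_ext P ^ 4) (emissivity P \<circ> u) u \<alpha>"
    by (simp add: V_Gamma_def R_Gamma_def Gam.V_def E_rad_def E_ph_def)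
qed

text \<open>For p = 0 all terms with \<tau> vanish. Choosing \<open>theta_ext P ^ 4\<close> gives
  both enclosures the same side conditions.\<close>

lemma V_interface_eq:
  "V_interface P u = Int.V (boltzmann P) (theta_ext P ^ 4) (emissivity P \<circ> u) u"
proof
  fix \<alpha>
  have "G_interface P u = Int.G (emissivity P \<circ> u)" by (intro ext) (simp add: G_interface_def Int.G_def)
  moreover have "E_rad P u = (\<lambda>\<beta>. boltzmann P * emissivity P (u \<beta>) * u \<beta> ^ 4 * lambda2 (elem P \<beta>))"
    by (intro ext) (simp add: E_rad_def)
  ultimately show "V_interface P u \<alpha> = Int.V (boltzmann P) (theta_ext P ^ 4) (emissivity P \<circ> u) u \<alpha>"
    by (simp add: V_interface_def R_interface_def Int.V_def)
qed

section \<open>The terms of the scheme\<close>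

definition area_Gamma :: "'i \<Rightarrow> real" where
  "area_Gamma i = lambda2 (frontier (subcell P Solid i) \<inter> Gamma_domain P)"

definition area_frontier :: "'i \<Rightarrow> real" where
  "area_frontier i = lambda2 (frontier (subcell P Solid i) \<inter> (frontier (domain P) - Gamma_domain P))"

definition area_interface :: "'i \<Rightarrow> real" where
  "area_interface i = lambda2 (cell P i \<inter> interface P)"

definition energy_gain :: "'i \<Rightarrow> real \<Rightarrow> real \<Rightarrow> real" where
  "energy_gain i x y = (\<Sum>m\<in>{Solid, Gas}. (energy P m x - energy P m y) * lambda3 (subcell P m i))"

definition conduction :: "'i \<Rightarrow> ('i \<Rightarrow> real) \<Rightarrow> real" where
  "conduction i w = (\<Sum>m\<in>{Solid, Gas}. kappa P m *
     (\<Sum>j\<in>nb_phase P m i. (w j - w i) / norm (node P i - node P j)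
        * lambda2 (frontier (subcell P m i) \<inter> frontier (subcell P m j))))"

text \<open>Minus the coefficient of \<open>w i\<close> in \<open>conduction i w\<close>: the
  response of conduction to a common shift of all differences \<open>w j - w i\<close>.\<close>

definition conductance :: "'i \<Rightarrow> real" where
  "conductance i = (\<Sum>m\<in>{Solid, Gas}. kappa P m *
     (\<Sum>j\<in>nb_phase P m i. 1 / norm (node P i - node P j)
        * lambda2 (frontier (subcell P m i) \<inter> frontier (subcell P m j))))"

definition irradiation_Gamma :: "'i \<Rightarrow> ('i \<Rightarrow> real) \<Rightarrow> real" where
  "irradiation_Gamma i w = (\<Sum>\<alpha>\<in>J_domain P i. V_Gamma P (w \<circ> cell_of P) \<alpha>)"

definition irradiation_interface :: "'i \<Rightarrow> ('i \<Rightarrow> real) \<Rightarrow> real" where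
  "irradiation_interface i w = (\<Sum>\<alpha>\<in>J_interface P i. V_interface P (w \<circ> cell_of P) \<alpha>)"

definition radiation :: "'i \<Rightarrow> ('i \<Rightarrow> real) \<Rightarrow> real" where
  "radiation i w = boltzmann P * emissivity P (w i) * w i ^ 4 * area_Gamma i - irradiation_Gamma i w
     + boltzmann P * emissivity P (w i) * (w i ^ 4 - theta_ext P ^ 4) * area_frontier i
     + boltzmann P * emissivity P (w i) * w i ^ 4 * area_interface i - irradiation_interface i w"

definition sources :: "nat \<Rightarrow> 'i \<Rightarrow> real" where
  "sources \<nu> i = (\<Sum>m\<in>{Solid, Gas}. source_approx P m \<nu> i * lambda3 (subcell P m i))"

lemma scheme_split:
  "scheme P \<nu> i v w
    = inverse (step P \<nu>) * energy_gain i (w i) (v i) - conduction i w + radiation i w - sources \<nu> i"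
  unfolding scheme_def energy_gain_def conduction_def radiation_def irradiation_Gamma_def
    irradiation_interface_def sources_def area_Gamma_def area_frontier_def area_interface_def
  by (simp only: diff_conv_add_uminus add.assoc)

lemma areas_nonneg: "0 \<le> area_Gamma i" "0 \<le> area_frontier i" "0 \<le> area_interface i"
  by (simp_all add: area_Gamma_def area_frontier_def area_interface_def)

lemma energy_gain_ge:
  assumes "i \<in> cells P" "0 \<le> y" "y \<le> x"
  shows "(x - y) * C_energy P * lambda3 (cell P i) \<le> energy_gain i x y"
proof -
  have "(x - y) * C_energy P * lambda3 (subcell P m i)
      \<le> (energy P m x - energy P m y) * lambda3 (subcell P m i)" for m
    using energy_growth[OF assms(2,3), of m] by (intro mult_right_mono) auto
  from this[of Solid] this[of Gas] show ?thesis
    by (simp add: energy_gain_def cell_volume_split[OF assms(1)] distrib_left)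
qed

lemma energy_gain_swap: "energy_gain i x y = - energy_gain i y x"
  by (simp add: energy_gain_def algebra_simps)

lemma nb_phase_subset: "nb_phase P m i \<subseteq> cells P"
  by (auto simp: nb_phase_def phase_cells_def)

text \<open>Conduction is monotone in the differences to the neighbours. Comparison with the zero
  vector for D = 0 gives its sign at extreme cells; general D serves the one-sided estimate.\<close>

lemma conduction_mono:
  assumes "\<And>j. j \<in> cells P \<Longrightarrow> u j - u i \<le> w j - w i + D"
  shows "conduction i u \<le> conduction i w + conductance i * D"
proof -
  have "(\<Sum>m\<in>{Solid, Gas}. kappa P m *
     (\<Sum>j\<in>nb_phase P m i. (u j - u i) / norm (node P i - node P j)
        * lambda2 (frontier (subcell P m i) \<inter> frontier (subcell P m j))))
    \<le> (\<Sum>m\<in>{Solid, Gas}. kappa P m *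
     (\<Sum>j\<in>nb_phase P m i. (w j - w i + D) / norm (node P i - node P j)
        * lambda2 (frontier (subcell P m i) \<inter> frontier (subcell P m j))))"
    using assms nb_phase_subset kappa_nonneg
    by (intro sum_mono mult_left_mono mult_right_mono divide_right_mono) auto
  also have "\<dots> = conduction i w + conductance i * D"
    by (simp add: conduction_def conductance_def add_divide_distrib distrib_right sum.distrib
        distrib_left sum_distrib_right sum_distrib_left mult_ac)
  finally show ?thesis by (simp add: conduction_def)
qed

lemma conductance_nonneg: "0 \<le> conductance i"
  unfolding conductance_def using kappa_nonneg by (intro sum_nonneg mult_nonneg_nonneg) auto

lemma conduction_zero: "conduction i (\<lambda>_. 0) = 0"
  by (simp add: conduction_def)

lemma conduction_le_0: "(\<And>j. j \<in> cells P \<Longrightarrow> w j \<le> w i) \<Longrightarrow> conduction i w \<le> 0"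
  using conduction_mono[of w i "\<lambda>_. 0" 0] by (simp add: conduction_zero)

lemma conduction_ge_0: "(\<And>j. j \<in> cells P \<Longrightarrow> w i \<le> w j) \<Longrightarrow> 0 \<le> conduction i w"
  using conduction_mono[of "\<lambda>_. 0" i w 0] by (simp add: conduction_zero)

lemma J_domain_D: "i \<in> cells P \<Longrightarrow> \<alpha> \<in> J_domain P i \<Longrightarrow> \<alpha> \<in> elems_domain P \<and> cell_of P \<alpha> = i"
  using J_domain_eq by blast

lemma J_interface_D: "i \<in> cells P \<Longrightarrow> \<alpha> \<in> J_interface P i \<Longrightarrow> \<alpha> \<in> elems_interface P \<and> cell_of P \<alpha> = i"
  using J_interface_eq by blast

text \<open>Here the equality of the areas enters: the sum over the elements of the cell turns into
  emission at temperature K over the very area that \<open>radiation\<close> uses for the emitted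
  heat.\<close>

lemma irradiation_le:
  assumes i: "i \<in> cells P" and w: "\<And>j. j \<in> cells P \<Longrightarrow> 0 \<le> w j \<and> w j \<le> K" and K: "theta_ext P \<le> K"
  shows "irradiation_Gamma i w \<le> boltzmann P * emissivity P (w i) * K ^ 4 * area_Gamma i"
    and "irradiation_interface i w \<le> boltzmann P * emissivity P (w i) * K ^ 4 * area_interface i"
proof -
  let ?u = "w \<circ> cell_of P"
  have u: "?u \<alpha> ^ 4 \<le> K ^ 4" "0 < (emissivity P \<circ> ?u) \<alpha> \<and> (emissivity P \<circ> ?u) \<alpha> \<le> 1"
    if "\<alpha> \<in> elems_domain P \<union> elems_interface P" for \<alpha>
    using w[OF cell_of_in[OF that]] emissivity_range by (auto intro: power_mono)
  have \<theta>: "theta_ext P ^ 4 \<le> K ^ 4" using K theta_ext_pos by (intro power_mono) auto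
  have \<sigma>: "0 \<le> boltzmann P" using boltzmann_pos by simp
  show "irradiation_Gamma i w \<le> boltzmann P * emissivity P (w i) * K ^ 4 * area_Gamma i"
    unfolding irradiation_Gamma_def V_Gamma_eq area_Gamma_def J_domain_area[OF i, symmetric]
    by (intro Gam.V_sum_bounds(1) u \<sigma> \<theta>) (use J_domain_D[OF i] in auto)
  show "irradiation_interface i w \<le> boltzmann P * emissivity P (w i) * K ^ 4 * area_interface i"
    unfolding irradiation_interface_def V_interface_eq area_interface_def J_interface_area[OF i, symmetric]
    by (intro Int.V_sum_bounds(1) u \<sigma> \<theta>) (use J_interface_D[OF i] in auto)
qed

lemma irradiation_ge:
  assumes i: "i \<in> cells P" and w: "\<And>j. j \<in> cells P \<Longrightarrow> K \<le> w j" and K: "0 \<le> K" "K \<le> theta_ext P"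
  shows "boltzmann P * emissivity P (w i) * K ^ 4 * area_Gamma i \<le> irradiation_Gamma i w"
    and "boltzmann P * emissivity P (w i) * K ^ 4 * area_interface i \<le> irradiation_interface i w"
proof -
  let ?u = "w \<circ> cell_of P"
  have u: "K ^ 4 \<le> ?u \<alpha> ^ 4" "0 < (emissivity P \<circ> ?u) \<alpha> \<and> (emissivity P \<circ> ?u) \<alpha> \<le> 1"
    if "\<alpha> \<in> elems_domain P \<union> elems_interface P" for \<alpha>
    using w[OF cell_of_in[OF that]] emissivity_range[of "?u \<alpha>"] K(1) by (auto intro: power_mono)
  have \<theta>: "K ^ 4 \<le> theta_ext P ^ 4" using K by (intro power_mono) auto
  have \<sigma>: "0 \<le> boltzmann P" using boltzmann_pos by simp
  show "boltzmann P * emissivity P (w i) * K ^ 4 * area_Gamma i \<le> irradiation_Gamma i w"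
    unfolding irradiation_Gamma_def V_Gamma_eq area_Gamma_def J_domain_area[OF i, symmetric]
    by (intro Gam.V_sum_bounds(2) u \<sigma> \<theta>) (use J_domain_D[OF i] in auto)
  show "boltzmann P * emissivity P (w i) * K ^ 4 * area_interface i \<le> irradiation_interface i w"
    unfolding irradiation_interface_def V_interface_eq area_interface_def J_interface_area[OF i, symmetric]
    by (intro Int.V_sum_bounds(2) u \<sigma> \<theta>) (use J_interface_D[OF i] in auto)
qed

lemma emissivity_continuous: "continuous_on {0..r} (emissivity P)"
proof (cases "r > 0")
  case True
  have "(lip_const (emissivity P) r)-lipschitz_on {0..r} (emissivity P)"
    using True emissivity_lipschitz[of r]
    by (intro lipschitz_onI) (auto simp: dist_real_def intro!: lip_const_le lip_const_nonneg)
  then show ?thesis by (rule lipschitz_on_continuous_on)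
next
  case False
  then have "{0..r} = {} \<or> {0..r} = {0}" by auto
  then show ?thesis by auto
qed

text \<open>By continuity the infimum over the compact interval is attained, hence positive.\<close>

lemma min_upto_bounds:
  assumes "0 \<le> r"
  shows "0 < min_upto (emissivity P) r" "min_upto (emissivity P) r \<le> 1"
    "\<And>x. x \<in> {0..r} \<Longrightarrow> min_upto (emissivity P) r \<le> emissivity P x"
proof -
  obtain x0 where x0: "x0 \<in> {0..r}" "\<And>x. x \<in> {0..r} \<Longrightarrow> emissivity P x0 \<le> emissivity P x"
    using continuous_attains_inf[OF _ _ emissivity_continuous[of r]] assms by auto
  have "min_upto (emissivity P) r = emissivity P x0"
    unfolding min_upto_def using x0 by (intro cInf_eq_minimum) auto
  then show "0 < min_upto (emissivity P) r" "min_upto (emissivity P) r \<le> 1"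
    "\<And>x. x \<in> {0..r} \<Longrightarrow> min_upto (emissivity P) r \<le> emissivity P x"
    using x0 emissivity_range[of x0] by auto
qed

lemma irradiation_lipschitz:
  assumes i: "i \<in> cells P" and r: "0 < r" and D: "0 \<le> D"
    and uw: "\<And>j. j \<in> cells P \<Longrightarrow> u j \<in> {0..r} \<and> w j \<in> {0..r} \<and> \<bar>u j - w j\<bar> \<le> D"
  shows "\<bar>irradiation_Gamma i u - irradiation_Gamma i w\<bar> \<le> boltzmann P * area_Gamma i * l_g2 P r * D"
    and "\<bar>irradiation_interface i u - irradiation_interface i w\<bar>
      \<le> boltzmann P * area_interface i * l_g2 P r * D"
proof -
  have \<sigma>: "0 \<le> boltzmann P" using boltzmann_pos by simp
  have bdd: "bdd_above (lipschitz_quotients (emissivity P) r)" using emissivity_lipschitz r by simp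
  note Lip = lip_const_nonneg[OF bdd r]
  note em = min_upto_bounds[of r]
  have h: "min_upto (emissivity P) r \<le> emissivity P x \<and> emissivity P x \<le> 1" if "x \<in> {0..r}" for x
    using em(3)[OF _ that] emissivity_range[of x] that r by auto
  have \<theta>: "0 \<le> theta_ext P ^ 4" by simp
  have uw': "(u \<circ> cell_of P) \<beta> \<in> {0..r} \<and> (w \<circ> cell_of P) \<beta> \<in> {0..r} \<and> \<bar>(u \<circ> cell_of P) \<beta> - (w \<circ> cell_of P) \<beta>\<bar> \<le> D"
    if "\<beta> \<in> elems_domain P \<union> elems_interface P" for \<beta>
    using uw[OF cell_of_in[OF that]] by simp
  have lg2: "l_g2 P r = 4 * inverse (min_upto (emissivity P) r) * r ^ 3 + max (r ^ 4) (theta_ext P ^ 4)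
      * lip_const (emissivity P) r * (2 * inverse (min_upto (emissivity P) r) + 1)"
    by (simp add: l_g2_def)
  have VG: "\<bar>V_Gamma P (u \<circ> cell_of P) \<alpha> - V_Gamma P (w \<circ> cell_of P) \<alpha>\<bar>
      \<le> boltzmann P * lambda2 (elem P \<alpha>) * l_g2 P r * D" if "\<alpha> \<in> J_domain P i" for \<alpha>
    unfolding V_Gamma_eq lg2
    using that J_domain_D[OF i] uw' r em(1,2) h lip_const_le[OF bdd] Lip D \<sigma> \<theta>
    by (intro Gam.V_lipschitz) auto
  have VI: "\<bar>V_interface P (u \<circ> cell_of P) \<alpha> - V_interface P (w \<circ> cell_of P) \<alpha>\<bar>
      \<le> boltzmann P * lambda2 (elem P \<alpha>) * l_g2 P r * D" if "\<alpha> \<in> J_interface P i" for \<alpha>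
    unfolding V_interface_eq lg2
    using that J_interface_D[OF i] uw' r em(1,2) h lip_const_le[OF bdd] Lip D \<sigma> \<theta>
    by (intro Int.V_lipschitz) auto
  have "\<bar>irradiation_Gamma i u - irradiation_Gamma i w\<bar>
      \<le> (\<Sum>\<alpha>\<in>J_domain P i. boltzmann P * lambda2 (elem P \<alpha>) * l_g2 P r * D)"
    unfolding irradiation_Gamma_def sum_subtractf[symmetric] using VG
    by (intro order_trans[OF sum_abs] sum_mono)
  also have "\<dots> = boltzmann P * area_Gamma i * l_g2 P r * D"
    unfolding area_Gamma_def J_domain_area[OF i, symmetric] by (simp add: sum_distrib_left sum_distrib_right)
  finally show "\<bar>irradiation_Gamma i u - irradiation_Gamma i w\<bar> \<le> boltzmann P * area_Gamma i * l_g2 P r * D" .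
  have "\<bar>irradiation_interface i u - irradiation_interface i w\<bar>
      \<le> (\<Sum>\<alpha>\<in>J_interface P i. boltzmann P * lambda2 (elem P \<alpha>) * l_g2 P r * D)"
    unfolding irradiation_interface_def sum_subtractf[symmetric] using VI
    by (intro order_trans[OF sum_abs] sum_mono)
  also have "\<dots> = boltzmann P * area_interface i * l_g2 P r * D"
    unfolding area_interface_def J_interface_area[OF i, symmetric]
    by (simp add: sum_distrib_left sum_distrib_right)
  finally show "\<bar>irradiation_interface i u - irradiation_interface i w\<bar>
      \<le> boltzmann P * area_interface i * l_g2 P r * D" .
qed

text \<open>Taking K = w i in \<open>irradiation_le\<close> bounds the absorbed heat by the emission
  of the cell itself.\<close>

lemma radiation_ge_0:
  assumes i: "i \<in> cells P" and w: "\<And>j. j \<in> cells P \<Longrightarrow> 0 \<le> w j \<and> w j \<le> w i" and "theta_ext P \<le> w i"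
  shows "0 \<le> radiation i w"
proof -
  have "theta_ext P ^ 4 \<le> w i ^ 4" using assms(3) theta_ext_pos by (intro power_mono) auto
  then have "0 \<le> boltzmann P * emissivity P (w i) * (w i ^ 4 - theta_ext P ^ 4) * area_frontier i"
    using boltzmann_pos emissivity_range[of "w i"] w[OF i] areas_nonneg by (intro mult_nonneg_nonneg) auto
  then show ?thesis using irradiation_le[of i w "w i", OF i w assms(3)] by (simp add: radiation_def)
qed

lemma radiation_le_0:
  assumes i: "i \<in> cells P" and w: "\<And>j. j \<in> cells P \<Longrightarrow> w i \<le> w j" and "0 \<le> w i" "w i \<le> theta_ext P"
  shows "radiation i w \<le> 0"
proof -
  have "w i ^ 4 \<le> theta_ext P ^ 4" using assms(3,4) by (intro power_mono) auto
  then have "0 \<le> boltzmann P * emissivity P (w i) * (theta_ext P ^ 4 - w i ^ 4) * area_frontier i"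
    using boltzmann_pos emissivity_range[of "w i"] assms(3) areas_nonneg by (intro mult_nonneg_nonneg) auto
  then have "boltzmann P * emissivity P (w i) * (w i ^ 4 - theta_ext P ^ 4) * area_frontier i \<le> 0"
    by (simp add: algebra_simps)
  then show ?thesis using irradiation_ge[of i "w i" w, OF i w assms(3,4)] by (simp add: radiation_def)
qed

lemma l_g_nonneg:
  assumes r: "0 < r"
  shows "0 \<le> l_g1 P r" "0 \<le> l_g2 P r" "0 \<le> l_g3 P r"
proof -
  have bdd: "bdd_above (lipschitz_quotients (emissivity P) r)" using emissivity_lipschitz r by simp
  note Lip = lip_const_nonneg[OF bdd r] and em = min_upto_bounds(1)[OF less_imp_le[OF r]]
  show "0 \<le> l_g1 P r" "0 \<le> l_g3 P r"
    using neg_variation_nonneg[OF bdd r] Lip r by (simp_all add: l_g1_def l_g3_def)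
  have "0 \<le> max (r ^ 4) (theta_ext P ^ 4)" by (simp add: le_max_iff_disj)
  then show "0 \<le> l_g2 P r"
    unfolding l_g2_def using Lip em r by (intro add_nonneg_nonneg mult_nonneg_nonneg) auto
qed

text \<open>The emission difference is split as e(x) (x^4 - y^4) + (e(x) - e(y)) y^4. The first part
  has the right sign, so only the change of the emissivity enters the factor of u i - w i. The
  irradiation depends on all cells and is therefore estimated by D.\<close>

lemma radiation_one_sided:
  assumes i: "i \<in> cells P" and r: "0 < r"
    and uw: "\<And>j. j \<in> cells P \<Longrightarrow> u j \<in> {0..r} \<and> w j \<in> {0..r} \<and> \<bar>u j - w j\<bar> \<le> D" and le: "w i \<le> u i"
  shows "- (boltzmann P * (area_Gamma i + area_frontier i + area_interface i) * l_g1 P r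
        + boltzmann P * area_frontier i * l_g3 P r) * (u i - w i)
      - boltzmann P * (area_Gamma i + area_interface i) * l_g2 P r * D
    \<le> radiation i u - radiation i w"
proof -
  let ?x = "u i" and ?y = "w i" and ?e = "emissivity P" and ?\<sigma> = "boltzmann P" and ?\<theta> = "theta_ext P ^ 4"
  let ?L = "lip_const (emissivity P) r" and ?S = "area_Gamma i + area_frontier i + area_interface i"
  have D: "0 \<le> D" using uw[OF i] by linarith
  have bdd: "bdd_above (lipschitz_quotients ?e r)" using emissivity_lipschitz r by simp
  have xy: "?x \<in> {0..r}" "?y \<in> {0..r}" using uw[OF i] by auto
  have e: "\<bar>?e ?x - ?e ?y\<bar> \<le> ?L * (?x - ?y)" using lip_const_le[OF bdd xy] le by simp
  have S0: "0 \<le> ?\<sigma> * ?S" "0 \<le> ?\<sigma> * area_frontier i" using boltzmann_pos areas_nonneg by simp_all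
  \<comment> \<open>The variation part of \<open>l_g1\<close> is nonnegative, so \<open>l_g1\<close>
    dominates its Lipschitz part.\<close>
  have "?L * r ^ 4 \<le> l_g1 P r"
    using neg_variation_nonneg[OF bdd r] r by (simp add: l_g1_def)
  then have g1: "?L * r ^ 4 * (?x - ?y) \<le> l_g1 P r * (?x - ?y)" using le by (intro mult_right_mono) auto
  have "- (?L * (?x - ?y) * r ^ 4) \<le> ?e ?x * ?x ^ 4 - ?e ?y * ?y ^ 4"
  proof -
    have "0 \<le> ?e ?x * (?x ^ 4 - ?y ^ 4)"
      using emissivity_range[of ?x] xy le by (intro mult_nonneg_nonneg) (auto intro: power_mono)
    moreover have "\<bar>(?e ?x - ?e ?y) * ?y ^ 4\<bar> \<le> ?L * (?x - ?y) * r ^ 4"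
      unfolding abs_mult using e xy by (intro mult_mono) (auto intro: power_mono)
    ultimately show ?thesis by (simp add: algebra_simps abs_le_iff)
  qed
  then have "- (l_g1 P r * (?x - ?y)) \<le> ?e ?x * ?x ^ 4 - ?e ?y * ?y ^ 4" using g1 by (simp add: mult_ac)
  from mult_left_mono[OF this S0(1)]
  have 1: "- (?\<sigma> * ?S * (l_g1 P r * (?x - ?y))) \<le> ?\<sigma> * ?S * (?e ?x * ?x ^ 4 - ?e ?y * ?y ^ 4)" by simp
  have "?e ?x - ?e ?y \<le> ?L * (?x - ?y)" using e by linarith
  then have "(?e ?x - ?e ?y) * ?\<theta> \<le> ?L * (?x - ?y) * ?\<theta>" by (intro mult_right_mono) auto
  then have "(?e ?x - ?e ?y) * ?\<theta> \<le> l_g3 P r * (?x - ?y)" by (simp add: l_g3_def mult_ac)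
  from mult_left_mono[OF this S0(2)]
  have 2: "?\<sigma> * area_frontier i * ((?e ?x - ?e ?y) * ?\<theta>) \<le> ?\<sigma> * area_frontier i * (l_g3 P r * (?x - ?y))" .
  have rad: "radiation i u - radiation i w = ?\<sigma> * ?S * (?e ?x * ?x ^ 4 - ?e ?y * ?y ^ 4)
      - ?\<sigma> * area_frontier i * ((?e ?x - ?e ?y) * ?\<theta>)
      - (irradiation_Gamma i u - irradiation_Gamma i w) - (irradiation_interface i u - irradiation_interface i w)"
    by (simp add: radiation_def algebra_simps)
  have g2: "?\<sigma> * (area_Gamma i + area_interface i) * l_g2 P r * D
      = ?\<sigma> * area_Gamma i * l_g2 P r * D + ?\<sigma> * area_interface i * l_g2 P r * D"
    by (simp add: algebra_simps)
  have g13: "- (?\<sigma> * ?S * l_g1 P r + ?\<sigma> * area_frontier i * l_g3 P r) * (?x - ?y)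
      = - (?\<sigma> * ?S * (l_g1 P r * (?x - ?y))) - ?\<sigma> * area_frontier i * (l_g3 P r * (?x - ?y))"
    by (simp add: algebra_simps)
  have arith: "- a - b - (c + d) \<le> a' - b' - c' - d'" if "- a \<le> a'" "b' \<le> b" "\<bar>c'\<bar> \<le> c" "\<bar>d'\<bar> \<le> d"
    for a b c d a' b' c' d' :: real using that by linarith
  show ?thesis
    unfolding rad g2 g13 by (rule arith[OF 1 2 irradiation_lipschitz[of i r D u w, OF i r D uw]])
qed

lemma sources_bounds:
  assumes "i \<in> cells P" "\<nu> \<in> {1..num_steps P}"
  shows "0 \<le> sources \<nu> i" "sources \<nu> i \<le> B_source P \<nu> * lambda3 (cell P i)"
proof -
  have "0 \<le> source_approx P m \<nu> i * lambda3 (subcell P m i)" for m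
  proof (cases "i \<in> phase_cells P m")
    case True
    have "0 \<le> ereal (source_approx P m \<nu> i)"
      using source_approx_bounds[OF assms(2) True] order_trans by blast
    then show ?thesis by simp
  next
    case False
    \<comment> \<open>The bounds on the approximate sources concern only phases present in the cell;
      an absent phase has volume 0.\<close>
    then have "subcell P m i = {}" using assms(1) by (simp add: phase_cells_def)
    then show ?thesis by simp
  qed
  then show "0 \<le> sources \<nu> i" unfolding sources_def by (intro sum_nonneg)
  have "sources \<nu> i / lambda3 (cell P i) \<le> B_source P \<nu>"
    unfolding B_source_def sources_def using assms(1) finite_cells by (intro Max_ge) auto
  then show "sources \<nu> i \<le> B_source P \<nu> * lambda3 (cell P i)"
    using cell_volume_pos[OF assms(1)] by (simp add: pos_divide_le_eq)
qed

lemma B_source_nonneg: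
  assumes "\<nu> \<in> {1..num_steps P}"
  shows "0 \<le> B_source P \<nu>"
proof -
  obtain i where i: "i \<in> cells P" using cells_nonempty by blast
  have "0 \<le> B_source P \<nu> * lambda3 (cell P i)" using sources_bounds[OF i assms] by linarith
  then show ?thesis using cell_volume_pos[OF i] by (simp add: zero_le_mult_iff)
qed

lemma step_pos: "\<nu> \<in> {1..num_steps P} \<Longrightarrow> 0 < step P \<nu>"
  using time_nodes(3)[of "\<nu> - 1"] by (cases \<nu>) (auto simp: step_def)

lemma area_le_L:
  assumes "i \<in> cells P"
  shows "boltzmann P * area_Gamma i \<le> L_Gamma P * lambda3 (cell P i)"
    "boltzmann P * area_frontier i \<le> L_frontier P * lambda3 (cell P i)"
    "boltzmann P * area_interface i \<le> L_interface P * lambda3 (cell P i)"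
proof -
  have *: "boltzmann P * a i \<le> boltzmann P * Max ((\<lambda>i. a i / lambda3 (cell P i)) ` cells P) * lambda3 (cell P i)"
    for a :: "'i \<Rightarrow> real"
  proof -
    have "a i / lambda3 (cell P i) \<le> Max ((\<lambda>i. a i / lambda3 (cell P i)) ` cells P)"
      using assms finite_cells by (intro Max_ge) auto
    then have "a i \<le> Max ((\<lambda>i. a i / lambda3 (cell P i)) ` cells P) * lambda3 (cell P i)"
      using cell_volume_pos[OF assms] by (simp add: pos_divide_le_eq)
    then show ?thesis using boltzmann_pos by (simp add: mult.assoc)
  qed
  show "boltzmann P * area_Gamma i \<le> L_Gamma P * lambda3 (cell P i)"
    using *[of area_Gamma] by (simp add: L_Gamma_def area_Gamma_def)
  show "boltzmann P * area_frontier i \<le> L_frontier P * lambda3 (cell P i)"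
    using *[of area_frontier] by (simp add: L_frontier_def area_frontier_def)
  show "boltzmann P * area_interface i \<le> L_interface P * lambda3 (cell P i)"
    using *[of area_interface] by (simp add: L_interface_def area_interface_def)
qed

section \<open>Extreme cells, one-sided estimate and continuity of the scheme\<close>

text \<open>Serves twice: for a solution it excludes a maximum above the bound, and on the upper
  face of the box it gives the sign for the intermediate value theorem.\<close>

lemma scheme_at_max:
  assumes i: "i \<in> cells P" and \<nu>: "\<nu> \<in> {1..num_steps P}"
    and w: "\<And>j. j \<in> cells P \<Longrightarrow> 0 \<le> w j \<and> w j \<le> w i" and "theta_ext P \<le> w i" "0 \<le> v i" "v i \<le> w i"
  shows "lambda3 (cell P i) * (inverse (step P \<nu>) * C_energy P * (w i - v i) - B_source P \<nu>) \<le> scheme P \<nu> i v w"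
proof -
  have "inverse (step P \<nu>) * ((w i - v i) * C_energy P * lambda3 (cell P i))
      \<le> inverse (step P \<nu>) * energy_gain i (w i) (v i)"
    using energy_gain_ge[OF i assms(5,6)] step_pos[OF \<nu>] by (intro mult_left_mono) auto
  moreover have "conduction i w \<le> 0" using w by (intro conduction_le_0) auto
  moreover have "0 \<le> radiation i w" by (rule radiation_ge_0[of i w, OF i w assms(4)])
  moreover have "lambda3 (cell P i) * (inverse (step P \<nu>) * C_energy P * (w i - v i) - B_source P \<nu>)
      = inverse (step P \<nu>) * ((w i - v i) * C_energy P * lambda3 (cell P i)) - B_source P \<nu> * lambda3 (cell P i)"
    by (simp add: algebra_simps)
  ultimately show ?thesis
    using sources_bounds(2)[OF i \<nu>] unfolding scheme_split by linarith
qed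

text \<open>The sources are nonnegative and enter with a minus sign, which is why the lower bound
  contains no source term.\<close>

lemma scheme_at_min:
  assumes i: "i \<in> cells P" and \<nu>: "\<nu> \<in> {1..num_steps P}"
    and w: "\<And>j. j \<in> cells P \<Longrightarrow> w i \<le> w j" and "0 \<le> w i" "w i \<le> theta_ext P" "w i \<le> v i"
  shows "scheme P \<nu> i v w \<le> - (lambda3 (cell P i) * (inverse (step P \<nu>) * C_energy P * (v i - w i)))"
proof -
  have "inverse (step P \<nu>) * ((v i - w i) * C_energy P * lambda3 (cell P i))
      \<le> inverse (step P \<nu>) * energy_gain i (v i) (w i)"
    using energy_gain_ge[OF i assms(4,6)] step_pos[OF \<nu>] by (intro mult_left_mono) auto
  moreover have "0 \<le> conduction i w" using w by (intro conduction_ge_0) auto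
  moreover have "radiation i w \<le> 0" by (rule radiation_le_0[of i w, OF i w assms(4,5)])
  moreover have "inverse (step P \<nu>) * energy_gain i (w i) (v i) = - (inverse (step P \<nu>) * energy_gain i (v i) (w i))"
    by (simp add: energy_gain_swap[of i "w i" "v i"])
  moreover have "lambda3 (cell P i) * (inverse (step P \<nu>) * C_energy P * (v i - w i))
      = inverse (step P \<nu>) * ((v i - w i) * C_energy P * lambda3 (cell P i))"
    by (simp add: mult_ac)
  ultimately show ?thesis
    using sources_bounds(1)[OF i \<nu>] unfolding scheme_split by linarith
qed

text \<open>All distances are at most D, so conduction grows by at most \<open>conductance i\<close>
  times D - (u i - w i). This coefficient therefore stands before both u i - w i and D, and cancels
  when the first factor is required to exceed the second.\<close>

lemma scheme_one_sided:
  assumes i: "i \<in> cells P" and \<nu>: "\<nu> \<in> {1..num_steps P}" and r: "0 < r"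
    and uw: "\<And>j. j \<in> cells P \<Longrightarrow> u j \<in> {0..r} \<and> w j \<in> {0..r} \<and> \<bar>u j - w j\<bar> \<le> D" and le: "w i \<le> u i"
  shows "(inverse (step P \<nu>) * C_energy P * lambda3 (cell P i) + conductance i
        - (boltzmann P * (area_Gamma i + area_frontier i + area_interface i) * l_g1 P r
           + boltzmann P * area_frontier i * l_g3 P r)) * (u i - w i)
      - (conductance i + boltzmann P * (area_Gamma i + area_interface i) * l_g2 P r) * D
    \<le> scheme P \<nu> i v u - scheme P \<nu> i v w"
proof -
  have "0 \<le> w i" using uw[OF i] by auto
  then have "inverse (step P \<nu>) * ((u i - w i) * C_energy P * lambda3 (cell P i))
      \<le> inverse (step P \<nu>) * energy_gain i (u i) (w i)"
    using energy_gain_ge[OF i _ le] step_pos[OF \<nu>] by (intro mult_left_mono) auto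
  also have "\<dots> = inverse (step P \<nu>) * energy_gain i (u i) (v i) - inverse (step P \<nu>) * energy_gain i (w i) (v i)"
    by (simp add: energy_gain_def algebra_simps)
  finally have 1: "inverse (step P \<nu>) * ((u i - w i) * C_energy P * lambda3 (cell P i))
      \<le> inverse (step P \<nu>) * energy_gain i (u i) (v i) - inverse (step P \<nu>) * energy_gain i (w i) (v i)" .
  have 2: "conduction i u \<le> conduction i w + conductance i * (D - (u i - w i))"
  proof (rule conduction_mono)
    fix j assume "j \<in> cells P"
    then show "u j - u i \<le> w j - w i + (D - (u i - w i))" using uw[of j] by linarith
  qed
  let ?A = "inverse (step P \<nu>) * C_energy P * lambda3 (cell P i)"
  have arith: "(A + K - L) * d - (K + M) * D \<le> (e1 - c1 + r1 - s) - (e2 - c2 + r2 - s)"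
    if "A * d \<le> e1 - e2" "c1 \<le> c2 + K * (D - d)" "- L * d - M * D \<le> r1 - r2"
    for A K L M d e1 e2 c1 c2 r1 r2 s :: real
    using that by (simp add: algebra_simps)
  have "?A * (u i - w i) = inverse (step P \<nu>) * ((u i - w i) * C_energy P * lambda3 (cell P i))"
    by (simp add: mult_ac)
  with 1 have 3: "?A * (u i - w i)
      \<le> inverse (step P \<nu>) * energy_gain i (u i) (v i) - inverse (step P \<nu>) * energy_gain i (w i) (v i)"
    by (rule ord_eq_le_trans[rotated])
  show ?thesis
    unfolding scheme_split by (rule arith[OF 3 2 radiation_one_sided[of i r u w D, OF i r uw le]])
qed

text \<open>The irradiation contains a matrix inverse; its continuity is read off from the Lipschitz
  estimate, since updating one coordinate moves the vector by at most |x - y|.\<close>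

lemma scheme_continuous:
  assumes i: "i \<in> cells P" and r: "0 < r" and w: "\<And>j. j \<in> cells P \<Longrightarrow> w j \<in> {0..r}"
  shows "continuous_on {0..r} (\<lambda>x. scheme P \<nu> i v (w(i := x)))"
proof -
  have en: "continuous_on {0..r} (energy P m)" for m
    by (rule continuous_on_subset[OF energy_continuous]) auto
  have upd: "(w(i := x)) j \<in> {0..r} \<and> (w(i := y)) j \<in> {0..r} \<and> \<bar>(w(i := x)) j - (w(i := y)) j\<bar> \<le> \<bar>x - y\<bar>"
    if "x \<in> {0..r}" "y \<in> {0..r}" "j \<in> cells P" for x y j
    using that w by auto
  note l2 = l_g_nonneg(2)[OF r]
  have \<sigma>: "0 \<le> boltzmann P" using boltzmann_pos by simp
  have "(boltzmann P * area_Gamma i * l_g2 P r)-lipschitz_on {0..r} (\<lambda>x. irradiation_Gamma i (w(i := x)))"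
  proof (rule lipschitz_onI)
    fix x y assume "x \<in> {0..r}" "y \<in> {0..r}"
    then show "dist (irradiation_Gamma i (w(i := x))) (irradiation_Gamma i (w(i := y)))
        \<le> boltzmann P * area_Gamma i * l_g2 P r * dist x y"
      unfolding dist_real_def using upd
      by (intro irradiation_lipschitz(1)[OF i r]) simp_all
  qed (use l2 areas_nonneg \<sigma> in simp)
  moreover have "(boltzmann P * area_interface i * l_g2 P r)-lipschitz_on {0..r}
      (\<lambda>x. irradiation_interface i (w(i := x)))"
  proof (rule lipschitz_onI)
    fix x y assume "x \<in> {0..r}" "y \<in> {0..r}"
    then show "dist (irradiation_interface i (w(i := x))) (irradiation_interface i (w(i := y)))
        \<le> boltzmann P * area_interface i * l_g2 P r * dist x y"
      unfolding dist_real_def using upd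
      by (intro irradiation_lipschitz(2)[OF i r]) simp_all
  qed (use l2 areas_nonneg \<sigma> in simp)
  ultimately have irr: "continuous_on {0..r} (\<lambda>x. irradiation_Gamma i (w(i := x)))"
    "continuous_on {0..r} (\<lambda>x. irradiation_interface i (w(i := x)))"
    by (auto intro: lipschitz_on_continuous_on)
  \<comment> \<open>A cell is not its own neighbour, so the update changes only the subtracted
    value.\<close>
  have "conduction i (w(i := x)) = (\<Sum>m\<in>{Solid, Gas}. kappa P m *
     (\<Sum>j\<in>nb_phase P m i. (w j - x) / norm (node P i - node P j)
        * lambda2 (frontier (subcell P m i) \<inter> frontier (subcell P m j))))" for x
    unfolding conduction_def by (intro sum.cong arg_cong2[where f = "(*)"] refl) (auto simp: nb_phase_def)
  then have cond: "continuous_on {0..r} (\<lambda>x. conduction i (w(i := x)))"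
    by (simp only: divide_inverse) (intro continuous_intros)
  show ?thesis
    unfolding scheme_split energy_gain_def radiation_def fun_upd_same
    by (intro continuous_intros cond irr en emissivity_continuous)
qed

end

section \<open>Bounds and unique solvability of one time step\<close>

theorem corollary1:
  fixes P :: "('i, 'a) fv_problem"
    and n :: nat
    and u :: "nat \<Rightarrow> 'i \<Rightarrow> real"
  assumes "fv_setting P"
    and "n \<in> {1..num_steps P}"
    and "nonneg_solution_upto P (n - 1) u"
  shows "(\<forall>w\<in>nonneg_vectors P. (\<forall>i\<in>cells P. scheme P n i (u (n - 1)) w = 0) \<longrightarrow>
            w \<in> cells P \<rightarrow>\<^sub>E {lower_bound P (u (n - 1))..upper_bound P n (u (n - 1))})
    \<and> (let M = upper_bound P n (u (n - 1)) in
         step P n * ((L_Gamma P + L_frontier P + L_interface P) * l_g1 P M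
           + (L_Gamma P + L_interface P) * l_g2 P M + L_frontier P * l_g3 P M) < C_energy P
         \<longrightarrow> (\<exists>!w. w \<in> nonneg_vectors P \<and> (\<forall>i\<in>cells P. scheme P n i (u (n - 1)) w = 0)))"
proof -
  interpret fv_setting P by (rule assms(1))
  define v where "v = u (n - 1)"
  define lo where "lo = lower_bound P v"
  define hi where "hi = upper_bound P n v"
  note k = step_pos[OF assms(2)]
  note C = C_energy_pos
  have v: "0 \<le> v j" if "j \<in> cells P" for j
    using assms(3) that by (auto simp: nonneg_solution_upto_def nonneg_vectors_def v_def PiE_iff)
  have vmin: "Min (v ` cells P) \<le> v j" "v j \<le> Max (v ` cells P)" if "j \<in> cells P" for j
    using finite_cells that by auto
  have "0 \<le> Min (v ` cells P)" using v finite_cells cells_nonempty by (subst Min_ge_iff) auto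
  then have lo0: "0 \<le> lo" using theta_ext_pos by (simp add: lo_def lower_bound_def)
  have lo: "lo \<le> theta_ext P" "\<And>j. j \<in> cells P \<Longrightarrow> lo \<le> v j"
    using vmin(1) by (auto simp: lo_def lower_bound_def min_le_iff_disj)
  have B: "0 \<le> step P n / C_energy P * B_source P n" using B_source_nonneg[OF assms(2)] k C by simp
  have hi\<theta>: "theta_ext P \<le> hi" by (simp add: hi_def upper_bound_def)
  have hi: "v j + step P n / C_energy P * B_source P n \<le> hi" if "j \<in> cells P" for j
    using vmin(2)[OF that] by (simp add: hi_def upper_bound_def le_max_iff_disj)
  have hi_v: "v j \<le> hi" if "j \<in> cells P" for j using hi[OF that] B by linarith
  have hi0: "0 < hi" using hi\<theta> theta_ext_pos by linarith
  \<comment> \<open>From \<open>hi\<close> on, the growth of the energy per time outweighs the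
    strongest source: this is the origin of the term
    \<open>step P n / C_energy P * B_source P n\<close> in the upper bound.\<close>
  have gain: "B_source P n \<le> inverse (step P n) * C_energy P * (x - v j)"
    if "j \<in> cells P" "hi \<le> x" for x j
  proof -
    have "step P n / C_energy P * B_source P n \<le> x - v j" using hi[OF that(1)] that(2) by linarith
    then show ?thesis using k C by (simp add: field_simps)
  qed
  have bounds: "w \<in> cells P \<rightarrow>\<^sub>E {lo..hi}"
    if w: "w \<in> nonneg_vectors P" "\<forall>i\<in>cells P. scheme P n i v w = 0" for w
  proof -
    have w0: "0 \<le> w j" if "j \<in> cells P" for j using w(1) that by (auto simp: nonneg_vectors_def PiE_iff)
    obtain i where i: "i \<in> cells P" "\<And>j. j \<in> cells P \<Longrightarrow> w j \<le> w i"
      using finite_argmax[OF finite_cells cells_nonempty, of w] by blast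
    have "w i \<le> hi"
    proof (rule ccontr)
      assume "\<not> ?thesis"
      then have gt: "hi < w i" by simp
      have "B_source P n \<le> inverse (step P n) * C_energy P * (hi - v i)" by (rule gain[OF i(1)]) simp
      also have "\<dots> < inverse (step P n) * C_energy P * (w i - v i)"
        using gt k C by (intro mult_strict_left_mono) auto
      finally have "0 < lambda3 (cell P i) * (inverse (step P n) * C_energy P * (w i - v i) - B_source P n)"
        using cell_volume_pos[OF i(1)] by simp
      also have "\<dots> \<le> scheme P n i v w"
        using i w0 v gt hi\<theta> hi_v[OF i(1)] by (intro scheme_at_max assms(2)) auto
      finally show False using w(2) i(1) by simp
    qed
    moreover obtain l where l: "l \<in> cells P" "\<And>j. j \<in> cells P \<Longrightarrow> w l \<le> w j"
      using finite_argmax[OF finite_cells cells_nonempty, of "\<lambda>j. - w j"] by auto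
    have "lo \<le> w l"
    proof (rule ccontr)
      assume "\<not> ?thesis"
      then have lt: "w l < lo" by simp
      have "scheme P n l v w \<le> - (lambda3 (cell P l) * (inverse (step P n) * C_energy P * (v l - w l)))"
        using l w0 lo(1) lo(2)[OF l(1)] lt by (intro scheme_at_min assms(2)) auto
      also have "\<dots> < 0" using cell_volume_pos[OF l(1)] k C lt lo(2)[OF l(1)] by simp
      finally show False using w(2) l(1) by simp
    qed
    ultimately show ?thesis
      using w(1) i(2) l(2) unfolding nonneg_vectors_def PiE_iff by (meson atLeastAtMost_iff order_trans)
  qed
  have unique: "\<exists>!w. w \<in> nonneg_vectors P \<and> (\<forall>i\<in>cells P. scheme P n i v w = 0)"
    if small: "step P n * ((L_Gamma P + L_frontier P + L_interface P) * l_g1 P hi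
           + (L_Gamma P + L_interface P) * l_g2 P hi + L_frontier P * l_g3 P hi) < C_energy P"
  proof -
    note l = l_g_nonneg[OF hi0]
    define L1 where "L1 i = boltzmann P * (area_Gamma i + area_frontier i + area_interface i) * l_g1 P hi
        + boltzmann P * area_frontier i * l_g3 P hi" for i
    define L2 where "L2 i = boltzmann P * (area_Gamma i + area_interface i) * l_g2 P hi" for i
    \<comment> \<open>The time step condition divided by the step and multiplied by the volume of
      the cell; the maxima in the L constants dominate the local ratios of area to volume.\<close>
    have L12: "L1 i + L2 i < inverse (step P n) * C_energy P * lambda3 (cell P i)" if i: "i \<in> cells P" for i
    proof -
      let ?V = "lambda3 (cell P i)"
      note a = area_le_L[OF i]
      have "boltzmann P * (area_Gamma i + area_frontier i + area_interface i)
          \<le> (L_Gamma P + L_frontier P + L_interface P) * ?V"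
        unfolding distrib_left distrib_right using a by linarith
      moreover have "boltzmann P * (area_Gamma i + area_interface i) \<le> (L_Gamma P + L_interface P) * ?V"
        unfolding distrib_left distrib_right using a by linarith
      ultimately have "L1 i + L2 i \<le> (L_Gamma P + L_frontier P + L_interface P) * ?V * l_g1 P hi
          + L_frontier P * ?V * l_g3 P hi + (L_Gamma P + L_interface P) * ?V * l_g2 P hi"
        unfolding L1_def L2_def using a l by (intro add_mono mult_right_mono)
      also have "\<dots> = ((L_Gamma P + L_frontier P + L_interface P) * l_g1 P hi
           + (L_Gamma P + L_interface P) * l_g2 P hi + L_frontier P * l_g3 P hi) * ?V"
        by (simp add: algebra_simps)
      also have "\<dots> < inverse (step P n) * C_energy P * ?V"
        using small k cell_volume_pos[OF i]
        by (intro mult_strict_right_mono) (simp_all add: inverse_eq_divide pos_less_divide_eq mult.commute)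
      finally show ?thesis .
    qed
    have box: "w j \<in> {0..hi}" if "w \<in> cells P \<rightarrow>\<^sub>E {lo..hi}" "j \<in> cells P" for w j
      using PiE_mem[OF that] lo0 by simp
    \<comment> \<open>The coefficient a collects energy growth and conductance minus the loss from
      the cell's own radiation; b bounds the influence of the distance D. After the conductance
      cancels, b < a is \<open>L12\<close>.\<close>
    have box_unique: "\<exists>!w. w \<in> cells P \<rightarrow>\<^sub>E {lo..hi} \<and> (\<forall>i\<in>cells P. scheme P n i v w = 0)"
    proof (rule one_sided_system_unique_solution[where
          a = "\<lambda>i. inverse (step P n) * C_energy P * lambda3 (cell P i) + conductance i - L1 i"
          and b = "\<lambda>i. conductance i + L2 i"])
      show "lo \<le> hi" using lo(1) hi\<theta> by linarith
      fix i assume i: "i \<in> cells P"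
      have "0 \<le> L2 i" using boltzmann_pos areas_nonneg l by (simp add: L2_def)
      then show "0 \<le> conductance i + L2 i \<and> conductance i + L2 i
          < inverse (step P n) * C_energy P * lambda3 (cell P i) + conductance i - L1 i"
        using L12[OF i] conductance_nonneg[of i] by simp
      fix w assume w: "w \<in> cells P \<rightarrow>\<^sub>E {lo..hi}"
      show "continuous_on {lo..hi} (\<lambda>x. scheme P n i v (w(i := x)))"
        using scheme_continuous[OF i hi0 box[OF w]] by (rule continuous_on_subset) (use lo0 in auto)
      show "0 \<le> scheme P n i v w" if "w i = hi"
      proof -
        have "0 \<le> lambda3 (cell P i) * (inverse (step P n) * C_energy P * (w i - v i) - B_source P n)"
          using gain[OF i, of "w i"] that by simp
        also have "\<dots> \<le> scheme P n i v w"
          using i box[OF w] v that hi\<theta> hi_v[OF i] by (intro scheme_at_max assms(2)) auto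
        finally show ?thesis .
      qed
      show "scheme P n i v w \<le> 0" if "w i = lo"
      proof -
        have "scheme P n i v w \<le> - (lambda3 (cell P i) * (inverse (step P n) * C_energy P * (v i - w i)))"
          using i w lo0 that lo(1) lo(2)[OF i] by (intro scheme_at_min assms(2)) (auto simp: PiE_iff)
        also have "\<dots> \<le> 0" using k C lo(2)[OF i] that by simp
        finally show ?thesis .
      qed
      fix z D
      assume "z \<in> cells P \<rightarrow>\<^sub>E {lo..hi}" "\<And>j. j \<in> cells P \<Longrightarrow> \<bar>w j - z j\<bar> \<le> D" "z i \<le> w i"
      then show "(inverse (step P n) * C_energy P * lambda3 (cell P i) + conductance i - L1 i) * (w i - z i)
          - (conductance i + L2 i) * D \<le> scheme P n i v w - scheme P n i v z"
        unfolding L1_def L2_def using box[OF w] box by (intro scheme_one_sided[OF i assms(2) hi0]) auto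
    qed (rule finite_cells)
    have sub: "cells P \<rightarrow>\<^sub>E {lo..hi} \<subseteq> nonneg_vectors P"
      unfolding nonneg_vectors_def using lo0 by (intro PiE_mono) auto
    \<comment> \<open>By the bounds every nonnegative solution lies in the box, so uniqueness there
      is uniqueness among all nonnegative vectors.\<close>
    have "w \<in> nonneg_vectors P \<and> (\<forall>i\<in>cells P. scheme P n i v w = 0)
        \<longleftrightarrow> w \<in> cells P \<rightarrow>\<^sub>E {lo..hi} \<and> (\<forall>i\<in>cells P. scheme P n i v w = 0)" for w
      using bounds[of w] subsetD[OF sub, of w] by argo
    then show ?thesis using box_unique by (simp only:)
  qed
  show ?thesis
    unfolding Let_def v_def[symmetric] lo_def[symmetric] hi_def[symmetric]
    by (rule conjI, intro ballI impI, erule (1) bounds, intro impI, erule unique)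
qed

end
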